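(* Let $E$ be an arbitrary directed graph, $K$ a field, $L=L_K(E)$ the Leavitt path algebra of $E$ over $K$, and let $I$ be a non-graded two-sided ideal of $L$. If $H=I\cap E^0$ and $S=\{v\in B_H: v^H\in I\}$, then $\bigcap_{n=1}^{\infty}I^n=I(H,S)$, the largest graded ideal of $L$ contained in $I$.
   Context: A directed graph $E=(E^0,E^1,r,s)$ consists of sets $E^0$ (vertices) and $E^1$ (edges), of arbitrary cardinality, with maps $r,s:E^1\to E^0$ (range, source). A vertex $v$ is regular if $s^{-1}(v)$ is finite and non-empty, and an infinite emitter if $s^{-1}(v)$ is infinite. The Leavitt path algebra $L_K(E)$ is the (not necessarily unital) $K$-algebra generated by pairwise orthogonal idempotents $\{v:v\in E^0\}$ and elements $\{e,e^*:e\in E^1\}$ subject to: (1) $s(e)e=e=er(e)$; (2) $r(e)e^*=e^*=e^*s(e)$; (3) $e^*e=r(e)$ and $e^*f=0$ for edges $e\ne f$; (4) $v=\sum_{s(e)=v}ee^*$ for every regular vertex $v$. It is $\mathbb{Z}$-graded, $L=\bigoplus_n L_n$, by $\deg v=0$, $\deg e=1$, $\deg e^*=-1$; an ideal $I$ is graded if $I=\bigoplus_n(I\cap L_n)$, and non-graded otherwise. Write $u\ge v$ if there is a (directed, possibly length-zero) path from $u$ to $v$. A set $H\subseteq E^0$ is hereditary if $v\in H$, $v\ge w$ imply $w\in H$; a hereditary set is saturated if for every regular vertex $v$, $r(s^{-1}(v))\subseteq H$ implies $v\in H$. (For any ideal $I$, $I\cap E^0$ is hereditary and saturated.) For $H$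 hereditary saturated, $B_H$ (the breaking vertices) is the set of infinite emitters $w\in E^0\setminus H$ with $0<|s^{-1}(w)\cap r^{-1}(E^0\setminus H)|<\infty$; for $v\in B_H$, $v^H=v-\sum_{s(e)=v,\,r(e)\notin H}ee^*$. For $S\subseteq B_H$, $I(H,S)$ is the two-sided ideal generated by $H\cup\{v^H:v\in S\}$. *)

theory Defs
  imports
    "HOL-Library.Poly_Mapping"
    "HOL-Algebra.Ideal_Product"
    "HOL-Algebra.QuotRing"
    "HOL-Algebra.Module"
    "Graph_Theory.Digraph"
begin

text \<open>
  Directed graphs are the structures of \<^theory>\<open>Graph_Theory.Digraph\<close> satisfying
  \<^locale>\<open>wf_digraph\<close>: parallel arcs and loops are allowed, and the sets of vertices and arcs may
  have any cardinality. The source map is \<^const>\<open>tail\<close> and the range map is \<^const>\<open>head\<close>.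
\<close>

definition regular_vertex :: "('v, 'e) pre_digraph \<Rightarrow> 'v \<Rightarrow> bool" where
  "regular_vertex E v \<longleftrightarrow> v \<in> verts E \<and> finite (out_arcs E v) \<and> out_arcs E v \<noteq> {}"

definition infinite_emitter :: "('v, 'e) pre_digraph \<Rightarrow> 'v \<Rightarrow> bool" where
  "infinite_emitter E v \<longleftrightarrow> v \<in> verts E \<and> infinite (out_arcs E v)"

definition arcs_leaving :: "('v, 'e) pre_digraph \<Rightarrow> 'v set \<Rightarrow> 'v \<Rightarrow> 'e set" where
  "arcs_leaving E H v = {e \<in> out_arcs E v. head E e \<notin> H}"

definition breaking_vertices :: "('v, 'e) pre_digraph \<Rightarrow> 'v set \<Rightarrow> 'v set" where
  "breaking_vertices E H =
     {w \<in> verts E - H. infinite_emitter E w \<and> finite (arcs_leaving E H w) \<and> arcs_leaving E H w \<noteq> {}}"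


section \<open>The free non-unital algebra\<close>

datatype ('v, 'e) letter = Vertex 'v | Edge 'e | Ghost 'e

text \<open>
  Words form the free monoid, written additively because the convolution product of
  \<^theory>\<open>HOL-Library.Poly_Mapping\<close> expects this. Thus the type of finitely supported functions
  from words to \<open>'k\<close> is the free unital algebra on all letters.
\<close>

datatype ('v, 'e) word = Word (letters: "('v, 'e) letter list")

instantiation word :: (type, type) monoid_add
begin

definition zero_word :: "('a, 'b) word" where
  "0 = Word []"

definition plus_word :: "('a, 'b) word \<Rightarrow> ('a, 'b) word \<Rightarrow> ('a, 'b) word" where
  "u + w = Word (letters u @ letters w)"

instance
  by standard (simp_all add: zero_word_def plus_word_def)

end

type_synonym ('k, 'v, 'e) free_alg = "('v, 'e) word \<Rightarrow>\<^sub>0 'k"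

definition gen :: "('v, 'e) letter \<Rightarrow> ('k::field, 'v, 'e) free_alg" where
  "gen x = Poly_Mapping.single (Word [x]) 1"

definition graph_letters :: "('v, 'e) pre_digraph \<Rightarrow> ('v, 'e) letter set" where
  "graph_letters E = Vertex ` verts E \<union> Edge ` arcs E \<union> Ghost ` arcs E"

text \<open>
  The carrier consists of the linear combinations of \<^emph>\<open>nonempty\<close> words in the letters of the
  graph, so it does not contain the empty word \<open>1\<close>. The field \<^const>\<open>one\<close>, which the record type
  forces us to fill, has no meaning here, nor does it have one in the quotient below.
\<close>

definition free_lpa :: "('v, 'e) pre_digraph \<Rightarrow> ('k::field, ('k, 'v, 'e) free_alg) module" where
  "free_lpa E =
     \<lparr>carrier = {p. \<forall>w \<in> Poly_Mapping.keys p. letters w \<noteq> [] \<and> set (letters w) \<subseteq> graph_letters E},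
      mult = (*), one = 1, zero = 0, add = (+),
      smult = (\<lambda>c p. Poly_Mapping.single 0 c * p)\<rparr>"


section \<open>Two-sided ideals of rings without unit\<close>

text \<open>
  The library's locale \<^locale>\<open>ideal\<close> presupposes a ring with unit. The notions below use only the
  additive group and the multiplication. Closure under scalars is not required: since Leavitt path
  algebras have local units, it is automatic for their ideals.
\<close>

definition two_sided_ideal :: "('a, 'm) ring_scheme \<Rightarrow> 'a set \<Rightarrow> bool" where
  "two_sided_ideal R I \<longleftrightarrow> additive_subgroup I R \<and>
     (\<forall>a \<in> I. \<forall>x \<in> carrier R. x \<otimes>\<^bsub>R\<^esub> a \<in> I \<and> a \<otimes>\<^bsub>R\<^esub> x \<in> I)"

definition ideal_generated :: "('a, 'm) ring_scheme \<Rightarrow> 'a set \<Rightarrow> 'a set" where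
  "ideal_generated R X = \<Inter> {I. two_sided_ideal R I \<and> X \<subseteq> I}"

fun ideal_power :: "('a, 'm) ring_scheme \<Rightarrow> 'a set \<Rightarrow> nat \<Rightarrow> 'a set" where
  "ideal_power R I 0 = carrier R"
| "ideal_power R I (Suc 0) = I"
| "ideal_power R I (Suc (Suc n)) = ideal_prod R (ideal_power R I (Suc n)) I"


section \<open>Leavitt path algebras\<close>

definition lpa_relators :: "('v, 'e) pre_digraph \<Rightarrow> ('k::field, 'v, 'e) free_alg set" where
  "lpa_relators E =
     {gen (Vertex v) * gen (Vertex v) - gen (Vertex v) | v. v \<in> verts E} \<union>
     {gen (Vertex u) * gen (Vertex v) | u v. u \<in> verts E \<and> v \<in> verts E \<and> u \<noteq> v} \<union>
     {gen (Vertex (tail E e)) * gen (Edge e) - gen (Edge e) | e. e \<in> arcs E} \<union>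
     {gen (Edge e) * gen (Vertex (head E e)) - gen (Edge e) | e. e \<in> arcs E} \<union>
     {gen (Vertex (head E e)) * gen (Ghost e) - gen (Ghost e) | e. e \<in> arcs E} \<union>
     {gen (Ghost e) * gen (Vertex (tail E e)) - gen (Ghost e) | e. e \<in> arcs E} \<union>
     {gen (Ghost e) * gen (Edge e) - gen (Vertex (head E e)) | e. e \<in> arcs E} \<union>
     {gen (Ghost e) * gen (Edge f) | e f. e \<in> arcs E \<and> f \<in> arcs E \<and> e \<noteq> f} \<union>
     {gen (Vertex v) - (\<Sum>e \<in> out_arcs E v. gen (Edge e) * gen (Ghost e)) | v. regular_vertex E v}"

text \<open>
  The free algebra has no local units, so here scalar multiples must be put in explicitly: the
  ring ideal generated by all scalar multiples of the relators is the algebra ideal generated by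
  the relators.
\<close>

definition lpa_relation_ideal :: "('v, 'e) pre_digraph \<Rightarrow> ('k::field, 'v, 'e) free_alg set" where
  "lpa_relation_ideal E =
     ideal_generated (free_lpa E) {c \<odot>\<^bsub>free_lpa E\<^esub> p | c p. p \<in> lpa_relators E}"

definition lpa_class :: "('v, 'e) pre_digraph \<Rightarrow> ('k::field, 'v, 'e) free_alg \<Rightarrow> ('k, 'v, 'e) free_alg set"
  where "lpa_class E p = lpa_relation_ideal E +>\<^bsub>free_lpa E\<^esub> p"

definition leavitt_path_algebra ::
    "('v, 'e) pre_digraph \<Rightarrow> ('k::field, ('k, 'v, 'e) free_alg set) module" where
  "leavitt_path_algebra E =
     ring.extend (free_lpa E Quot lpa_relation_ideal E)
       (module.fields (\<lambda>c X. \<Union>p \<in> X. lpa_class E (c \<odot>\<^bsub>free_lpa E\<^esub> p)))"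

abbreviation lpa_vertex :: "('v, 'e) pre_digraph \<Rightarrow> 'v \<Rightarrow> ('k::field, 'v, 'e) free_alg set" where
  "lpa_vertex E v \<equiv> lpa_class E (gen (Vertex v))"

abbreviation lpa_edge :: "('v, 'e) pre_digraph \<Rightarrow> 'e \<Rightarrow> ('k::field, 'v, 'e) free_alg set" where
  "lpa_edge E e \<equiv> lpa_class E (gen (Edge e))"

abbreviation lpa_ghost :: "('v, 'e) pre_digraph \<Rightarrow> 'e \<Rightarrow> ('k::field, 'v, 'e) free_alg set" where
  "lpa_ghost E e \<equiv> lpa_class E (gen (Ghost e))"


subsection \<open>The grading\<close>

fun letter_degree :: "('v, 'e) letter \<Rightarrow> int" where
  "letter_degree (Vertex v) = 0"
| "letter_degree (Edge e) = 1"
| "letter_degree (Ghost e) = -1"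

definition word_degree :: "('v, 'e) word \<Rightarrow> int" where
  "word_degree w = sum_list (map letter_degree (letters w))"

definition lpa_component :: "('v, 'e) pre_digraph \<Rightarrow> int \<Rightarrow> ('k::field, 'v, 'e) free_alg set set" where
  "lpa_component E n =
     lpa_class E ` {p \<in> carrier (free_lpa E). \<forall>w \<in> Poly_Mapping.keys p. word_degree w = n}"

text \<open>
  This says that \<open>I\<close> is the internal direct sum of the \<open>I \<inter> L\<^sub>n\<close>: every element of \<open>I\<close> is in a
  unique way a finite sum of elements of these. (All such sums are in \<open>I\<close>, as \<open>I\<close> is an ideal.)
\<close>

definition graded_ideal ::
    "('v, 'e) pre_digraph \<Rightarrow> ('k::field, 'v, 'e) free_alg set set \<Rightarrow> bool" where
  "graded_ideal E I \<longleftrightarrow> two_sided_ideal (leavitt_path_algebra E) I \<and>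
     (\<forall>x \<in> I. \<exists>!f :: int \<Rightarrow> _.
        (\<forall>n. f n \<in> I \<inter> lpa_component E n) \<and>
        finite {n. f n \<noteq> \<zero>\<^bsub>leavitt_path_algebra E\<^esub>} \<and>
        x = (\<Oplus>\<^bsub>leavitt_path_algebra E\<^esub>n \<in> {n. f n \<noteq> \<zero>\<^bsub>leavitt_path_algebra E\<^esub>}. f n))"


subsection \<open>The ideals \<open>I(H,S)\<close>\<close>

definition breaking_element ::
    "('v, 'e) pre_digraph \<Rightarrow> 'v set \<Rightarrow> 'v \<Rightarrow> ('k::field, 'v, 'e) free_alg set" where
  "breaking_element E H v =
     lpa_vertex E v \<ominus>\<^bsub>leavitt_path_algebra E\<^esub>
       (\<Oplus>\<^bsub>leavitt_path_algebra E\<^esub>e \<in> arcs_leaving E H v.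
          lpa_edge E e \<otimes>\<^bsub>leavitt_path_algebra E\<^esub> lpa_ghost E e)"

definition ideal_HS ::
    "('v, 'e) pre_digraph \<Rightarrow> 'v set \<Rightarrow> 'v set \<Rightarrow> ('k::field, 'v, 'e) free_alg set set" where
  "ideal_HS E H S =
     ideal_generated (leavitt_path_algebra E) (lpa_vertex E ` H \<union> breaking_element E H ` S)"

end

theory Submission
  imports Defs "Graph_Theory.Arc_Walk" "HOL-Computational_Algebra.Polynomial"
begin

text \<open>
  Let \<open>J = I(H,S)\<close>. It is homogeneous, and it lies in every power of \<open>I\<close> because its generators are
  idempotents of \<open>I\<close>. Suppose that an ideal \<open>T\<close> contained in \<open>I\<close> is not contained in \<open>J\<close>. Multiplying
  an element of \<open>T - J\<close> by paths and ghost paths yields an element \<open>g\<close> of \<open>T\<close> that is, modulo \<open>J\<close>, a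
  combination of a vertex \<open>u\<close> outside \<open>H\<close> (with coefficient \<open>k \<noteq> 0\<close>) and of closed walks at \<open>u\<close>; the
  reduction could only get stuck at some \<open>w\<^sup>H\<close> with \<open>w \<notin> S\<close>, which would then lie in \<open>I\<close>. If \<open>T\<close> is
  graded, the part of degree 0 shows that \<open>u\<close> is in \<open>I\<close>, a contradiction. If \<open>T\<close> is the intersection of
  the powers of \<open>I\<close>, choose \<open>g\<close> with as few closed walks as possible. Then these walks have no exits
  modulo \<open>J\<close>, so they are powers of a single cycle \<open>c\<close>, and \<open>g = p(c)\<close> for a polynomial \<open>p \<noteq> 0\<close>. Let
  \<open>f\<close> be a polynomial of least degree with \<open>f(c) \<in> I\<close>. Comparing coefficients of paths ending at \<open>u\<close>
  shows that \<open>I u\<close> consists of left multiples of \<open>f(c)\<close> modulo \<open>J\<close>. Hence \<open>f\<^sup>n\<close> divides \<open>p\<close> for every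
  \<open>n\<close>, although \<open>f\<close> is not constant.
\<close>

text \<open>No basis of \<open>L\<close> and no matrix description of an ideal is available, so that
  an element is nonzero modulo \<open>J\<close> has to come from degrees: \<open>J\<close> is
  homogeneous and closed walks of positive length have positive degree, so the part of degree 0 of k
  u + (closed walks) is k u, and u is not in \<open>I\<close> since \<open>H\<close> collects all
  vertices of \<open>I\<close>. The obstacle in the reduction is an infinite emitter w. It satisfies
  no relation that expands w, and right multiplication by any arc sends \<open>w\<^sup>H\<close>
  into \<open>J\<close>, so stripping ghost arcs makes no progress on y \<open>w\<^sup>H\<close>.
  Membership of \<open>w\<^sup>H\<close> in \<open>I\<close> is then forced by multiplying a special
  element by \<open>w\<^sup>H\<close> on both sides. The cycle is invertible modulo \<open>J\<close>
  in the corner at u, so Laurent polynomials would be the natural ring. Ordinary polynomials do as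
  well: a high power of the cycle absorbs every ghost path, and it can be cancelled afterwards
  because the constant coefficient of f is not 0.\<close>

definition ring_ideal :: "'a::ring_1 set \<Rightarrow> bool" where
  "ring_ideal A \<longleftrightarrow> 0 \<in> A \<and> (\<forall>a \<in> A. \<forall>b \<in> A. a + b \<in> A) \<and> (\<forall>a \<in> A. \<forall>x. x * a \<in> A \<and> a * x \<in> A)"

lemma ring_idealI:
  assumes "0 \<in> A" and "\<And>a b. a \<in> A \<Longrightarrow> b \<in> A \<Longrightarrow> a + b \<in> A"
    and "\<And>a x. a \<in> A \<Longrightarrow> x * a \<in> A" and "\<And>a x. a \<in> A \<Longrightarrow> a * x \<in> A"
  shows "ring_ideal A"
  using assms by (simp add: ring_ideal_def)

lemma
  assumes "ring_ideal A"
  shows ring_ideal_zero: "0 \<in> A"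
    and ring_ideal_add: "a \<in> A \<Longrightarrow> b \<in> A \<Longrightarrow> a + b \<in> A"
    and ring_ideal_left: "a \<in> A \<Longrightarrow> x * a \<in> A"
    and ring_ideal_right: "a \<in> A \<Longrightarrow> a * x \<in> A"
  using assms by (auto simp: ring_ideal_def)

lemma ring_ideal_uminus: "ring_ideal A \<Longrightarrow> a \<in> A \<Longrightarrow> - a \<in> A"
  using ring_ideal_left[of A a "- 1"] by simp

lemma ring_ideal_diff: "ring_ideal A \<Longrightarrow> a \<in> A \<Longrightarrow> b \<in> A \<Longrightarrow> a - b \<in> A"
  using ring_ideal_add[of A a "- b"] ring_ideal_uminus[of A b] by simp

lemma ring_ideal_sum: "ring_ideal A \<Longrightarrow> (\<And>i. i \<in> S \<Longrightarrow> f i \<in> A) \<Longrightarrow> sum f S \<in> A"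
  by (induction S rule: infinite_finite_induct) (auto intro: ring_ideal_zero ring_ideal_add)

section \<open>Restricting finitely supported functions\<close>

text \<open>Used for two projections: onto the words of a given degree, and, as
  \<open>prune\<close>, onto the words in the letters of the graph.\<close>

definition restrict_keys :: "('a \<Rightarrow> bool) \<Rightarrow> ('a \<Rightarrow>\<^sub>0 'b::zero) \<Rightarrow> 'a \<Rightarrow>\<^sub>0 'b" where
  "restrict_keys P p = Poly_Mapping.mapp (\<lambda>w c. c when P w) p"

lemma lookup_restrict_keys:
  "Poly_Mapping.lookup (restrict_keys P p) w = (Poly_Mapping.lookup p w when P w)"
  by (auto simp: restrict_keys_def lookup_mapp when_def in_keys_iff)

lemma keys_restrict_keys: "Poly_Mapping.keys (restrict_keys P p) = {w \<in> Poly_Mapping.keys p. P w}"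
  by (auto simp: in_keys_iff lookup_restrict_keys when_def split: if_splits)

lemma restrict_keys_zero [simp]: "restrict_keys P 0 = 0"
  by (rule poly_mapping_eqI) (simp add: lookup_restrict_keys)

lemma restrict_keys_add: "restrict_keys P (p + q) = restrict_keys P p + restrict_keys P q"
  by (rule poly_mapping_eqI) (simp add: lookup_restrict_keys lookup_add when_add_distrib)

lemma restrict_keys_uminus: "restrict_keys P (- p) = - restrict_keys P (p :: _ \<Rightarrow>\<^sub>0 _::ab_group_add)"
  by (rule poly_mapping_eqI) (simp add: lookup_restrict_keys when_def)

lemma restrict_keys_diff:
  "restrict_keys P (p - q) = restrict_keys P p - restrict_keys P (q :: _ \<Rightarrow>\<^sub>0 _::ab_group_add)"
  by (rule poly_mapping_eqI) (simp add: lookup_restrict_keys when_def lookup_minus)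

lemma restrict_keys_sum: "restrict_keys P (sum f S) = (\<Sum>i\<in>S. restrict_keys P (f i))"
  by (induction S rule: infinite_finite_induct) (auto simp: restrict_keys_add)

lemma restrict_keys_commute:
  "restrict_keys P (restrict_keys Q p) = restrict_keys Q (restrict_keys P p)"
  by (rule poly_mapping_eqI) (simp add: lookup_restrict_keys when_def)

lemma restrict_keys_single:
  "restrict_keys P (Poly_Mapping.single w c) = (if P w then Poly_Mapping.single w c else 0)"
  by (rule poly_mapping_eqI) (simp add: lookup_restrict_keys lookup_single when_def)

lemma restrict_keys_id: "(\<And>w. w \<in> Poly_Mapping.keys p \<Longrightarrow> P w) \<Longrightarrow> restrict_keys P p = p"
  by (rule poly_mapping_eqI) (auto simp: lookup_restrict_keys when_def in_keys_iff)

lemma restrict_keys_eq_zero: "(\<And>w. w \<in> Poly_Mapping.keys p \<Longrightarrow> \<not> P w) \<Longrightarrow> restrict_keys P p = 0"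
  by (rule poly_mapping_eqI) (auto simp: lookup_restrict_keys when_def in_keys_iff)

lemma poly_mapping_sum_singles:
  "p = (\<Sum>w\<in>Poly_Mapping.keys p. Poly_Mapping.single w (Poly_Mapping.lookup p w))"
  by (rule poly_mapping_eqI)
     (simp add: lookup_sum lookup_single when_def sum.delta in_keys_iff)

lemma poly_mapping_additive_induct [case_names zero single add]:
  fixes p :: "'a \<Rightarrow>\<^sub>0 'b::comm_monoid_add"
  assumes "P 0" and "\<And>w c. P (Poly_Mapping.single w c)" and "\<And>p q. P p \<Longrightarrow> P q \<Longrightarrow> P (p + q)"
  shows "P p"
proof -
  have "P (\<Sum>w\<in>S. Poly_Mapping.single w (Poly_Mapping.lookup p w))" for S
    by (induction S rule: infinite_finite_induct) (auto intro: assms)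
  then show ?thesis
    using poly_mapping_sum_singles[of p] by metis
qed

lemma restrict_keys_single_mult:
  fixes p :: "'a::monoid_add \<Rightarrow>\<^sub>0 'b::semiring_0"
  assumes "\<And>w'. P (w + w') \<longleftrightarrow> Q w'"
  shows "restrict_keys P (Poly_Mapping.single w c * p) = Poly_Mapping.single w c * restrict_keys Q p"
  by (induction p rule: poly_mapping_additive_induct)
     (simp_all add: restrict_keys_add distrib_left mult_single restrict_keys_single assms)

lemma restrict_keys_mult_single:
  fixes p :: "'a::monoid_add \<Rightarrow>\<^sub>0 'b::semiring_0"
  assumes "\<And>w'. P (w' + w) \<longleftrightarrow> Q w'"
  shows "restrict_keys P (p * Poly_Mapping.single w c) = restrict_keys Q p * Poly_Mapping.single w c"
  by (induction p rule: poly_mapping_additive_induct)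
     (simp_all add: restrict_keys_add distrib_right mult_single restrict_keys_single assms)

text \<open>The words violating \<open>P\<close> absorb products from both sides, so projecting them
  away is multiplicative.\<close>

lemma restrict_keys_mult:
  fixes p q :: "'a::monoid_add \<Rightarrow>\<^sub>0 'b::semiring_0"
  assumes "\<And>w w'. P (w + w') \<longleftrightarrow> P w \<and> P w'"
  shows "restrict_keys P (p * q) = restrict_keys P p * restrict_keys P q"
proof (induction p rule: poly_mapping_additive_induct)
  case (single w c)
  show ?case
  proof (cases "P w")
    case True
    then show ?thesis
      using restrict_keys_single_mult[of P w P c q] assms by (simp add: restrict_keys_single)
  next
    case False
    then show ?thesis
      using restrict_keys_single_mult[of P w "\<lambda>_. False" c q] assms
      by (simp add: restrict_keys_single restrict_keys_eq_zero)
  qed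
qed (simp_all add: restrict_keys_add distrib_right)

section \<open>Homogeneous parts in the free algebra\<close>

abbreviation hom_part :: "int \<Rightarrow> ('k::zero, 'v, 'e) free_alg \<Rightarrow> ('k, 'v, 'e) free_alg" where
  "hom_part n \<equiv> restrict_keys (\<lambda>w. word_degree w = n)"

lemma word_degree_add: "word_degree (u + w) = word_degree u + word_degree w"
  by (simp add: word_degree_def plus_word_def)

lemma word_degree_zero [simp]: "word_degree 0 = 0"
  by (simp add: word_degree_def zero_word_def)

lemma hom_part_single_mult:
  "hom_part n (Poly_Mapping.single w c * p) =
     Poly_Mapping.single w c * hom_part (n - word_degree w) (p :: ('k::semiring_0, 'v, 'e) free_alg)"
  by (rule restrict_keys_single_mult) (auto simp: word_degree_add)

lemma hom_part_mult_single:
  "hom_part n (p * Poly_Mapping.single w c) =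
     hom_part (n - word_degree w) (p :: ('k::semiring_0, 'v, 'e) free_alg) * Poly_Mapping.single w c"
  by (rule restrict_keys_mult_single) (auto simp: word_degree_add)

text \<open>For the preimage of an ideal of \<open>L\<close> this amounts to the ideal being
  graded.\<close>

definition homogeneous_closed :: "('k::zero, 'v, 'e) free_alg set \<Rightarrow> bool" where
  "homogeneous_closed A \<longleftrightarrow> (\<forall>p \<in> A. \<forall>n. hom_part n p \<in> A)"

lemma sum_hom_parts:
  fixes p :: "('k::comm_monoid_add, 'v, 'e) free_alg"
  assumes "finite D" and "word_degree ` Poly_Mapping.keys p \<subseteq> D"
  shows "(\<Sum>n\<in>D. hom_part n p) = p"
proof (rule poly_mapping_eqI)
  fix w
  have "(\<Sum>n\<in>D. Poly_Mapping.lookup p w when word_degree w = n) =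
      (if word_degree w \<in> D then Poly_Mapping.lookup p w else 0)"
    using assms(1) by (simp add: when_def)
  also have "\<dots> = Poly_Mapping.lookup p w"
    using assms(2) by (cases "w \<in> Poly_Mapping.keys p") (auto simp: in_keys_iff)
  finally show "Poly_Mapping.lookup (\<Sum>n\<in>D. hom_part n p) w = Poly_Mapping.lookup p w"
    by (simp add: lookup_sum lookup_restrict_keys)
qed

text \<open>Multiples of the empty word are central, so scalar multiplication becomes ring
  multiplication, and ideals of the unital free algebra are closed under it without further
  assumptions.\<close>

definition scal :: "'k::field \<Rightarrow> ('k, 'v, 'e) free_alg" where
  "scal k = Poly_Mapping.single 0 k"

lemma scal_commute: "scal k * p = p * scal k"
  by (induction p rule: poly_mapping_additive_induct)
     (simp_all add: scal_def mult_single distrib_left distrib_right mult.commute)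

lemma scal_commute_left: "p * (scal k * q) = scal k * (p * q)"
  using scal_commute[of k p] by (simp add: mult.assoc[symmetric])

lemma scal_zero [simp]: "scal 0 = 0" by (simp add: scal_def)
lemma scal_one [simp]: "scal 1 = 1" by (simp add: scal_def)
lemma scal_add: "scal (a + b) = scal a + scal b" by (simp add: scal_def single_add)
lemma scal_uminus: "scal (- a) = - scal a" by (simp add: scal_def single_uminus)
lemma scal_mult: "scal (a * b) = scal a * scal b" by (simp add: scal_def mult_single)
lemma scal_cancel: "k \<noteq> 0 \<Longrightarrow> scal (inverse k) * (scal k * p) = p"
  by (simp add: mult.assoc[symmetric] scal_mult[symmetric])

lemma single_word_Cons: "Poly_Mapping.single (Word (x # l)) c = gen x * Poly_Mapping.single (Word l) c"
  by (simp add: gen_def mult_single plus_word_def)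

lemma single_word: "Poly_Mapping.single (Word l) c = scal c * prod_list (map gen l)"
  by (induction l) (simp_all add: scal_def[symmetric] zero_word_def[symmetric] single_word_Cons scal_commute_left)

lemma hom_part_scal_mult: "hom_part n (scal k * p) = scal k * hom_part n p"
  using hom_part_single_mult[of n 0 k p] by (simp add: scal_def)

abbreviation vtx :: "'v \<Rightarrow> ('k::field, 'v, 'e) free_alg" where "vtx v \<equiv> gen (Vertex v)"
abbreviation edg :: "'e \<Rightarrow> ('k::field, 'v, 'e) free_alg" where "edg e \<equiv> gen (Edge e)"
abbreviation gho :: "'e \<Rightarrow> ('k::field, 'v, 'e) free_alg" where "gho e \<equiv> gen (Ghost e)"

text \<open>A path is given by its list of edges and its range \<open>w\<close>; the empty list stands for the vertex \<open>w\<close>.\<close>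

definition edges :: "'e list \<Rightarrow> ('k::field, 'v, 'e) free_alg" where
  "edges \<alpha> = prod_list (map edg \<alpha>)"

definition ghosts :: "'e list \<Rightarrow> ('k::field, 'v, 'e) free_alg" where
  "ghosts \<alpha> = prod_list (map gho (rev \<alpha>))"

lemma edges_simps [simp]:
  "edges [] = 1" "edges (e # \<alpha>) = edg e * edges \<alpha>" "edges (\<alpha> @ \<beta>) = edges \<alpha> * edges \<beta>"
  by (simp_all add: edges_def)

lemma ghosts_simps [simp]:
  "ghosts [] = 1" "ghosts (e # \<alpha>) = ghosts \<alpha> * gho e" "ghosts (\<alpha> @ \<beta>) = ghosts \<beta> * ghosts \<alpha>"
  by (simp_all add: ghosts_def)

abbreviation real_path :: "'v \<Rightarrow> 'e list \<Rightarrow> ('k::field, 'v, 'e) free_alg" where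
  "real_path w \<alpha> \<equiv> edges \<alpha> * vtx w"

abbreviation ghost_path :: "'v \<Rightarrow> 'e list \<Rightarrow> ('k::field, 'v, 'e) free_alg" where
  "ghost_path w \<alpha> \<equiv> vtx w * ghosts \<alpha>"

section \<open>Calculating modulo an ideal that contains the relators\<close>

text \<open>\<open>J\<close> is an ideal of the whole unital free algebra. Letters foreign to the
  graph are required to lie in it, so that identities such as \<open>tail_edg\<close> hold for every
  letter of the type: for a foreign letter both sides vanish. The locale serves both for the
  relation ideal itself and for larger ideals such as I(H,S).\<close>

locale lpa_congruence = wf_digraph E for E :: "('v, 'e) pre_digraph" +
  fixes J :: "('k::field, 'v, 'e) free_alg set"
  assumes ideal_J: "ring_ideal J"
    and relators: "lpa_relators E \<subseteq> J"
    and other_letters: "x \<notin> graph_letters E \<Longrightarrow> gen x \<in> J"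
begin

definition cong (infix "\<approx>" 50) where "a \<approx> b \<longleftrightarrow> a - b \<in> J"

lemma cong_refl [simp, intro]: "a \<approx> a"
  by (simp add: cong_def ring_ideal_zero[OF ideal_J])

lemma cong_sym: "a \<approx> b \<Longrightarrow> b \<approx> a"
  using ring_ideal_uminus[OF ideal_J, of "a - b"] by (simp add: cong_def)

lemma cong_trans [trans]: "a \<approx> b \<Longrightarrow> b \<approx> c \<Longrightarrow> a \<approx> c"
  using ring_ideal_add[OF ideal_J, of "a - b" "b - c"] by (simp add: cong_def)

lemma cong_add: "a \<approx> a' \<Longrightarrow> b \<approx> b' \<Longrightarrow> a + b \<approx> a' + b'"
  using ring_ideal_add[OF ideal_J, of "a - a'" "b - b'"] by (simp add: cong_def algebra_simps)

lemma cong_diff: "a \<approx> a' \<Longrightarrow> b \<approx> b' \<Longrightarrow> a - b \<approx> a' - b'"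
  using ring_ideal_diff[OF ideal_J, of "a - a'" "b - b'"] by (simp add: cong_def algebra_simps)

lemma cong_left: "a \<approx> b \<Longrightarrow> x * a \<approx> x * b"
  using ring_ideal_left[OF ideal_J, of "a - b" x] by (simp add: cong_def algebra_simps)

lemma cong_right: "a \<approx> b \<Longrightarrow> a * x \<approx> b * x"
  using ring_ideal_right[OF ideal_J, of "a - b" x] by (simp add: cong_def algebra_simps)

lemma cong_mult3: "a \<approx> b \<Longrightarrow> x * a * y \<approx> x * b * y"
  by (intro cong_right cong_left)

lemma cong_sum: "(\<And>i. i \<in> S \<Longrightarrow> f i \<approx> g i) \<Longrightarrow> sum f S \<approx> sum g S"
  by (induction S rule: infinite_finite_induct) (auto intro: cong_add)

lemma cong_zero_iff: "a \<approx> 0 \<longleftrightarrow> a \<in> J"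
  by (simp add: cong_def)

lemma cong_ideal: "a \<approx> b \<Longrightarrow> ring_ideal T \<Longrightarrow> J \<subseteq> T \<Longrightarrow> a \<in> T \<longleftrightarrow> b \<in> T"
  using ring_ideal_add[of T "a - b" b] ring_ideal_diff[of T a "a - b"] by (auto simp: cong_def)

lemma cong_J: "a \<approx> b \<Longrightarrow> a \<in> J \<longleftrightarrow> b \<in> J"
  by (rule cong_ideal) (auto simp: ideal_J)

lemma gen_cong_zero: "x \<notin> graph_letters E \<Longrightarrow> gen x \<approx> 0"
  by (simp add: cong_zero_iff other_letters)

lemma not_vert: "v \<notin> verts E \<Longrightarrow> vtx v \<approx> 0"
  by (rule gen_cong_zero) (auto simp: graph_letters_def)

lemma not_arc: "e \<notin> arcs E \<Longrightarrow> edg e \<approx> 0" "e \<notin> arcs E \<Longrightarrow> gho e \<approx> 0"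
  by (auto intro!: gen_cong_zero simp: graph_letters_def)

lemma cong_relator: "a - b \<in> lpa_relators E \<Longrightarrow> a \<approx> b"
  using relators by (auto simp: cong_def)

lemma cong_zeroI1: "a \<approx> 0 \<Longrightarrow> x * a \<approx> 0"
  using cong_left[of a 0 x] by simp

lemma cong_zeroI2: "a \<approx> 0 \<Longrightarrow> a * x \<approx> 0"
  using cong_right[of a 0 x] by simp

lemma vtx_idem: "vtx v * vtx v \<approx> vtx v"
proof (cases "v \<in> verts E")
  case True
  then show ?thesis by (intro cong_relator) (unfold lpa_relators_def, blast)
next
  case False
  then show ?thesis
    by (meson cong_sym cong_trans cong_zeroI1 not_vert)
qed

lemma vtx_orth: "u \<noteq> v \<Longrightarrow> vtx u * vtx v \<approx> 0"
proof (cases "u \<in> verts E \<and> v \<in> verts E")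
  case True
  moreover assume "u \<noteq> v"
  ultimately show ?thesis unfolding cong_zero_iff
    by (intro subsetD[OF relators]) (unfold lpa_relators_def, blast)
next
  case False
  then show ?thesis
    by (meson cong_zeroI1 cong_zeroI2 not_vert)
qed

lemma vtx_mult: "vtx u * vtx v \<approx> (if u = v then vtx v else 0)"
  by (simp add: vtx_idem vtx_orth)

lemma
  assumes "e \<in> arcs E"
  shows tail_edg': "vtx (tail E e) * edg e \<approx> edg e"
    and edg_head': "edg e * vtx (head E e) \<approx> edg e"
    and head_gho': "vtx (head E e) * gho e \<approx> gho e"
    and gho_tail': "gho e * vtx (tail E e) \<approx> gho e"
    and gho_edg: "gho e * edg e \<approx> vtx (head E e)"
  using assms by (intro cong_relator; unfold lpa_relators_def; blast)+

lemma cong_zero_eq: "a \<approx> 0 \<Longrightarrow> b \<approx> 0 \<Longrightarrow> a \<approx> b"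
  by (blast intro: cong_trans cong_sym)

lemma tail_edg: "vtx (tail E e) * edg e \<approx> edg e"
  by (cases "e \<in> arcs E") (auto intro: tail_edg' cong_zero_eq cong_zeroI1 not_arc)

lemma edg_head: "edg e * vtx (head E e) \<approx> edg e"
  by (cases "e \<in> arcs E") (auto intro: edg_head' cong_zero_eq cong_zeroI2 not_arc)

lemma head_gho: "vtx (head E e) * gho e \<approx> gho e"
  by (cases "e \<in> arcs E") (auto intro: head_gho' cong_zero_eq cong_zeroI1 not_arc)

lemma gho_tail: "gho e * vtx (tail E e) \<approx> gho e"
  by (cases "e \<in> arcs E") (auto intro: gho_tail' cong_zero_eq cong_zeroI2 not_arc)

lemma gho_edg_orth: "e \<noteq> f \<Longrightarrow> gho e * edg f \<approx> 0"
proof (cases "e \<in> arcs E \<and> f \<in> arcs E")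
  case True
  moreover assume "e \<noteq> f"
  ultimately show ?thesis unfolding cong_zero_iff
    by (intro subsetD[OF relators]) (unfold lpa_relators_def, blast)
next
  case False
  then show ?thesis
    by (meson cong_zeroI1 cong_zeroI2 not_arc)
qed

lemma regular: "regular_vertex E v \<Longrightarrow> vtx v \<approx> (\<Sum>e\<in>out_arcs E v. edg e * gho e)"
  by (intro cong_relator) (unfold lpa_relators_def, blast)

lemma vtx_edg: "vtx v * edg e \<approx> (if v = tail E e then edg e else 0)"
proof (cases "v = tail E e")
  case False
  have "vtx v * edg e \<approx> vtx v * (vtx (tail E e) * edg e)"
    by (intro cong_left cong_sym[OF tail_edg])
  also have "vtx v * (vtx (tail E e) * edg e) \<approx> 0"
    using cong_zeroI2[OF vtx_orth[OF False]] by (simp add: mult.assoc)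
  finally show ?thesis using False by simp
qed (simp add: tail_edg)

lemma gho_vtx: "gho e * vtx v \<approx> (if v = tail E e then gho e else 0)"
proof (cases "v = tail E e")
  case False
  have "gho e * vtx v \<approx> (gho e * vtx (tail E e)) * vtx v"
    by (intro cong_right cong_sym[OF gho_tail])
  also have "(gho e * vtx (tail E e)) * vtx v \<approx> 0"
    using cong_zeroI1[OF vtx_orth[of "tail E e" v]] False by (simp add: mult.assoc)
  finally show ?thesis using False by simp
qed (simp add: gho_tail)

lemma vtx_real_path:
  assumes "awalk u \<alpha> w"
  shows "vtx v * real_path w \<alpha> \<approx> (if v = u then real_path w \<alpha> else 0)"
proof (cases \<alpha>)
  case Nil
  then show ?thesis using assms vtx_mult[of v w] by (auto simp: awalk_Nil_iff)
next
  case (Cons e \<beta>)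
  then show ?thesis
    using assms cong_right[OF vtx_edg[of v e], of "edges \<beta> * vtx w"]
    by (auto simp: awalk_Cons_iff mult.assoc)
qed

lemma ghost_path_vtx:
  assumes "awalk u \<alpha> w"
  shows "ghost_path w \<alpha> * vtx v \<approx> (if v = u then ghost_path w \<alpha> else 0)"
proof (cases \<alpha>)
  case Nil
  then show ?thesis using assms vtx_mult[of w v] by (auto simp: awalk_Nil_iff)
next
  case (Cons e \<beta>)
  then show ?thesis
    using assms cong_left[OF gho_vtx[of e v], of "vtx w * ghosts \<beta>"]
    by (auto simp: awalk_Cons_iff mult.assoc)
qed

lemma real_path_append:
  assumes "awalk w \<beta> z"
  shows "real_path w \<alpha> * real_path z \<beta> \<approx> real_path z (\<alpha> @ \<beta>)"
  using cong_left[OF vtx_real_path[OF assms, of w], of "edges \<alpha>"] by (simp add: mult.assoc)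

lemma ghosts_edges:
  "awalk u \<alpha> w \<Longrightarrow> ghosts \<alpha> * (vtx u * edges \<alpha>) \<approx> vtx w"
proof (induction \<alpha> arbitrary: u)
  case Nil
  then show ?case by (simp add: awalk_Nil_iff)
next
  case (Cons e \<alpha>)
  then have e: "e \<in> arcs E" "tail E e = u" "awalk (head E e) \<alpha> w"
    by (auto simp: awalk_Cons_iff)
  have "ghosts (e # \<alpha>) * (vtx u * edges (e # \<alpha>)) = (ghosts \<alpha> * gho e) * (vtx (tail E e) * edg e) * edges \<alpha>"
    by (simp add: e mult.assoc)
  also have "\<dots> \<approx> (ghosts \<alpha> * gho e) * edg e * edges \<alpha>"
    by (intro cong_mult3 tail_edg)
  also have "\<dots> = ghosts \<alpha> * (gho e * edg e) * edges \<alpha>"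
    by (simp add: mult.assoc)
  also have "\<dots> \<approx> ghosts \<alpha> * vtx (head E e) * edges \<alpha>"
    by (intro cong_mult3 gho_edg e)
  also have "\<dots> = ghosts \<alpha> * (vtx (head E e) * edges \<alpha>)"
    by (simp add: mult.assoc)
  also have "\<dots> \<approx> vtx w" by (intro Cons.IH e)
  finally show ?case .
qed

lemma ghost_path_real_path_append:
  assumes "awalk u \<alpha> w" and "awalk w \<beta> z"
  shows "ghost_path w \<alpha> * real_path z (\<alpha> @ \<beta>) \<approx> real_path z \<beta>"
proof -
  have "awalk u (\<alpha> @ \<beta>) z" using assms by (auto intro: awalk_appendI)
  have "ghost_path w \<alpha> * real_path z (\<alpha> @ \<beta>) \<approx> ghost_path w \<alpha> * (vtx u * real_path z (\<alpha> @ \<beta>))"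
    using cong_left[OF cong_sym[OF vtx_real_path[OF \<open>awalk u (\<alpha> @ \<beta>) z\<close>, of u]]] by simp
  also have "\<dots> = vtx w * (ghosts \<alpha> * (vtx u * edges \<alpha>)) * (edges \<beta> * vtx z)"
    by (simp add: mult.assoc)
  also have "\<dots> \<approx> vtx w * vtx w * (edges \<beta> * vtx z)"
    by (intro cong_mult3 ghosts_edges assms)
  also have "\<dots> \<approx> vtx w * (edges \<beta> * vtx z)"
    by (intro cong_right vtx_idem)
  also have "\<dots> \<approx> real_path z \<beta>"
    using vtx_real_path[OF assms(2), of w] by simp
  finally show ?thesis .
qed

lemma ghost_path_real_path:
  assumes "awalk u \<alpha> w"
  shows "ghost_path w \<alpha> * real_path w \<alpha> \<approx> vtx w"
  using ghost_path_real_path_append[OF assms, of "[]" w] assms by (auto simp: awalk_Nil_iff)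

text \<open>Common initial arcs cancel by e^* e = r(e). As neither walk is a prefix of the other,
  two distinct arcs meet eventually, and e^* f = 0 applies.\<close>

lemma ghosts_edges_incomparable:
  assumes "awalk u \<alpha> w" and "awalk u \<beta> z"
    and "\<And>\<gamma>. \<beta> \<noteq> \<alpha> @ \<gamma>" and "\<And>\<gamma>. \<alpha> \<noteq> \<beta> @ \<gamma>"
  shows "ghosts \<alpha> * (vtx u * edges \<beta>) \<approx> 0"
  using assms
proof (induction \<alpha> arbitrary: \<beta> u)
  case Nil
  from Nil(3)[of \<beta>] show ?case by simp
next
  case (Cons e \<alpha>)
  then obtain f \<beta>' where \<beta>: "\<beta> = f # \<beta>'"
    by (metis append_Nil neq_Nil_conv)
  then have e: "e \<in> arcs E" "tail E e = u" "awalk (head E e) \<alpha> w"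
    and f: "tail E f = u" "awalk (head E f) \<beta>' z"
    using Cons.prems by (auto simp: awalk_Cons_iff)
  have "ghosts (e # \<alpha>) * (vtx u * edges \<beta>) = (ghosts \<alpha> * gho e) * (vtx (tail E f) * edg f) * edges \<beta>'"
    by (simp add: f \<beta> mult.assoc)
  also have "\<dots> \<approx> (ghosts \<alpha> * gho e) * edg f * edges \<beta>'"
    by (intro cong_mult3 tail_edg)
  also have "\<dots> = ghosts \<alpha> * (gho e * edg f) * edges \<beta>'"
    by (simp add: mult.assoc)
  also have "\<dots> \<approx> 0"
  proof (cases "e = f")
    case True
    have "ghosts \<alpha> * (gho e * edg f) * edges \<beta>' \<approx> ghosts \<alpha> * vtx (head E e) * edges \<beta>'"
      using True gho_edg[OF e(1)] by (intro cong_mult3) simp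
    also have "\<dots> = ghosts \<alpha> * (vtx (head E e) * edges \<beta>')"
      by (simp add: mult.assoc)
    also have "\<dots> \<approx> 0"
      using Cons.prems(3,4) by (intro Cons.IH e) (use f \<beta> True in auto)
    finally show ?thesis .
  next
    case False
    then show ?thesis
      by (intro cong_zeroI1 cong_zeroI2 gho_edg_orth)
  qed
  finally show ?case .
qed

text \<open>The multiplication table of ghost paths against paths. Equal paths belong to
  \<open>extends\<close>. The case \<open>orth\<close> does not exclude the others, because a path
  may itself be in \<open>J\<close>.\<close>

lemma ghost_path_real_path_cases:
  assumes "awalk u \<alpha> w" and "awalk u' \<beta> z"
  obtains (extends) \<gamma> where "u' = u" "\<beta> = \<alpha> @ \<gamma>"
  | (extended) \<gamma> where "u' = u" "\<alpha> = \<beta> @ \<gamma>" "\<gamma> \<noteq> []"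
  | (orth) "ghost_path w \<alpha> * real_path z \<beta> \<approx> 0"
proof -
  have *: "ghost_path w \<alpha> * real_path z \<beta> \<approx> ghost_path w \<alpha> * vtx u * real_path z \<beta>"
    using cong_right[OF cong_sym[OF ghost_path_vtx[OF assms(1), of u]]] by simp
  show thesis
  proof (cases "u' = u")
    case True
    show thesis
    proof (cases "(\<exists>\<gamma>. \<beta> = \<alpha> @ \<gamma>) \<or> (\<exists>\<gamma>. \<alpha> = \<beta> @ \<gamma>)")
      case True
      then show thesis
        using extends extended \<open>u' = u\<close> by (metis append_Nil2)
    next
      case False
      have "vtx w * (ghosts \<alpha> * (vtx u * edges \<beta>)) * vtx z \<approx> 0"
        using False assms \<open>u' = u\<close>
        by (intro cong_zeroI1 cong_zeroI2 ghosts_edges_incomparable[where z = z and w = w]) auto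
      then show thesis
        using * by (intro orth) (auto simp: mult.assoc intro: cong_trans)
    qed
  next
    case False
    have "ghost_path w \<alpha> * (vtx u * real_path z \<beta>) \<approx> 0"
      using vtx_real_path[OF assms(2), of u] False by (auto intro: cong_zeroI1[of "vtx u * real_path z \<beta>"])
    then show thesis
      using * by (intro orth) (auto simp: mult.assoc intro: cong_trans)
  qed
qed

lemma real_path_vtx: "real_path w \<alpha> * vtx w \<approx> real_path w \<alpha>"
  using cong_left[OF vtx_idem[of w], of "edges \<alpha>"] by (simp add: mult.assoc)

lemma real_path_edg:
  assumes "tail E e = w"
  shows "real_path w \<alpha> * edg e \<approx> real_path (head E e) (\<alpha> @ [e])"
proof -
  have "edges \<alpha> * (vtx w * edg e) \<approx> edges \<alpha> * edg e"
    using assms by (auto intro: cong_left tail_edg)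
  also have "\<dots> \<approx> edges \<alpha> * (edg e * vtx (head E e))"
    by (intro cong_left cong_sym[OF edg_head])
  finally show ?thesis by (simp add: mult.assoc)
qed

lemma edg_real_path:
  assumes "awalk u \<alpha> w"
  shows "edg e * real_path w \<alpha> \<approx> (if head E e = u then real_path w (e # \<alpha>) else 0)"
proof -
  have "edg e * real_path w \<alpha> \<approx> edg e * vtx (head E e) * real_path w \<alpha>"
    by (intro cong_right cong_sym[OF edg_head])
  also have "\<dots> = edg e * (vtx (head E e) * real_path w \<alpha>)"
    by (simp add: mult.assoc)
  also have "\<dots> \<approx> edg e * (if head E e = u then real_path w \<alpha> else 0)"
    by (intro cong_left vtx_real_path assms)
  finally show ?thesis by (auto simp: mult.assoc split: if_splits)
qed


section \<open>Spanning monomials\<close>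

abbreviation monomial :: "'e list \<Rightarrow> 'v \<Rightarrow> 'e list \<Rightarrow> ('k, 'v, 'e) free_alg" where
  "monomial \<alpha> z \<beta> \<equiv> edges \<alpha> * vtx z * ghosts \<beta>"

definition zero_or_monomial :: "('k, 'v, 'e) free_alg \<Rightarrow> bool" where
  "zero_or_monomial p \<longleftrightarrow> p \<approx> 0 \<or>
     (\<exists>u \<alpha> z w \<beta>. awalk u \<alpha> z \<and> awalk w \<beta> z \<and> p \<approx> monomial \<alpha> z \<beta>)"

lemma zero_or_monomial_zero: "p \<approx> 0 \<Longrightarrow> zero_or_monomial p"
  by (simp add: zero_or_monomial_def)

lemma zero_or_monomialI:
  "p \<approx> monomial \<alpha> z \<beta> \<Longrightarrow> awalk u \<alpha> z \<Longrightarrow> awalk w \<beta> z \<Longrightarrow> zero_or_monomial p"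
  by (auto simp: zero_or_monomial_def)

lemma zero_or_monomial_cong: "p \<approx> q \<Longrightarrow> zero_or_monomial q \<Longrightarrow> zero_or_monomial p"
  unfolding zero_or_monomial_def by (meson cong_trans)

lemma zero_or_monomial_gen: "zero_or_monomial (gen x)"
proof (cases "x \<in> graph_letters E")
  case False
  then show ?thesis by (intro zero_or_monomial_zero gen_cong_zero)
next
  case True
  show ?thesis
  proof (cases x)
    case (Vertex v)
    then have "v \<in> verts E" using True by (auto simp: graph_letters_def)
    then show ?thesis
      using Vertex by (intro zero_or_monomialI[of _ "[]" v "[]" v v]) (auto simp: awalk_Nil_iff)
  next
    case (Edge e)
    then have "e \<in> arcs E" using True by (auto simp: graph_letters_def)
    then show ?thesis
      using Edge cong_sym[OF edg_head[of e]]
      by (intro zero_or_monomialI[of _ "[e]" "head E e" "[]" "tail E e" "head E e"])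
         (auto simp: awalk_Nil_iff arc_implies_awalk)
  next
    case (Ghost e)
    then have "e \<in> arcs E" using True by (auto simp: graph_letters_def)
    then show ?thesis
      using Ghost cong_sym[OF head_gho[of e]]
      by (intro zero_or_monomialI[of _ "[]" "head E e" "[e]" "head E e" "tail E e"])
         (auto simp: awalk_Nil_iff arc_implies_awalk)
  qed
qed

lemma zero_or_monomial_vtx_mult:
  assumes "awalk u \<alpha> z" and "awalk w \<beta> z"
  shows "zero_or_monomial (vtx v * monomial \<alpha> z \<beta>)"
  using cong_right[OF vtx_real_path[OF assms(1), of v], of "ghosts \<beta>"] assms
  by (cases "v = u") (auto simp: mult.assoc intro: zero_or_monomial_zero zero_or_monomialI)

lemma zero_or_monomial_edg_mult:
  assumes "awalk u \<alpha> z" and "awalk w \<beta> z"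
  shows "zero_or_monomial (edg e * monomial \<alpha> z \<beta>)"
proof (cases "e \<in> arcs E \<and> head E e = u")
  case True
  then have "awalk (tail E e) (e # \<alpha>) z"
    using assms by (auto simp: awalk_Cons_iff)
  then show ?thesis
    using assms by (intro zero_or_monomialI[of _ "e # \<alpha>" z \<beta>]) (auto simp: mult.assoc)
next
  case False
  then have "edg e * (edges \<alpha> * vtx z) \<approx> 0"
    using edg_real_path[OF assms(1), of e] cong_zeroI2[OF not_arc(1)[of e]] by auto
  then have "edg e * (edges \<alpha> * vtx z) * ghosts \<beta> \<approx> 0"
    by (rule cong_zeroI2)
  then show ?thesis
    by (intro zero_or_monomial_zero) (simp add: mult.assoc)
qed

lemma zero_or_monomial_gho_mult:
  assumes "awalk u \<alpha> z" and "awalk w \<beta> z"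
  shows "zero_or_monomial (gho e * monomial \<alpha> z \<beta>)"
proof (cases "e \<in> arcs E")
  case False
  then show ?thesis
    by (intro zero_or_monomial_zero cong_zeroI2 not_arc)
next
  case e: True
  show ?thesis
  proof (cases \<alpha>)
    case Nil
    show ?thesis
    proof (cases "z = tail E e")
      case True
      have "gho e * vtx z * ghosts \<beta> \<approx> gho e * ghosts \<beta>"
        unfolding True by (intro cong_right gho_tail)
      also have "\<dots> \<approx> vtx (head E e) * gho e * ghosts \<beta>"
        by (intro cong_right cong_sym[OF head_gho])
      finally have "gho e * monomial \<alpha> z \<beta> \<approx> monomial [] (head E e) (\<beta> @ [e])"
        using Nil by (simp add: mult.assoc)
      moreover have "awalk w (\<beta> @ [e]) (head E e)"
        using assms(2) True e arc_implies_awalk[of e] by auto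
      ultimately show ?thesis
        using e by (intro zero_or_monomialI[of _ "[]" "head E e" "\<beta> @ [e]" "head E e"])
                   (auto simp: awalk_Nil_iff)
    next
      case False
      then have "gho e * vtx z * ghosts \<beta> \<approx> 0"
        using cong_zeroI2[of "gho e * vtx z"] gho_vtx[of e z] by auto
      then show ?thesis
        using Nil by (intro zero_or_monomial_zero) (simp add: mult.assoc)
    qed
  next
    case (Cons f \<alpha>')
    then have f: "f \<in> arcs E" "tail E f = u" "awalk (head E f) \<alpha>' z"
      using assms by (auto simp: awalk_Cons_iff)
    have eq: "gho e * monomial \<alpha> z \<beta> = gho e * edg f * (real_path z \<alpha>' * ghosts \<beta>)"
      using Cons by (simp add: mult.assoc)
    show ?thesis
    proof (cases "e = f")
      case True
      have "gho e * edg f * (real_path z \<alpha>' * ghosts \<beta>) \<approx> vtx (head E f) * (real_path z \<alpha>' * ghosts \<beta>)"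
        unfolding True by (intro cong_right gho_edg f)
      also have "\<dots> \<approx> real_path z \<alpha>' * ghosts \<beta>"
        using cong_right[OF vtx_real_path[OF f(3), of "head E f"], of "ghosts \<beta>"] by (simp add: mult.assoc)
      finally show ?thesis
        using f assms eq by (intro zero_or_monomialI[of _ \<alpha>' z \<beta>]) auto
    next
      case False
      then show ?thesis
        unfolding eq by (intro zero_or_monomial_zero cong_zeroI2 gho_edg_orth)
    qed
  qed
qed

text \<open>Up to zero, monomials are stable under left multiplication by a letter, so the induction
  removes the first letter. The empty word is excluded because it is the unit of the free algebra,
  which need not be congruent to a monomial.\<close>

lemma zero_or_monomial_word: "l \<noteq> [] \<Longrightarrow> zero_or_monomial (prod_list (map gen l))"
proof (induction l rule: list_nonempty_induct)
  case (single x)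
  then show ?case by (simp add: zero_or_monomial_gen)
next
  case (cons x l)
  have *: "gen x * prod_list (map gen l) \<approx> gen x * q" if "prod_list (map gen l) \<approx> q" for q
    using that by (rule cong_left)
  from cons.IH consider "prod_list (map gen l) \<approx> 0"
    | u \<alpha> z w \<beta> where "awalk u \<alpha> z" "awalk w \<beta> z" "prod_list (map gen l) \<approx> monomial \<alpha> z \<beta>"
    by (auto simp: zero_or_monomial_def)
  then show ?case
  proof cases
    case 1
    then show ?thesis by (auto intro: zero_or_monomial_zero cong_zeroI1)
  next
    case 2
    then have "zero_or_monomial (gen x * monomial \<alpha> z \<beta>)"
      by (cases x) (auto intro: zero_or_monomial_vtx_mult zero_or_monomial_edg_mult zero_or_monomial_gho_mult)
    then show ?thesis
      using *[OF 2(3)] by (auto intro: zero_or_monomial_cong)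
  qed
qed

text \<open>Monomials span the elements without constant term modulo \<open>J\<close>. An induction
  rule, rather than an explicit sum, fits the uses: each proves a property that is additive and
  invariant under congruence. Independence of the monomials is not claimed.\<close>

lemma monomial_induct [consumes 1, case_names zero add cong monomial]:
  assumes "Poly_Mapping.lookup p 0 = 0"
    and zero: "P 0" and add: "\<And>p q. P p \<Longrightarrow> P q \<Longrightarrow> P (p + q)"
    and cong: "\<And>p q. q \<approx> p \<Longrightarrow> P p \<Longrightarrow> P q"
    and mono: "\<And>k u \<alpha> z w \<beta>. awalk u \<alpha> z \<Longrightarrow> awalk w \<beta> z \<Longrightarrow> P (scal k * monomial \<alpha> z \<beta>)"
  shows "P p"
proof -
  have single: "P (Poly_Mapping.single w (Poly_Mapping.lookup p w))" for w
  proof (cases "letters w = []")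
    case True
    then have "w = 0" by (cases w) (simp add: zero_word_def)
    then show ?thesis using assms(1) zero by simp
  next
    case False
    then obtain l where w: "w = Word l" "l \<noteq> []" by (cases w) auto
    let ?k = "Poly_Mapping.lookup p w"
    have eq: "Poly_Mapping.single w ?k = scal ?k * prod_list (map gen l)"
      using w single_word[of l ?k] by simp
    from zero_or_monomial_word[OF w(2)] consider "prod_list (map gen l) \<approx> 0"
      | u \<alpha> z v \<beta> where "awalk u \<alpha> z" "awalk v \<beta> z" "prod_list (map gen l) \<approx> monomial \<alpha> z \<beta>"
      by (auto simp: zero_or_monomial_def)
    then show ?thesis
    proof cases
      case 1
      then show ?thesis unfolding eq using cong zero cong_zeroI1 by blast
    next
      case 2
      then show ?thesis unfolding eq using cong mono cong_left by blast
    qed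
  qed
  have "P (\<Sum>w\<in>S. Poly_Mapping.single w (Poly_Mapping.lookup p w))" for S
    by (induction S rule: infinite_finite_induct) (auto intro: zero add single)
  then show ?thesis using poly_mapping_sum_singles[of p] by metis
qed

lemma monomial_vtx:
  assumes "awalk w \<beta> z"
  shows "monomial \<alpha> z \<beta> * vtx v \<approx> (if v = w then monomial \<alpha> z \<beta> else 0)"
  using cong_left[OF ghost_path_vtx[OF assms, of v], of "edges \<alpha>"] by (auto simp: mult.assoc)

text \<open>The sum over every larger finite set is a right unit as well; this stronger form lets
  the sets obtained for two summands be united.\<close>

lemma right_local_unit:
  assumes "Poly_Mapping.lookup x 0 = 0"
  shows "\<exists>W. finite W \<and> (\<forall>W'. finite W' \<longrightarrow> W \<subseteq> W' \<longrightarrow> x \<approx> x * (\<Sum>w\<in>W'. vtx w))"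
  using assms
proof (induction x rule: monomial_induct)
  case zero
  show ?case by (intro exI[of _ "{}"]) simp
next
  case (add p q)
  then obtain W1 W2 where "finite W1" "finite W2"
    and *: "\<And>W'. finite W' \<Longrightarrow> W1 \<subseteq> W' \<Longrightarrow> p \<approx> p * (\<Sum>w\<in>W'. vtx w)"
      "\<And>W'. finite W' \<Longrightarrow> W2 \<subseteq> W' \<Longrightarrow> q \<approx> q * (\<Sum>w\<in>W'. vtx w)"
    by blast
  then have "\<forall>W'. finite W' \<longrightarrow> W1 \<union> W2 \<subseteq> W' \<longrightarrow> p + q \<approx> (p + q) * (\<Sum>w\<in>W'. vtx w)"
    unfolding distrib_right by (intro allI impI cong_add) auto
  then show ?case using \<open>finite W1\<close> \<open>finite W2\<close> by (intro exI[of _ "W1 \<union> W2"]) blast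
next
  case (cong p q)
  then show ?case by (meson cong_right cong_sym cong_trans)
next
  case (monomial k u \<alpha> z w \<beta>)
  let ?m = "scal k * monomial \<alpha> z \<beta>"
  have "?m \<approx> ?m * (\<Sum>v\<in>W'. vtx v)" if "finite W'" "{w} \<subseteq> W'" for W'
  proof -
    have "?m = scal k * (\<Sum>v\<in>W'. if v = w then monomial \<alpha> z \<beta> else 0)"
      using that by simp
    also have "\<dots> \<approx> scal k * (\<Sum>v\<in>W'. monomial \<alpha> z \<beta> * vtx v)"
      by (intro cong_left cong_sum cong_sym[OF monomial_vtx[OF monomial(2)]])
    finally show ?thesis by (simp add: sum_distrib_left mult.assoc)
  qed
  then show ?case by blast
qed


section \<open>Elements with bounded ghost length\<close>

abbreviation path_sum :: "'v \<Rightarrow> ('e list \<Rightarrow> 'k) \<Rightarrow> 'e list set \<Rightarrow> ('k, 'v, 'e) free_alg" where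
  "path_sum w \<kappa> A \<equiv> \<Sum>\<alpha>\<in>A. scal (\<kappa> \<alpha>) * real_path w \<alpha>"

definition real_elem :: "'v \<Rightarrow> ('k, 'v, 'e) free_alg \<Rightarrow> bool" where
  "real_elem w y \<longleftrightarrow> (\<exists>A \<kappa>. finite A \<and> (\<forall>\<alpha>\<in>A. \<exists>u. awalk u \<alpha> w) \<and>
     y \<approx> path_sum w \<kappa> A)"

lemma real_elem_cong: "y \<approx> y' \<Longrightarrow> real_elem w y' \<Longrightarrow> real_elem w y"
  unfolding real_elem_def by (meson cong_trans)

lemma real_elem_path:
  assumes "awalk u \<alpha> w"
  shows "real_elem w (scal k * real_path w \<alpha>)"
  unfolding real_elem_def using assms by (intro exI[of _ "{\<alpha>}"] exI[of _ "\<lambda>_. k"]) auto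

lemma real_elem_zero: "real_elem w 0"
  unfolding real_elem_def by (intro exI[of _ "{}"]) auto

lemma real_elem_add:
  assumes "real_elem w x" and "real_elem w y"
  shows "real_elem w (x + y)"
proof -
  obtain A \<kappa> where A: "finite A" "\<forall>\<alpha>\<in>A. \<exists>u. awalk u \<alpha> w"
    "x \<approx> path_sum w \<kappa> A"
    using assms(1) by (auto simp: real_elem_def)
  obtain B \<mu> where B: "finite B" "\<forall>\<alpha>\<in>B. \<exists>u. awalk u \<alpha> w"
    "y \<approx> path_sum w \<mu> B"
    using assms(2) by (auto simp: real_elem_def)
  define \<kappa>' where "\<kappa>' \<alpha> = (if \<alpha> \<in> A then \<kappa> \<alpha> else 0)" for \<alpha>
  define \<mu>' where "\<mu>' \<alpha> = (if \<alpha> \<in> B then \<mu> \<alpha> else 0)" for \<alpha>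
  have "path_sum w \<kappa> A = (\<Sum>\<alpha>\<in>A \<union> B. scal (\<kappa>' \<alpha>) * real_path w \<alpha>)"
    using A(1) B(1) by (intro sum.mono_neutral_cong_left) (auto simp: \<kappa>'_def)
  moreover have "path_sum w \<mu> B = (\<Sum>\<alpha>\<in>A \<union> B. scal (\<mu>' \<alpha>) * real_path w \<alpha>)"
    using A(1) B(1) by (intro sum.mono_neutral_cong_left) (auto simp: \<mu>'_def)
  ultimately have "x + y \<approx> (\<Sum>\<alpha>\<in>A \<union> B. scal (\<kappa>' \<alpha> + \<mu>' \<alpha>) * real_path w \<alpha>)"
    using cong_add[OF A(3) B(3)] by (simp add: sum.distrib scal_add distrib_right)
  then show ?thesis
    unfolding real_elem_def using A B by (intro exI[of _ "A \<union> B"] exI[of _ "\<lambda>\<alpha>. \<kappa>' \<alpha> + \<mu>' \<alpha>"]) auto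
qed

lemma real_elem_sum: "(\<And>i. i \<in> S \<Longrightarrow> real_elem w (f i)) \<Longrightarrow> real_elem w (sum f S)"
  by (induction S rule: infinite_finite_induct) (auto intro: real_elem_zero real_elem_add)

lemma real_elem_vtx:
  assumes "real_elem w y"
  shows "y * vtx w \<approx> y"
proof -
  obtain A \<kappa> where A: "finite A" "y \<approx> path_sum w \<kappa> A"
    using assms by (auto simp: real_elem_def)
  have "y * vtx w \<approx> (\<Sum>\<alpha>\<in>A. scal (\<kappa> \<alpha>) * (real_path w \<alpha> * vtx w))"
    using cong_right[OF A(2), of "vtx w"] by (simp add: sum_distrib_right mult.assoc)
  also have "\<dots> \<approx> path_sum w \<kappa> A"
    by (intro cong_sum cong_left real_path_vtx)
  also have "\<dots> \<approx> y" by (rule cong_sym[OF A(2)])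
  finally show ?thesis .
qed

lemma real_elem_edg:
  assumes "real_elem w y" and "e \<in> out_arcs E w"
  shows "real_elem (head E e) (y * edg e)"
proof -
  obtain A \<kappa> where A: "finite A" "\<forall>\<alpha>\<in>A. \<exists>u. awalk u \<alpha> w" "y \<approx> path_sum w \<kappa> A"
    using assms(1) unfolding real_elem_def by blast
  have e: "e \<in> arcs E" "tail E e = w" using assms(2) by auto
  have y: "y * edg e \<approx> (\<Sum>\<alpha>\<in>A. scal (\<kappa> \<alpha>) * (real_path w \<alpha> * edg e))"
    using cong_right[OF A(3), of "edg e"] by (simp only: sum_distrib_right mult.assoc)
  have "real_elem (head E e) (scal (\<kappa> \<alpha>) * (real_path w \<alpha> * edg e))" if \<alpha>: "\<alpha> \<in> A" for \<alpha>
  proof (rule real_elem_cong)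
    show "scal (\<kappa> \<alpha>) * (real_path w \<alpha> * edg e) \<approx> scal (\<kappa> \<alpha>) * real_path (head E e) (\<alpha> @ [e])"
      by (rule cong_left[OF real_path_edg[OF e(2)]])
    obtain u where "awalk u \<alpha> w" using A(2) \<alpha> by blast
    then have "awalk u (\<alpha> @ [e]) (head E e)"
      using arc_implies_awalk[OF e(1)] e(2) by simp
    then show "real_elem (head E e) (scal (\<kappa> \<alpha>) * real_path (head E e) (\<alpha> @ [e]))"
      by (rule real_elem_path)
  qed
  then have "real_elem (head E e) (\<Sum>\<alpha>\<in>A. scal (\<kappa> \<alpha>) * (real_path w \<alpha> * edg e))"
    by (rule real_elem_sum)
  then show ?thesis
    by (rule real_elem_cong[OF y])
qed

text \<open>The recursion splits off the first arc of the ghost paths, which right multiplication by an arc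
  cancels.\<close>

primrec ghost_bounded :: "nat \<Rightarrow> 'v \<Rightarrow> ('k, 'v, 'e) free_alg \<Rightarrow> bool" where
  "ghost_bounded 0 w x \<longleftrightarrow> real_elem w x"
| "ghost_bounded (Suc n) w x \<longleftrightarrow> (\<exists>y B g. real_elem w y \<and> finite B \<and> B \<subseteq> out_arcs E w \<and>
     (\<forall>e\<in>B. ghost_bounded n (head E e) (g e)) \<and> x \<approx> y + (\<Sum>e\<in>B. g e * gho e))"

lemma ghost_bounded_cong: "x \<approx> x' \<Longrightarrow> ghost_bounded n w x' \<Longrightarrow> ghost_bounded n w x"
  by (cases n) (auto intro: real_elem_cong cong_trans)

lemma ghost_bounded_real: "real_elem w x \<Longrightarrow> ghost_bounded n w x"
proof (cases n)
  case (Suc m)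
  assume "real_elem w x"
  then show ?thesis
    unfolding Suc ghost_bounded.simps by (intro exI[of _ x] exI[of _ "{}"]) auto
qed simp

lemma ghost_bounded_zero: "ghost_bounded n w 0"
  by (intro ghost_bounded_real real_elem_zero)

lemma ghost_bounded_Suc: "ghost_bounded n w x \<Longrightarrow> ghost_bounded (Suc n) w x"
proof (induction n arbitrary: w x)
  case 0
  then have "real_elem w x" by simp
  then show ?case by (rule ghost_bounded_real)
next
  case (Suc n)
  from Suc.prems obtain y B g where *: "real_elem w y" "finite B" "B \<subseteq> out_arcs E w"
    "\<forall>e\<in>B. ghost_bounded n (head E e) (g e)" "x \<approx> y + (\<Sum>e\<in>B. g e * gho e)"
    unfolding ghost_bounded.simps(2) by (elim exE conjE)
  then have "\<forall>e\<in>B. ghost_bounded (Suc n) (head E e) (g e)"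
    using Suc.IH by (auto simp del: ghost_bounded.simps)
  with * show ?case
    unfolding ghost_bounded.simps(2)[of "Suc n"] by (intro exI conjI)
qed

lemma ghost_bounded_mono: "n \<le> m \<Longrightarrow> ghost_bounded n w x \<Longrightarrow> ghost_bounded m w x"
  by (induction m rule: dec_induct) (auto intro: ghost_bounded_Suc simp del: ghost_bounded.simps)

lemma ghost_bounded_add:
  "ghost_bounded n w x \<Longrightarrow> ghost_bounded n w x' \<Longrightarrow> ghost_bounded n w (x + x')"
proof (induction n arbitrary: w x x')
  case (Suc n)
  from Suc.prems obtain y B g where 1: "real_elem w y" "finite B" "B \<subseteq> out_arcs E w"
    "\<forall>e\<in>B. ghost_bounded n (head E e) (g e)" "x \<approx> y + (\<Sum>e\<in>B. g e * gho e)"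
    by auto
  from Suc.prems obtain y' B' g' where 2: "real_elem w y'" "finite B'" "B' \<subseteq> out_arcs E w"
    "\<forall>e\<in>B'. ghost_bounded n (head E e) (g' e)" "x' \<approx> y' + (\<Sum>e\<in>B'. g' e * gho e)"
    by auto
  define h where "h e = (if e \<in> B then g e else 0)" for e
  define h' where "h' e = (if e \<in> B' then g' e else 0)" for e
  have "(\<Sum>e\<in>B. g e * gho e) = (\<Sum>e\<in>B \<union> B'. h e * gho e)"
    using 1(2) 2(2) by (intro sum.mono_neutral_cong_left) (auto simp: h_def)
  moreover have "(\<Sum>e\<in>B'. g' e * gho e) = (\<Sum>e\<in>B \<union> B'. h' e * gho e)"
    using 1(2) 2(2) by (intro sum.mono_neutral_cong_left) (auto simp: h'_def)
  ultimately have "x + x' \<approx> (y + y') + (\<Sum>e\<in>B \<union> B'. (h e + h' e) * gho e)"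
    using cong_add[OF 1(5) 2(5)] by (simp add: sum.distrib distrib_right algebra_simps)
  moreover have "\<forall>e\<in>B \<union> B'. ghost_bounded n (head E e) (h e + h' e)"
    using 1(4) 2(4) by (intro ballI Suc.IH) (auto simp: h_def h'_def ghost_bounded_zero)
  ultimately show ?case
    unfolding ghost_bounded.simps(2) using 1(1-3) 2(1-3)
    by (intro exI[of _ "y + y'"] exI[of _ "B \<union> B'"] exI[of _ "\<lambda>e. h e + h' e"])
       (simp add: real_elem_add)
qed (simp add: real_elem_add)

lemma ghost_bounded_vtx: "ghost_bounded n w x \<Longrightarrow> x * vtx w \<approx> x"
proof (cases n)
  case (Suc m)
  assume "ghost_bounded n w x"
  then obtain y B g where *: "real_elem w y" "B \<subseteq> out_arcs E w" "x \<approx> y + (\<Sum>e\<in>B. g e * gho e)"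
    using Suc by auto
  have "x * vtx w \<approx> y * vtx w + (\<Sum>e\<in>B. g e * (gho e * vtx w))"
    using cong_right[OF *(3), of "vtx w"] by (simp add: distrib_right sum_distrib_right mult.assoc)
  also have "\<dots> \<approx> y + (\<Sum>e\<in>B. g e * gho e)"
  proof (intro cong_add[OF real_elem_vtx[OF *(1)] cong_sum] cong_left)
    fix e assume "e \<in> B"
    then show "gho e * vtx w \<approx> gho e" using *(2) gho_tail[of e] by auto
  qed
  also have "\<dots> \<approx> x" by (rule cong_sym[OF *(3)])
  finally show ?thesis .
qed (simp add: real_elem_vtx)

lemma ghost_bounded_monomial:
  assumes "awalk u \<alpha> z" and "awalk w \<beta> z"
  shows "ghost_bounded (length \<beta>) w (scal k * monomial \<alpha> z \<beta>)"
  using assms(2)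
proof (induction \<beta> arbitrary: w)
  case Nil
  then show ?case using real_elem_path[OF assms(1)] by (simp add: awalk_Nil_iff)
next
  case (Cons e \<beta>)
  then have e: "e \<in> out_arcs E w" "awalk (head E e) \<beta> z"
    by (auto simp: awalk_Cons_iff)
  have "scal k * monomial \<alpha> z (e # \<beta>) = 0 + (\<Sum>e\<in>{e}. scal k * monomial \<alpha> z \<beta> * gho e)"
    by (simp add: mult.assoc)
  then have "ghost_bounded (Suc (length \<beta>)) w (scal k * monomial \<alpha> z (e # \<beta>))"
    unfolding ghost_bounded.simps(2) using e Cons.IH[OF e(2)] real_elem_zero[of w]
    by (intro exI[of _ 0] exI[of _ "{e}"] exI[of _ "\<lambda>_. scal k * monomial \<alpha> z \<beta>"]) simp
  then show ?case by simp
qed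

lemma ex_ghost_bounded:
  assumes "Poly_Mapping.lookup x 0 = 0"
  shows "\<exists>n. ghost_bounded n w (x * vtx w)"
  using assms
proof (induction x rule: monomial_induct)
  case zero
  have "ghost_bounded 0 w (0 * vtx w)" using ghost_bounded_zero[of 0 w] by simp
  then show ?case by blast
next
  case (add p q)
  then obtain n m where "ghost_bounded n w (p * vtx w)" "ghost_bounded m w (q * vtx w)" by blast
  then have "ghost_bounded (max n m) w (p * vtx w + q * vtx w)"
    by (intro ghost_bounded_add) (auto intro: ghost_bounded_mono[rotated])
  then show ?case by (auto simp: distrib_right)
next
  case (cong p q)
  then obtain n where "ghost_bounded n w (p * vtx w)" by blast
  then show ?case using ghost_bounded_cong[OF cong_right[OF cong(1)]] by blast
next
  case (monomial k u \<alpha> z v \<beta>)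
  have *: "scal k * monomial \<alpha> z \<beta> * vtx w \<approx> scal k * (if w = v then monomial \<alpha> z \<beta> else 0)"
    using cong_left[OF monomial_vtx[OF monomial(2), of \<alpha> w], of "scal k"] by (simp add: mult.assoc)
  have "\<exists>n. ghost_bounded n w (scal k * (if w = v then monomial \<alpha> z \<beta> else 0))"
    using ghost_bounded_monomial[OF monomial, of k] ghost_bounded_zero[of _ w]
    by (cases "w = v") (auto simp del: ghost_bounded.simps)
  then show ?case using ghost_bounded_cong[OF *] by blast
qed

end

section \<open>Elements of positive and of nonnegative degree\<close>

text \<open>Degrees are read off the words of a chosen representative. Congruent elements need not
  share the property; it is the homogeneity of \<open>J\<close> that later carries conclusions over
  to them.\<close>

definition positive_degree :: "('k::zero, 'v, 'e) free_alg \<Rightarrow> bool" where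
  "positive_degree p \<longleftrightarrow> (\<forall>w \<in> Poly_Mapping.keys p. word_degree w > 0)"

definition nonneg_degree :: "('k::zero, 'v, 'e) free_alg \<Rightarrow> bool" where
  "nonneg_degree p \<longleftrightarrow> (\<forall>w \<in> Poly_Mapping.keys p. word_degree w \<ge> 0)"

lemma positive_degree_zero: "positive_degree 0"
  by (simp add: positive_degree_def)

lemma nonneg_degree_zero: "nonneg_degree 0"
  by (simp add: nonneg_degree_def)

lemma positive_imp_nonneg_degree: "positive_degree p \<Longrightarrow> nonneg_degree p"
  by (force simp: positive_degree_def nonneg_degree_def)

lemma positive_degree_add: "positive_degree p \<Longrightarrow> positive_degree q \<Longrightarrow> positive_degree (p + q)"
  using keys_add[of p q] by (auto simp: positive_degree_def)

lemma nonneg_degree_add: "nonneg_degree p \<Longrightarrow> nonneg_degree q \<Longrightarrow> nonneg_degree (p + q)"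
  using keys_add[of p q] by (auto simp: nonneg_degree_def)

lemma positive_degree_sum_list:
  "(\<And>i. i \<in> set l \<Longrightarrow> positive_degree (f i)) \<Longrightarrow> positive_degree (sum_list (map f l))"
  by (induction l) (auto intro: positive_degree_zero positive_degree_add)

lemma positive_degree_mult:
  assumes "positive_degree p" and "nonneg_degree q"
  shows "positive_degree (p * q)" "positive_degree (q * p)"
  using keys_mult[of p q] keys_mult[of q p] assms
  by (force simp: positive_degree_def nonneg_degree_def word_degree_add)+

lemma nonneg_degree_mult: "nonneg_degree p \<Longrightarrow> nonneg_degree q \<Longrightarrow> nonneg_degree (p * q)"
  using keys_mult[of p q] by (force simp: nonneg_degree_def word_degree_add)

lemma nonneg_degree_scal: "nonneg_degree (scal k)"
  by (simp add: nonneg_degree_def scal_def)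

lemma nonneg_degree_vtx: "nonneg_degree (vtx v)"
  by (simp add: nonneg_degree_def gen_def word_degree_def)

lemma positive_degree_edg: "positive_degree (edg e)"
  by (simp add: positive_degree_def gen_def word_degree_def)

lemma positive_degree_edges: "\<alpha> \<noteq> [] \<Longrightarrow> positive_degree (edges \<alpha>)"
proof (induction \<alpha>)
  case (Cons e \<alpha>)
  then show ?case
    by (cases "\<alpha> = []")
       (auto intro: positive_degree_mult positive_degree_edg positive_imp_nonneg_degree)
qed simp

lemma positive_degree_real_path: "\<alpha> \<noteq> [] \<Longrightarrow> positive_degree (scal k * (edges \<alpha> * vtx w))"
  by (intro positive_degree_mult positive_degree_edges nonneg_degree_scal nonneg_degree_vtx)

lemma hom_part_positive: "positive_degree p \<Longrightarrow> hom_part 0 p = 0"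
  by (rule restrict_keys_eq_zero) (auto simp: positive_degree_def)

lemma hom_part_vtx: "hom_part 0 (scal k * vtx v) = scal k * vtx v"
  unfolding hom_part_scal_mult by (simp add: gen_def restrict_keys_single word_degree_def)

section \<open>A vertex plus closed walks, and conjugation by paths\<close>

context lpa_congruence
begin

lemma awalk_append_cancel: "awalk u \<alpha> w \<Longrightarrow> awalk u (\<alpha> @ \<beta>) z \<Longrightarrow> awalk w \<beta> z"
  by auto

abbreviation walk_sum :: "'v \<Rightarrow> ('k \<times> 'e list) list \<Rightarrow> ('k, 'v, 'e) free_alg" where
  "walk_sum u L \<equiv> \<Sum>(k, \<gamma>)\<leftarrow>L. scal k * real_path u \<gamma>"

text \<open>The closed walks form a list, whose length is the quantity to be minimised. Repeated
  walks and zero coefficients are allowed, so terms never have to be collected after a conjugation.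
  Only the coefficient of the vertex must be nonzero.\<close>

definition special :: "'v \<Rightarrow> ('k, 'v, 'e) free_alg \<Rightarrow> ('k \<times> 'e list) list \<Rightarrow> bool" where
  "special u g L \<longleftrightarrow> u \<in> verts E \<and> (\<forall>(k, \<gamma>) \<in> set L. \<gamma> \<noteq> [] \<and> awalk u \<gamma> u) \<and>
     (\<exists>k. k \<noteq> 0 \<and> g \<approx> scal k * vtx u + walk_sum u L)"

lemma special_cong: "g \<approx> g' \<Longrightarrow> special u g' L \<Longrightarrow> special u g L"
  unfolding special_def by (blast intro: cong_trans)

lemma specialE:
  assumes "special u g L"
  obtains k where "u \<in> verts E" "\<And>k' \<gamma>. (k', \<gamma>) \<in> set L \<Longrightarrow> \<gamma> \<noteq> [] \<and> awalk u \<gamma> u" "k \<noteq> 0"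
    "g \<approx> scal k * vtx u + walk_sum u L"
  using assms unfolding special_def by blast

text \<open>The product \<pi>^* \<gamma> \<pi> can be nonzero only if \<pi> is a prefix of
  \<gamma>\<pi>. Writing \<gamma>\<pi> = \<pi>\<delta>, it then equals \<delta>, which is
  \<open>conj_walk \<pi> \<gamma>\<close>.\<close>

definition survives :: "'e list \<Rightarrow> 'e list \<Rightarrow> bool" where
  "survives \<pi> \<gamma> \<longleftrightarrow> (\<exists>\<delta>. \<gamma> @ \<pi> = \<pi> @ \<delta>)"

definition conj_walk :: "'e list \<Rightarrow> 'e list \<Rightarrow> 'e list" where
  "conj_walk \<pi> \<gamma> = drop (length \<pi>) (\<gamma> @ \<pi>)"

lemma conj_walk_eq: "\<gamma> @ \<pi> = \<pi> @ \<delta> \<Longrightarrow> conj_walk \<pi> \<gamma> = \<delta>"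
  unfolding conj_walk_def by (metis append_eq_conv_conj)

lemma survives_conj_walk: "survives \<pi> \<gamma> \<Longrightarrow> \<gamma> @ \<pi> = \<pi> @ conj_walk \<pi> \<gamma>"
  by (auto simp: survives_def conj_walk_eq)

lemma conjugate_real_path:
  assumes "awalk u \<pi> v" and "awalk u \<gamma> u" and "\<gamma> \<noteq> []"
  shows "ghost_path v \<pi> * real_path u \<gamma> * real_path v \<pi> \<approx>
    (if survives \<pi> \<gamma> then real_path v (conj_walk \<pi> \<gamma>) else 0)"
proof -
  have walk: "awalk u (\<gamma> @ \<pi>) v" using assms by auto
  have *: ?thesis if "\<gamma> @ \<pi> = \<pi> @ \<delta>" for \<delta>
    using awalk_append_cancel[OF assms(1), of \<delta> v] walk that
      ghost_path_real_path_append[OF assms(1), of \<delta> v]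
      cong_trans[OF cong_left[OF real_path_append[OF assms(1), of \<gamma>], of "ghost_path v \<pi>"]]
    by (simp add: survives_def conj_walk_eq mult.assoc)
  show ?thesis
  proof (rule ghost_path_real_path_cases[OF assms(1) walk])
    fix \<delta> assume "\<gamma> @ \<pi> = \<pi> @ \<delta>"
    then show ?thesis by (rule *)
  next
    fix \<delta> assume "\<pi> = (\<gamma> @ \<pi>) @ \<delta>"
    from arg_cong[OF this, of length] show ?thesis using assms(3) by simp
  next
    assume orth: "ghost_path v \<pi> * real_path v (\<gamma> @ \<pi>) \<approx> 0"
    show ?thesis
    \<comment> \<open>Vanishing of the product does not rule out survival, since the surviving walk
      may lie in \<open>J\<close>.\<close>
    proof (cases "survives \<pi> \<gamma>")
      case True
      then show ?thesis by (rule *[OF survives_conj_walk])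
    next
      case False
      then show ?thesis
        using cong_trans[OF cong_left[OF real_path_append[OF assms(1), of \<gamma>]] orth] by (simp add: mult.assoc)
    qed
  qed
qed

definition conjugate :: "'e list \<Rightarrow> ('k \<times> 'e list) list \<Rightarrow> ('k \<times> 'e list) list" where
  "conjugate \<pi> L = map (\<lambda>(k, \<gamma>). (k, conj_walk \<pi> \<gamma>)) (filter (\<lambda>(k, \<gamma>). survives \<pi> \<gamma>) L)"

text \<open>Special elements travel along paths without leaving an ideal: \<pi>^* u \<pi> = v keeps
  the coefficient of the vertex, and each closed walk at u either becomes one at v or
  disappears.\<close>

lemma special_conjugate:
  assumes "special u g L" and "awalk u \<pi> v"
  shows "special v (ghost_path v \<pi> * g * real_path v \<pi>) (conjugate \<pi> L)"
proof -
  obtain k where L: "u \<in> verts E" "\<And>k' \<gamma>. (k', \<gamma>) \<in> set L \<Longrightarrow> \<gamma> \<noteq> [] \<and> awalk u \<gamma> u" "k \<noteq> 0"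
    and g: "g \<approx> scal k * vtx u + walk_sum u L"
    using assms(1) by (rule specialE) blast
  let ?q = "ghost_path v \<pi>" and ?p = "real_path v \<pi>"
  have "?q * walk_sum u L * ?p \<approx>
      walk_sum v (conjugate \<pi> L)"
    using L(2)
  proof (induction L)
    case Nil
    then show ?case by (simp add: conjugate_def)
  next
    case (Cons x L)
    obtain k' \<gamma> where x: "x = (k', \<gamma>)" by force
    have "?q * (scal k' * real_path u \<gamma>) * ?p = scal k' * (?q * real_path u \<gamma> * ?p)"
      by (simp add: scal_commute_left mult.assoc)
    also have "\<dots> \<approx> scal k' * (if survives \<pi> \<gamma> then real_path v (conj_walk \<pi> \<gamma>) else 0)"
      using Cons.prems[of k' \<gamma>] x by (intro cong_left conjugate_real_path assms) auto
    finally have "?q * (scal k' * real_path u \<gamma>) * ?p \<approx>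
      scal k' * (if survives \<pi> \<gamma> then real_path v (conj_walk \<pi> \<gamma>) else 0)" .
    moreover have "?q * walk_sum u L * ?p \<approx>
        walk_sum v (conjugate \<pi> L)"
      using Cons.prems by (intro Cons.IH) auto
    ultimately have "?q * (scal k' * real_path u \<gamma>) * ?p + ?q * walk_sum u L * ?p \<approx>
        scal k' * (if survives \<pi> \<gamma> then real_path v (conj_walk \<pi> \<gamma>) else 0) +
        walk_sum v (conjugate \<pi> L)"
      by (rule cong_add)
    then show ?case
      unfolding x by (cases "survives \<pi> \<gamma>") (simp_all add: conjugate_def distrib_left distrib_right)
  qed
  moreover have "?q * (scal k * vtx u) * ?p \<approx> scal k * vtx v"
  proof -
    have "?q * (scal k * vtx u) * ?p = scal k * (?q * (vtx u * ?p))"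
      by (simp add: scal_commute_left mult.assoc)
    also have "\<dots> \<approx> scal k * (?q * ?p)"
      using vtx_real_path[OF assms(2), of u] by (intro cong_left) simp
    also have "\<dots> \<approx> scal k * vtx v"
      by (intro cong_left ghost_path_real_path[OF assms(2)])
    finally show ?thesis .
  qed
  ultimately have "?q * (scal k * vtx u) * ?p + ?q * walk_sum u L * ?p \<approx>
      scal k * vtx v + walk_sum v (conjugate \<pi> L)"
    by (intro cong_add)
  then have g': "?q * g * ?p \<approx> scal k * vtx v + walk_sum v (conjugate \<pi> L)"
    using cong_trans[OF cong_mult3[OF g, of ?q ?p]] by (simp add: distrib_left distrib_right)
  have "\<gamma>' \<noteq> [] \<and> awalk v \<gamma>' v" if "(k', \<gamma>') \<in> set (conjugate \<pi> L)" for k' \<gamma>'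
  proof -
    obtain \<gamma> where \<gamma>: "(k', \<gamma>) \<in> set L" "survives \<pi> \<gamma>" "\<gamma>' = conj_walk \<pi> \<gamma>"
      using \<open>(k', \<gamma>') \<in> set (conjugate \<pi> L)\<close> by (auto simp: conjugate_def)
    then have eq: "\<gamma> @ \<pi> = \<pi> @ \<gamma>'" by (simp add: survives_conj_walk)
    \<comment> \<open>Equal lengths guarantee that a surviving walk does not become empty.\<close>
    from arg_cong[OF this, of length] have "length \<gamma>' = length \<gamma>" by simp
    moreover have "awalk u (\<pi> @ \<gamma>') v" using L(2)[OF \<gamma>(1)] assms(2) eq[symmetric] by auto
    ultimately show ?thesis
      using L(2)[OF \<gamma>(1)] awalk_append_cancel[OF assms(2), of \<gamma>' v] by auto
  qed
  then show ?thesis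
    using g' L(3) assms(2) unfolding special_def by (auto intro: awalk_last_in_verts)
qed

lemma length_conjugate: "length (conjugate \<pi> L) \<le> length L"
  by (simp add: conjugate_def)

lemma length_conjugate_less:
  assumes "(k, \<gamma>) \<in> set L" and "\<not> survives \<pi> \<gamma>"
  shows "length (conjugate \<pi> L) < length L"
  using length_filter_less[OF assms(1), of "\<lambda>(k, \<gamma>). survives \<pi> \<gamma>"] assms(2)
  by (simp add: conjugate_def)

text \<open>Conjugation by an initial segment rotates a closed walk.\<close>

lemma conjugate_prefix: "(k, \<pi> @ \<gamma>) \<in> set L \<Longrightarrow> (k, \<gamma> @ \<pi>) \<in> set (conjugate \<pi> L)"
  by (force simp: conjugate_def survives_def conj_walk_def)

text \<open>Let \<alpha> be a shortest path occurring in y. Multiplication by \<alpha>^* turns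
  \<alpha> into w, and a proper extension \<alpha>\<gamma> into \<gamma>, which is closed because
  both paths end at w. All other paths are sent to 0, none being a proper prefix of
  \<alpha>.\<close>

lemma real_to_special:
  assumes "real_elem w y" and "y \<notin> J"
  obtains u \<alpha> L where "awalk u \<alpha> w" "special w (ghost_path w \<alpha> * y) L"
proof -
  obtain A \<kappa> where A: "finite A" "\<forall>\<alpha>\<in>A. \<exists>u. awalk u \<alpha> w" "y \<approx> path_sum w \<kappa> A"
    using assms(1) unfolding real_elem_def by blast
  \<comment> \<open>Zero coefficients are dropped so that the coefficient of the chosen shortest
    path can serve as k.\<close>
  define A' where "A' = {\<alpha>\<in>A. \<kappa> \<alpha> \<noteq> 0}"
  have y: "y \<approx> path_sum w \<kappa> A'"
  proof -
    have "path_sum w \<kappa> A = path_sum w \<kappa> A'"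
      using A(1) by (intro sum.mono_neutral_right) (auto simp: A'_def)
    then show ?thesis using A(3) by simp
  qed
  have fin: "finite A'" using A(1) by (simp add: A'_def)
  have "A' \<noteq> {}" using y assms(2) cong_J[OF y] ring_ideal_zero[OF ideal_J] by auto
  then obtain \<alpha> where \<alpha>: "\<alpha> \<in> A'" "\<And>\<beta>. \<beta> \<in> A' \<Longrightarrow> length \<alpha> \<le> length \<beta>"
    using arg_min_if_finite[OF fin, of length] by (meson not_le_imp_less)
  have "\<alpha> \<in> A" using \<alpha>(1) by (simp add: A'_def)
  with A(2) obtain u where u: "awalk u \<alpha> w" by blast
  define B where "B = {\<beta> \<in> A' - {\<alpha>}. \<exists>\<gamma>. \<beta> = \<alpha> @ \<gamma> \<and> awalk w \<gamma> w}"
  have "finite B" using fin by (simp add: B_def)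
  then obtain l where l: "set l = B" "distinct l"
    using finite_distinct_list by blast
  define L where "L = map (\<lambda>\<beta>. (\<kappa> \<beta>, drop (length \<alpha>) \<beta>)) l"
  let ?q = "ghost_path w \<alpha>"
  have star: "?q * real_path w \<beta> \<approx> (if \<beta> \<in> B then real_path w (drop (length \<alpha>) \<beta>) else 0)"
    if \<beta>: "\<beta> \<in> A' - {\<alpha>}" for \<beta>
  proof -
    have "\<beta> \<in> A" using \<beta> by (simp add: A'_def)
    with A(2) obtain u' where u': "awalk u' \<beta> w" by blast
    show ?thesis
    proof (rule ghost_path_real_path_cases[OF u u'])
      fix \<gamma> assume *: "u' = u" "\<beta> = \<alpha> @ \<gamma>"
      then have "awalk w \<gamma> w" using awalk_append_cancel[OF u, of \<gamma> w] u' by simp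
      then show ?thesis using ghost_path_real_path_append[OF u] * \<beta> by (auto simp: B_def)
    next
      fix \<gamma> assume "\<alpha> = \<beta> @ \<gamma>" "\<gamma> \<noteq> []"
      then have "length \<beta> < length \<alpha>" by simp
      then show ?thesis using \<alpha>(2)[of \<beta>] \<beta> by simp
    next
      assume orth: "?q * real_path w \<beta> \<approx> 0"
      show ?thesis
      proof (cases "\<beta> \<in> B")
        case True
        then obtain \<gamma> where "\<beta> = \<alpha> @ \<gamma>" "awalk w \<gamma> w" by (auto simp: B_def)
        then show ?thesis using ghost_path_real_path_append[OF u, of \<gamma> w] True by simp
      qed (use orth in simp)
    qed
  qed
  have "?q * y \<approx> ?q * path_sum w \<kappa> A'"
    by (rule cong_left[OF y])
  also have "\<dots> = scal (\<kappa> \<alpha>) * (?q * real_path w \<alpha>) + (\<Sum>\<beta>\<in>A' - {\<alpha>}. scal (\<kappa> \<beta>) * (?q * real_path w \<beta>))"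
    using sum.remove[OF fin \<alpha>(1), of "\<lambda>\<beta>. ?q * (scal (\<kappa> \<beta>) * real_path w \<beta>)"]
    by (simp only: sum_distrib_left scal_commute_left)
  also have "\<dots> \<approx> scal (\<kappa> \<alpha>) * vtx w +
      (\<Sum>\<beta>\<in>A' - {\<alpha>}. scal (\<kappa> \<beta>) * (if \<beta> \<in> B then real_path w (drop (length \<alpha>) \<beta>) else 0))"
    by (rule cong_add[OF cong_left[OF ghost_path_real_path[OF u]] cong_sum[OF cong_left[OF star]]])
  also have "(\<Sum>\<beta>\<in>A' - {\<alpha>}. scal (\<kappa> \<beta>) * (if \<beta> \<in> B then real_path w (drop (length \<alpha>) \<beta>) else 0)) =
      (\<Sum>\<beta>\<in>B. scal (\<kappa> \<beta>) * real_path w (drop (length \<alpha>) \<beta>))"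
    using fin by (intro sum.mono_neutral_cong_right) (auto simp: B_def)
  also have "\<dots> = walk_sum w L"
    using l by (simp add: L_def sum_list_distinct_conv_sum_set o_def)
  finally have "?q * y \<approx> scal (\<kappa> \<alpha>) * vtx w + walk_sum w L" .
  moreover have "\<gamma> \<noteq> [] \<and> awalk w \<gamma> w" if "(k, \<gamma>) \<in> set L" for k \<gamma>
  proof -
    obtain \<beta> where "\<beta> \<in> B" "\<gamma> = drop (length \<alpha>) \<beta>"
      using \<open>(k, \<gamma>) \<in> set L\<close> l(1) unfolding L_def by auto
    moreover from \<open>\<beta> \<in> B\<close> obtain \<delta> where "\<beta> = \<alpha> @ \<delta>" "awalk w \<delta> w" "\<beta> \<noteq> \<alpha>"
      unfolding B_def by blast
    ultimately show ?thesis by simp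
  qed
  ultimately have "special w (?q * y) L"
    using \<alpha>(1) u unfolding special_def A'_def by (auto intro: awalk_last_in_verts)
  with u show thesis by (rule that)
qed

end

section \<open>The elements \<open>v\<^sup>H\<close>, lifted to the free algebra\<close>

definition break_elem :: "('v, 'e) pre_digraph \<Rightarrow> 'v set \<Rightarrow> 'v \<Rightarrow> ('k::field, 'v, 'e) free_alg" where
  "break_elem E H v = vtx v - (\<Sum>e\<in>arcs_leaving E H v. edg e * gho e)"

context lpa_congruence
begin

lemma break_elem_vtx: "break_elem E H w * vtx w \<approx> break_elem E H w"
proof -
  have "(\<Sum>e\<in>arcs_leaving E H w. edg e * (gho e * vtx w)) \<approx> (\<Sum>e\<in>arcs_leaving E H w. edg e * gho e)"
  proof (rule cong_sum[OF cong_left])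
    fix e assume "e \<in> arcs_leaving E H w"
    then show "gho e * vtx w \<approx> gho e" using gho_tail[of e] by (auto simp: arcs_leaving_def)
  qed
  from cong_diff[OF vtx_idem[of w] this] show ?thesis
    unfolding break_elem_def by (simp add: left_diff_distrib sum_distrib_right mult.assoc)
qed

lemma break_elem_edg:
  assumes "finite (arcs_leaving E H w)" and "e \<in> arcs_leaving E H w"
  shows "break_elem E H w * edg e \<approx> 0"
proof -
  have e: "e \<in> arcs E" "tail E e = w" using assms(2) by (auto simp: arcs_leaving_def)
  have "(\<Sum>f\<in>arcs_leaving E H w. edg f * (gho f * edg e)) \<approx>
      (\<Sum>f\<in>arcs_leaving E H w. if f = e then edg e * vtx (head E e) else 0)"
    using gho_edg[OF e(1)] gho_edg_orth
    by (intro cong_sum) (auto intro: cong_left cong_zeroI1)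
  also have "\<dots> = edg e * vtx (head E e)" using assms by simp
  also have "\<dots> \<approx> edg e" by (rule edg_head)
  finally have *: "(\<Sum>f\<in>arcs_leaving E H w. edg f * (gho f * edg e)) \<approx> edg e" .
  have "vtx w * edg e \<approx> edg e" using tail_edg[of e] e(2) by simp
  from cong_diff[OF this *] show ?thesis
    unfolding break_elem_def by (simp add: left_diff_distrib sum_distrib_right mult.assoc)
qed

text \<open>The left factor annihilates each arc in the sum of the right factor, so only its product
  with w remains.\<close>

lemma break_elem_idem:
  assumes "finite (arcs_leaving E H w)"
  shows "break_elem E H w * break_elem E H w \<approx> break_elem E H w"
proof -
  let ?b = "break_elem E H w :: ('k, 'v, 'e) free_alg"
  have "(\<Sum>e\<in>arcs_leaving E H w. ?b * edg e * gho e) \<approx> (\<Sum>e\<in>arcs_leaving E H w. 0)"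
    by (rule cong_sum[OF cong_zeroI2[OF break_elem_edg[OF assms]]])
  then have "(\<Sum>e\<in>arcs_leaving E H w. ?b * edg e * gho e) \<approx> 0" by simp
  from cong_diff[OF break_elem_vtx[of H w] this]
  have "?b * vtx w - (\<Sum>e\<in>arcs_leaving E H w. ?b * edg e * gho e) \<approx> ?b"
    by simp
  moreover have "?b * ?b = ?b * vtx w - (\<Sum>e\<in>arcs_leaving E H w. ?b * edg e * gho e)"
    by (subst (2) break_elem_def) (simp add: right_diff_distrib sum_distrib_left mult.assoc)
  ultimately show ?thesis by simp
qed

end

section \<open>An ideal together with its graded part\<close>

text \<open>\<open>J\<close> stands for I(H,S), and the assumptions list what is needed of it: it is
  homogeneous, lies in \<open>I\<close>, and contains the vertices of \<open>H\<close> and every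
  \<open>v\<^sup>H\<close> that is in \<open>I\<close>. The last assumption encodes
  \<open>S\<close>. The condition on coefficients at 0 records that \<open>I\<close> comes from the
  algebra without unit.\<close>

locale leavitt_ideal_pair = lpa_congruence E J
  for E :: "('v, 'e) pre_digraph" and J :: "('k::field, 'v, 'e) free_alg set" +
  fixes I :: "('k, 'v, 'e) free_alg set" and H :: "'v set"
  assumes ideal_I: "ring_ideal I"
    and J_le_I: "J \<subseteq> I"
    and I_augmentation: "p \<in> I \<Longrightarrow> Poly_Mapping.lookup p 0 = 0"
    and J_homogeneous: "homogeneous_closed J"
    and H_def: "H = {v \<in> verts E. vtx v \<in> I}"
    and H_J: "v \<in> H \<Longrightarrow> vtx v \<in> J"
    and break_J: "v \<in> breaking_vertices E H \<Longrightarrow> break_elem E H v \<in> I \<Longrightarrow> break_elem E H v \<in> J"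
begin

lemma cong_I: "a \<approx> b \<Longrightarrow> a \<in> I \<longleftrightarrow> b \<in> I"
  by (rule cong_ideal[OF _ ideal_I J_le_I])

lemma vtx_I_imp: "vtx v \<in> I \<Longrightarrow> v \<in> verts E \<Longrightarrow> v \<in> H"
  by (simp add: H_def)

lemma scal_vtx_I_imp: "scal k * p \<in> I \<Longrightarrow> k \<noteq> 0 \<Longrightarrow> p \<in> I"
  using ring_ideal_left[OF ideal_I, of "scal k * p" "scal (inverse k)"] by (simp add: scal_cancel)

lemma scal_vtx_notin_I: "v \<in> verts E - H \<Longrightarrow> k \<noteq> 0 \<Longrightarrow> scal k * vtx v \<notin> I"
  using scal_vtx_I_imp vtx_I_imp by blast

lemma H_arc:
  assumes "e \<in> arcs E" and "tail E e \<in> H"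
  shows "head E e \<in> H"
proof -
  have "vtx (tail E e) \<in> I" using assms(2) by (simp add: H_def)
  then have "gho e * (vtx (tail E e) * edg e) \<in> I"
    by (intro ring_ideal_left[OF ideal_I] ring_ideal_right[OF ideal_I])
  moreover have "gho e * (vtx (tail E e) * edg e) \<approx> vtx (head E e)"
    by (rule cong_trans[OF cong_left[OF tail_edg] gho_edg[OF assms(1)]])
  ultimately have "vtx (head E e) \<in> I" using cong_I by blast
  then show ?thesis using assms(1) by (simp add: H_def)
qed

lemma H_awalk: "awalk u \<alpha> w \<Longrightarrow> u \<in> H \<Longrightarrow> w \<in> H"
  by (induction \<alpha> arbitrary: u) (auto simp: awalk_Nil_iff awalk_Cons_iff H_arc)

lemma edg_head_H: "head E e \<in> H \<Longrightarrow> edg e \<approx> 0"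
  using cong_trans[OF cong_sym[OF edg_head] cong_zeroI1] H_J[of "head E e"] by (simp add: cong_zero_iff)

text \<open>The walks have positive degree, and since \<open>J\<close> is homogeneous, taking the
  part of degree 0 respects congruence.\<close>

lemma special_hom_part:
  assumes "special u g L"
  obtains k where "k \<noteq> 0" "hom_part 0 g \<approx> scal k * vtx u"
proof -
  obtain k where k: "k \<noteq> 0" and L: "\<And>k' \<gamma>. (k', \<gamma>) \<in> set L \<Longrightarrow> \<gamma> \<noteq> [] \<and> awalk u \<gamma> u"
    and g: "g \<approx> scal k * vtx u + walk_sum u L"
    using assms by (rule specialE) blast
  have "positive_degree (walk_sum u L)"
  proof (rule positive_degree_sum_list)
    fix x assume x: "x \<in> set L"
    obtain k' \<gamma> where "x = (k', \<gamma>)" by force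
    then show "positive_degree (case x of (k', \<gamma>) \<Rightarrow> scal k' * real_path u \<gamma>)"
      using L[of k' \<gamma>] x positive_degree_real_path[of \<gamma> k' u] by simp
  qed
  then have "hom_part 0 (scal k * vtx u + walk_sum u L) = scal k * vtx u"
    by (simp only: restrict_keys_add hom_part_positive hom_part_vtx) simp
  moreover have "hom_part 0 g \<approx> hom_part 0 (scal k * vtx u + walk_sum u L)"
    using g J_homogeneous unfolding cong_def homogeneous_closed_def restrict_keys_diff[symmetric] by blast
  ultimately have "hom_part 0 g \<approx> scal k * vtx u" by (simp only:)
  then show thesis by (rule that[OF k])
qed

text \<open>This is where all nonvanishing comes from. It is used with \<open>T\<close> =
  \<open>J\<close> to recognise elements outside \<open>J\<close>, and with a graded ideal inside
  \<open>I\<close> to show that this ideal lies in \<open>J\<close>.\<close>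

lemma special_notin_graded:
  assumes "special u g L" and "u \<notin> H" and "homogeneous_closed T" and "T \<subseteq> I"
  shows "g \<notin> T"
proof
  assume "g \<in> T"
  obtain k where k: "k \<noteq> 0" "hom_part 0 g \<approx> scal k * vtx u"
    by (rule special_hom_part[OF assms(1)])
  have "hom_part 0 g \<in> I"
    using \<open>g \<in> T\<close> assms(3,4) by (auto simp: homogeneous_closed_def)
  then have "scal k * vtx u \<in> I"
    using cong_I[OF k(2)] by blast
  moreover have "u \<in> verts E" using assms(1) by (simp add: special_def)
  ultimately show False using scal_vtx_notin_I k(1) assms(2) by blast
qed

lemma special_notin_J: "special u g L \<Longrightarrow> u \<notin> H \<Longrightarrow> g \<notin> J"
  by (rule special_notin_graded[OF _ _ J_homogeneous J_le_I])

text \<open>Closed walks at a breaking vertex start with an arc leaving \<open>H\<close>, so \<open>w\<^sup>H\<close> kills them.\<close>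

lemma special_break_elem:
  assumes "special w g L" and "w \<notin> H" and "finite (arcs_leaving E H w)"
    and "break_elem E H w * g * break_elem E H w \<in> I"
  shows "break_elem E H w \<in> I"
proof -
  let ?b = "break_elem E H w :: ('k, 'v, 'e) free_alg"
  obtain k where k: "k \<noteq> 0" and L: "\<And>k' \<gamma>. (k', \<gamma>) \<in> set L \<Longrightarrow> \<gamma> \<noteq> [] \<and> awalk w \<gamma> w"
    and g: "g \<approx> scal k * vtx w + walk_sum w L"
    using assms(1) by (rule specialE) blast
  have kill: "?b * real_path w \<gamma> \<approx> 0" if "\<gamma> \<noteq> []" "awalk w \<gamma> w" for \<gamma>
  proof -
    obtain e \<beta> where \<gamma>: "\<gamma> = e # \<beta>" using \<open>\<gamma> \<noteq> []\<close> by (cases \<gamma>) auto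
    then have "e \<in> arcs E" "tail E e = w" "awalk (head E e) \<beta> w"
      using \<open>awalk w \<gamma> w\<close> by (auto simp: awalk_Cons_iff)
    \<comment> \<open>The rest of the walk leads from the head of \<open>e\<close> back to w, which
      is outside the hereditary set \<open>H\<close>; hence so is the head of
      \<open>e\<close>.\<close>
    then have "e \<in> arcs_leaving E H w"
      using H_awalk[of "head E e" \<beta> w] assms(2) by (auto simp: arcs_leaving_def)
    from cong_zeroI2[OF break_elem_edg[OF assms(3) this], of "edges \<beta> * vtx w"] show ?thesis
      by (simp add: \<gamma> mult.assoc)
  qed
  have "?b * walk_sum w L \<approx> 0"
    using L
  proof (induction L)
    case (Cons x L)
    obtain k' \<gamma> where x: "x = (k', \<gamma>)" by force
    have "?b * (scal k' * real_path w \<gamma>) \<approx> 0"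
      using cong_zeroI1[OF kill[of \<gamma>], of "scal k'"] Cons.prems[of k' \<gamma>] x
      by (simp add: scal_commute_left)
    moreover have "?b * walk_sum w L \<approx> 0"
      using Cons.prems by (intro Cons.IH) auto
    ultimately have "?b * (scal k' * real_path w \<gamma>) + ?b * walk_sum w L \<approx> 0 + 0"
      by (rule cong_add)
    then show ?case by (simp add: x distrib_left)
  qed simp
  from cong_add[OF cong_refl this, of "?b * (scal k * vtx w)"]
  have "?b * (scal k * vtx w + walk_sum w L) \<approx> scal k * (?b * vtx w)"
    by (simp add: distrib_left scal_commute_left)
  with cong_left[OF g, of ?b] have "?b * g \<approx> scal k * (?b * vtx w)"
    by (rule cong_trans)
  also have "\<dots> \<approx> scal k * ?b"
    by (rule cong_left[OF break_elem_vtx])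
  finally have "?b * g * ?b \<approx> scal k * (?b * ?b)"
    using cong_right[of "?b * g" "scal k * ?b" ?b] by (simp add: mult.assoc)
  also have "\<dots> \<approx> scal k * ?b"
    by (rule cong_left[OF break_elem_idem[OF assms(3)]])
  finally have "scal k * ?b \<in> I"
    using assms(4) cong_I by blast
  then show ?thesis using scal_vtx_I_imp k by blast
qed

text \<open>Induction on the ghost length. If x e is outside \<open>J\<close> for some arc e, it has
  shorter ghosts and replaces x. Otherwise x = y c modulo \<open>J\<close>, with y free of ghosts
  and c either w or \<open>w\<^sup>H\<close>: in the first case y yields the special element, in the
  second x is forced into \<open>J\<close>. \<open>T\<close> is an arbitrary ideal inside
  \<open>I\<close>, so that graded ideals and the intersection of powers are both covered.\<close>

lemma ghost_bounded_special:
  assumes T: "ring_ideal T" "T \<subseteq> I"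
  shows "ghost_bounded n w x \<Longrightarrow> x \<in> T \<Longrightarrow> x \<notin> J \<Longrightarrow>
    \<exists>u g L. u \<notin> H \<and> g \<in> T \<and> special u g L"
proof (induction n arbitrary: w x)
  case 0
  then have x: "real_elem w x" by simp
  then obtain u \<alpha> L where *: "awalk u \<alpha> w" "special w (ghost_path w \<alpha> * x) L"
    using real_to_special[OF _ \<open>x \<notin> J\<close>] by blast
  moreover have "ghost_path w \<alpha> * x \<in> T" using T(1) \<open>x \<in> T\<close> by (rule ring_ideal_left)
  moreover have "w \<notin> H"
  proof
    assume "w \<in> H"
    then have "x * vtx w \<in> J" using H_J ring_ideal_left[OF ideal_J] by blast
    then show False using cong_J[OF real_elem_vtx[OF x]] \<open>x \<notin> J\<close> by blast
  qed
  ultimately show ?case by blast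
next
  case (Suc n)
  obtain y B g where y: "real_elem w y" and B: "finite B" "B \<subseteq> out_arcs E w"
    and g: "\<forall>e\<in>B. ghost_bounded n (head E e) (g e)" and x: "x \<approx> y + (\<Sum>e\<in>B. g e * gho e)"
    using Suc.prems(1) unfolding ghost_bounded.simps(2) by (elim exE conjE)
  have x_vtx: "x * vtx w \<approx> x" by (rule ghost_bounded_vtx[OF Suc.prems(1)])
  have wH: "w \<notin> H"
  proof
    assume "w \<in> H"
    then have "x * vtx w \<in> J" using H_J ring_ideal_left[OF ideal_J] by blast
    then show False using cong_J[OF x_vtx] \<open>x \<notin> J\<close> by blast
  qed
  \<comment> \<open>Right multiplication by \<open>e\<close> cancels the ghost arc of the summand at
    \<open>e\<close> and kills the other summands with ghosts, so the ghost length drops.\<close>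
  have xe: "x * edg e \<approx> y * edg e + (if e \<in> B then g e else 0)" if e: "e \<in> out_arcs E w" for e
  proof -
    have "(\<Sum>f\<in>B. g f * (gho f * edg e)) \<approx> (\<Sum>f\<in>B. if f = e then g e * vtx (head E e) else 0)"
    proof (rule cong_sum)
      fix f assume "f \<in> B"
      show "g f * (gho f * edg e) \<approx> (if f = e then g e * vtx (head E e) else 0)"
        using gho_edg[of e] gho_edg_orth[of f e] e by (auto intro: cong_left cong_zeroI1)
    qed
    also have "\<dots> = (if e \<in> B then g e * vtx (head E e) else 0)" using B(1) by simp
    also have "\<dots> \<approx> (if e \<in> B then g e else 0)"
      using ghost_bounded_vtx[of n "head E e" "g e"] g by auto
    finally have *: "(\<Sum>f\<in>B. g f * (gho f * edg e)) \<approx> (if e \<in> B then g e else 0)" .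
    have "x * edg e \<approx> y * edg e + (\<Sum>f\<in>B. g f * (gho f * edg e))"
      using cong_right[OF x, of "edg e"] by (simp add: distrib_right sum_distrib_right mult.assoc)
    then show ?thesis by (rule cong_trans[OF _ cong_add[OF cong_refl *]])
  qed
  show ?case
  proof (cases "\<exists>e\<in>out_arcs E w. x * edg e \<notin> J")
    case True
    then obtain e where e: "e \<in> out_arcs E w" "x * edg e \<notin> J" by blast
    have "ghost_bounded n (head E e) (y * edg e + (if e \<in> B then g e else 0))"
      using g by (intro ghost_bounded_add ghost_bounded_real[OF real_elem_edg[OF y e(1)]])
                 (auto intro: ghost_bounded_zero)
    then have "ghost_bounded n (head E e) (x * edg e)"
      by (rule ghost_bounded_cong[OF xe[OF e(1)]])
    moreover have "x * edg e \<in> T" using T(1) \<open>x \<in> T\<close> by (rule ring_ideal_right)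
    ultimately show ?thesis using e(2) by (rule Suc.IH)
  next
    case False
    then have xe0: "x * edg e \<approx> 0" if "e \<in> out_arcs E w" for e
      using that by (auto simp: cong_zero_iff)
    have g_eq: "g e \<approx> - (y * edg e)" if "e \<in> B" for e
    proof -
      have e: "e \<in> out_arcs E w" using that B(2) by blast
      have "y * edg e + g e \<approx> 0"
        using cong_trans[OF cong_sym[OF xe[OF e]] xe0[OF e]] that by simp
      from cong_diff[OF this cong_refl, of "y * edg e"] show ?thesis by simp
    qed
    have ye: "y * edg e \<approx> 0" if "e \<in> out_arcs E w" "e \<notin> B" for e
      using cong_trans[OF cong_sym[OF xe[OF that(1)]] xe0[OF that(1)]] that(2) by simp
    \<comment> \<open>Every x e being in \<open>J\<close> determines the coefficients: g e = - y e
      modulo \<open>J\<close>. Substituting this into x leaves y times w minus the sum of e e^* over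
      \<open>B\<close>, a first version of \<open>w\<^sup>H\<close> with the wrong index
      set.\<close>
    define c :: "('k, 'v, 'e) free_alg" where "c = vtx w - (\<Sum>e\<in>B. edg e * gho e)"
    have x_c: "x \<approx> y * c"
    proof -
      have "x \<approx> y * vtx w + (\<Sum>e\<in>B. - (y * edg e) * gho e)"
        by (rule cong_trans[OF x cong_add[OF cong_sym[OF real_elem_vtx[OF y]] cong_sum[OF cong_right[OF g_eq]]]])
      also have "\<dots> = y * c"
        by (simp add: c_def right_diff_distrib sum_distrib_left mult.assoc sum_negf)
      finally show ?thesis .
    qed
    have "y \<notin> J"
      using cong_J[OF x_c] \<open>x \<notin> J\<close> ring_ideal_right[OF ideal_J] by blast
    then obtain u \<alpha> L where \<alpha>: "awalk u \<alpha> w" and sp: "special w (ghost_path w \<alpha> * y) L"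
      using real_to_special[OF y] by blast
    define h where "h = ghost_path w \<alpha> * y"
    have hx: "ghost_path w \<alpha> * x \<in> T" using T(1) \<open>x \<in> T\<close> by (rule ring_ideal_left)
    have hx_c: "ghost_path w \<alpha> * x \<approx> h * c"
      using cong_left[OF x_c, of "ghost_path w \<alpha>"] by (simp add: h_def mult.assoc)
    have h_vtx: "h * vtx w \<approx> h"
      using cong_left[OF real_elem_vtx[OF y], of "ghost_path w \<alpha>"] by (simp add: h_def mult.assoc)
    have w: "w \<in> verts E" using sp by (simp add: special_def)
    define \<Lambda> where "\<Lambda> = arcs_leaving E H w"
    \<comment> \<open>For an arc f outside \<open>B\<close> the product h f vanishes modulo
      \<open>J\<close>. If f ended outside \<open>H\<close>, then f^* h f would be special at its
      head and hence not in \<open>J\<close>. So the arcs ending outside \<open>H\<close> are finite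
      in number.\<close>
    have \<Lambda>_B: "\<Lambda> \<subseteq> B"
    proof
      fix f assume "f \<in> \<Lambda>"
      then have f: "f \<in> arcs E" "tail E f = w" "head E f \<notin> H" "f \<in> out_arcs E w"
        by (auto simp: \<Lambda>_def arcs_leaving_def)
      show "f \<in> B"
      proof (rule ccontr)
        assume "f \<notin> B"
        then have "h * edg f \<approx> 0"
          using cong_zeroI1[OF ye[OF f(4)], of "ghost_path w \<alpha>"] by (simp add: h_def mult.assoc)
        then have "ghost_path (head E f) [f] * (h * edg f) * vtx (head E f) \<approx> 0"
          by (rule cong_zeroI2[OF cong_zeroI1])
        then have "ghost_path (head E f) [f] * h * real_path (head E f) [f] \<in> J"
          by (simp add: mult.assoc cong_zero_iff)
        moreover have "awalk w [f] (head E f)"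
          using f arc_implies_awalk[of f] by simp
        ultimately show False
          using special_notin_J[OF special_conjugate[OF sp[folded h_def]] f(3)] by blast
      qed
    qed
    have fin: "finite \<Lambda>" using \<Lambda>_B B(1) finite_subset by blast
    have c_eq: "c \<approx> break_elem E H w"
    proof -
      have eq: "(\<Sum>e\<in>B. edg e * gho e :: ('k, 'v, 'e) free_alg) =
          (\<Sum>e\<in>\<Lambda>. edg e * gho e) + (\<Sum>e\<in>B - \<Lambda>. edg e * gho e)"
        using sum.subset_diff[OF \<Lambda>_B B(1)] by (simp add: add.commute)
      have zero: "(\<Sum>e\<in>B - \<Lambda>. edg e * gho e) \<approx> (\<Sum>e\<in>B - \<Lambda>. 0)"
      proof (rule cong_sum[OF cong_zeroI2[OF edg_head_H]])
        fix e assume "e \<in> B - \<Lambda>"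
        then show "head E e \<in> H" using B(2) by (auto simp: \<Lambda>_def arcs_leaving_def)
      qed
      show ?thesis
        using cong_diff[OF cong_refl[of "vtx w"] cong_add[OF cong_refl[of "\<Sum>e\<in>\<Lambda>. edg e * gho e"] zero]]
        unfolding c_def break_elem_def \<Lambda>_def[symmetric] eq by simp
    qed
    show ?thesis
    \<comment> \<open>Without arcs to vertices outside \<open>H\<close>, c is w, and \<alpha>^* x
      itself is special.\<close>
    proof (cases "\<Lambda> = {}")
      case True
      then have "c \<approx> vtx w" using c_eq by (simp add: break_elem_def \<Lambda>_def)
      then have "ghost_path w \<alpha> * x \<approx> h"
        using hx_c h_vtx cong_left[of c "vtx w" h] cong_trans by blast
      then have "special w (ghost_path w \<alpha> * x) L"
        using sp special_cong h_def by blast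
      then show ?thesis using hx wH by blast
    next
      case False
      \<comment> \<open>At a regular vertex x = x w would be the sum of the x e e^*, which are all
        in \<open>J\<close>. As w emits arcs, it is an infinite emitter.\<close>
      have "\<not> regular_vertex E w"
      proof
        assume "regular_vertex E w"
        then have "x \<approx> x * (\<Sum>e\<in>out_arcs E w. edg e * gho e)"
          using cong_trans[OF cong_sym[OF x_vtx] cong_left[OF regular]] by blast
        also have "\<dots> = (\<Sum>e\<in>out_arcs E w. x * edg e * gho e)"
          by (simp add: sum_distrib_left mult.assoc)
        also have "\<dots> \<approx> (\<Sum>e\<in>out_arcs E w. 0)"
          by (rule cong_sum[OF cong_zeroI2[OF xe0]])
        finally show False using \<open>x \<notin> J\<close> by (simp add: cong_zero_iff)
      qed
      moreover have "out_arcs E w \<noteq> {}" using False by (auto simp: \<Lambda>_def arcs_leaving_def)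
      ultimately have br: "w \<in> breaking_vertices E H"
        using w wH fin False
        by (simp add: breaking_vertices_def regular_vertex_def infinite_emitter_def \<Lambda>_def)
      let ?b = "break_elem E H w :: ('k, 'v, 'e) free_alg"
      \<comment> \<open>Modulo \<open>J\<close> this is b h b, that is, k b, because b annihilates
        the closed walks of h. So b is in \<open>I\<close>, hence in \<open>J\<close>, and x = y b
        follows it.\<close>
      have "?b * (ghost_path w \<alpha> * x) \<in> I"
        using hx T(2) ring_ideal_left[OF ideal_I] by blast
      moreover have "?b * (ghost_path w \<alpha> * x) \<approx> ?b * (h * ?b)"
        by (rule cong_left[OF cong_trans[OF hx_c cong_left[OF c_eq]]])
      ultimately have "?b * h * ?b \<in> I"
        using cong_I by (simp add: mult.assoc)
      then have "?b \<in> I"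
        using special_break_elem[OF sp wH] fin by (simp add: \<Lambda>_def h_def)
      then have "y * ?b \<in> J" using break_J[OF br] ring_ideal_left[OF ideal_J] by blast
      then have "x \<in> J" using cong_J[OF cong_trans[OF x_c cong_left[OF c_eq]]] by blast
      then show ?thesis using \<open>x \<notin> J\<close> by blast
    qed
  qed
qed

text \<open>By the local units some x w stays outside \<open>J\<close>, and elements ending at one
  vertex have a bounded ghost length.\<close>

lemma ex_special:
  assumes T: "ring_ideal T" "T \<subseteq> I" and "\<not> T \<subseteq> J"
  shows "\<exists>u g L. u \<notin> H \<and> g \<in> T \<and> special u g L"
proof -
  obtain x where x: "x \<in> T" "x \<notin> J" using assms(3) by blast
  then have aug: "Poly_Mapping.lookup x 0 = 0" using T(2) I_augmentation by blast
  obtain W where W: "finite W" "x \<approx> x * (\<Sum>w\<in>W. vtx w)"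
    using right_local_unit[OF aug] by blast
  have "\<exists>w. x * vtx w \<notin> J"
  proof (rule ccontr)
    assume "\<not> ?thesis"
    then have "x * (\<Sum>w\<in>W. vtx w) \<in> J"
      unfolding sum_distrib_left by (intro ring_ideal_sum[OF ideal_J]) blast
    then show False using cong_J[OF W(2)] x(2) by blast
  qed
  then obtain w where w: "x * vtx w \<notin> J" by blast
  obtain n where n: "ghost_bounded n w (x * vtx w)" using ex_ghost_bounded[OF aug] by blast
  have "x * vtx w \<in> T" using T(1) x(1) by (rule ring_ideal_right)
  then show ?thesis using ghost_bounded_special[OF T n _ w] by blast
qed

theorem graded_subset_J:
  assumes "ring_ideal T" and "T \<subseteq> I" and "homogeneous_closed T"
  shows "T \<subseteq> J"
proof (rule ccontr)
  assume "\<not> T \<subseteq> J"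
  then obtain u g L where "u \<notin> H" "g \<in> T" "special u g L"
    using ex_special[OF assms(1,2)] by blast
  then show False using special_notin_graded assms(2,3) by blast
qed

section \<open>Closed walks without exits\<close>

text \<open>Modulo \<open>J\<close> the arc is the only one that leaves its tail. As a congruence
  the condition has the same form at regular vertices and at breaking vertices of \<open>S\<close>,
  and it can be used directly to collapse e e^*.\<close>

definition exitless :: "'e \<Rightarrow> bool" where
  "exitless e \<longleftrightarrow> edg e * gho e \<approx> vtx (tail E e)"

text \<open>Take a special element of \<open>T\<close> with the shortest list. An exit f at a vertex
  of one of its walks would permit a conjugation by f that loses this walk, contradicting
  minimality. Once e is the only arc to a vertex outside \<open>H\<close>, either the relation at a
  regular vertex or \<open>v\<^sup>H\<close> gives v = e e^* modulo \<open>J\<close>.\<close>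

lemma ex_special_exitless:
  assumes T: "ring_ideal T" "T \<subseteq> I" and "\<not> T \<subseteq> J"
  shows "\<exists>u g L. u \<notin> H \<and> g \<in> T \<and> special u g L \<and> (\<forall>(k, \<gamma>) \<in> set L. \<forall>e \<in> set \<gamma>. exitless e)"
proof -
  define P where "P n \<longleftrightarrow> (\<exists>u g L. u \<notin> H \<and> g \<in> T \<and> special u g L \<and> length L = n)" for n
  have "\<exists>n. P n" using ex_special[OF assms] unfolding P_def by blast
  then have LP: "P (LEAST n. P n)" by (rule LeastI_ex)
  then obtain u g L where uH: "u \<notin> H" and gT: "g \<in> T" and sp: "special u g L"
    and len: "length L = (LEAST n. P n)" unfolding P_def by blast
  have minimal: "length L \<le> length L'" if "u' \<notin> H" "g' \<in> T" "special u' g' L'" for u' g' L'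
  proof -
    have "P (length L')" unfolding P_def using that by blast
    then show ?thesis unfolding len by (rule Least_le)
  qed
  have "exitless e" if mem: "(k, \<gamma>) \<in> set L" "e \<in> set \<gamma>" for k \<gamma> e
  proof -
    have \<gamma>: "awalk u \<gamma> u" using specialE[OF sp] mem(1) by metis
    obtain \<pi> \<rho> where split: "\<gamma> = \<pi> @ e # \<rho>" using mem(2) by (meson split_list)
    define v where "v = tail E e"
    have \<pi>: "awalk u \<pi> v" and e: "e \<in> arcs E" and \<rho>: "awalk (head E e) \<rho> u"
      using \<gamma> unfolding split v_def by (auto simp: awalk_Cons_iff)
    define g' where "g' = ghost_path v \<pi> * g * real_path v \<pi>"
    define L' where "L' = conjugate \<pi> L"
    have vH: "v \<notin> H" "head E e \<notin> H"
      using H_awalk[OF \<rho>] H_arc[OF e] uH by (auto simp: v_def)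
    have g'T: "g' \<in> T"
      unfolding g'_def by (rule ring_ideal_right[OF T(1) ring_ideal_left[OF T(1) gT]])
    have sp': "special v g' L'"
      unfolding g'_def L'_def by (rule special_conjugate[OF sp \<pi>])
    have len': "length L' \<le> length L" by (simp add: L'_def length_conjugate)
    \<comment> \<open>Conjugating by the part of the walk before e makes e its first arc.\<close>
    have mem': "(k, e # \<rho> @ \<pi>) \<in> set L'"
      using conjugate_prefix[of k \<pi> "e # \<rho>" L] mem(1) by (simp add: split L'_def)
    have only: "f = e" if f: "f \<in> arcs_leaving E H v" for f
    proof (rule ccontr)
      assume "f \<noteq> e"
      have f': "f \<in> arcs E" "tail E f = v" "head E f \<notin> H"
        using f by (auto simp: arcs_leaving_def)
      have walk: "awalk v [f] (head E f)" using f' arc_implies_awalk[of f] by simp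
      have "ghost_path (head E f) [f] * g' * real_path (head E f) [f] \<in> T"
        by (rule ring_ideal_right[OF T(1) ring_ideal_left[OF T(1) g'T]])
      from minimal[OF f'(3) this special_conjugate[OF sp' walk]]
      have "length L \<le> length (conjugate [f] L')" .
      \<comment> \<open>A walk starting with e cannot have f as a prefix, so conjugation by f
        removes at least this entry of the list.\<close>
      moreover have "\<not> survives [f] (e # \<rho> @ \<pi>)"
        using \<open>f \<noteq> e\<close> by (auto simp: survives_def)
      ultimately show False
        using length_conjugate_less[OF mem'] len' by fastforce
    qed
    have leaving: "arcs_leaving E H v = {e}"
      using only e vH by (auto simp: arcs_leaving_def v_def)
    have v: "v \<in> verts E" using e by (simp add: v_def)
    have e_out: "e \<in> out_arcs E v" using e by (simp add: v_def)
    show "exitless e"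
    proof (cases "finite (out_arcs E v)")
      case True
      then have reg: "regular_vertex E v"
        using v e_out by (auto simp: regular_vertex_def)
      \<comment> \<open>All arcs other than e end in \<open>H\<close> and vanish modulo
        \<open>J\<close>, so a single term of the relation at v is left.\<close>
      have "(\<Sum>f\<in>out_arcs E v. edg f * gho f) \<approx> (\<Sum>f\<in>out_arcs E v. if f = e then edg e * gho e else 0)"
      proof (rule cong_sum)
        fix f assume f: "f \<in> out_arcs E v"
        show "edg f * gho f \<approx> (if f = e then edg e * gho e else 0)"
        proof (cases "f = e")
          case False
          then have "head E f \<in> H" using only[of f] f by (auto simp: arcs_leaving_def)
          then show ?thesis using False by (simp add: cong_zeroI2 edg_head_H)
        qed simp
      qed
      also have "\<dots> = edg e * gho e" using True e by (simp add: v_def)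
      finally show ?thesis
        unfolding exitless_def v_def[symmetric]
        by (rule cong_sym[OF cong_trans[OF regular[OF reg]]])
    next
      case False
      \<comment> \<open>Infinitely many arcs with only e ending outside \<open>H\<close> make v a
        breaking vertex, with \<open>v\<^sup>H\<close> = v - e e^*. The special element at v forces
        this into \<open>I\<close>, hence into \<open>J\<close>.\<close>
      then have br: "v \<in> breaking_vertices E H"
        using vH(1) v by (simp add: breaking_vertices_def infinite_emitter_def leaving)
      have "break_elem E H v * g' * break_elem E H v \<in> I"
        using g'T T(2) by (intro ring_ideal_right[OF ideal_I ring_ideal_left[OF ideal_I]]) blast
      then have "break_elem E H v \<in> I"
        using special_break_elem[OF sp' vH(1)] leaving by simp
      then have "break_elem E H v \<in> J" by (rule break_J[OF br])
      then have "vtx v \<approx> edg e * gho e"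
        by (simp add: break_elem_def leaving cong_def)
      then show ?thesis unfolding exitless_def v_def[symmetric] by (rule cong_sym)
    qed
  qed
  then have "\<forall>(k, \<gamma>)\<in>set L. \<forall>e\<in>set \<gamma>. exitless e" by blast
  with uH gT sp show ?thesis by (intro exI conjI)
qed

end

text \<open>A nonzero constant coefficient makes g coprime to X, and one factor X is removed at a
  time. This undoes the multiplication by a power of the cycle that clears ghost paths.\<close>

lemma dvd_monom_mult_cancel:
  fixes g :: "'a::idom poly"
  assumes "coeff g 0 \<noteq> 0" and "g dvd monom 1 N * p"
  shows "g dvd p"
  using assms(2)
proof (induction N)
  case (Suc N)
  have "g dvd pCons 0 (monom 1 N * p)"
    using Suc.prems by (simp add: monom_Suc)
  then obtain h where h: "pCons 0 (monom 1 N * p) = g * h" by (auto elim: dvdE)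
  have "coeff (g * h) 0 = 0" unfolding h[symmetric] by simp
  then have "coeff g 0 * coeff h 0 = 0" by (simp add: coeff_mult)
  then obtain h' where "h = pCons 0 h'" using assms(1) by (cases h) auto
  then have "monom 1 N * p = g * h'" using h by simp
  then show ?case using Suc.IH by simp
qed (simp add: monom_0)

context leavitt_ideal_pair
begin

text \<open>Since s(e) = e e^*, one gets f = e e^* f = 0 modulo \<open>J\<close>, and r(f) = f^* f
  follows.\<close>

lemma exitless_unique:
  assumes "exitless e" and "f \<in> arcs E" and "tail E f = tail E e" and "f \<noteq> e"
  shows "head E f \<in> H"
proof -
  have "edg f \<approx> vtx (tail E e) * edg f"
    using cong_sym[OF tail_edg[of f]] assms(3) by simp
  also have "\<dots> \<approx> edg e * gho e * edg f"
    using assms(1) unfolding exitless_def by (rule cong_right[OF cong_sym])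
  also have "\<dots> = edg e * (gho e * edg f)" by (simp add: mult.assoc)
  also have "\<dots> \<approx> 0" using assms(4) by (intro cong_zeroI1[OF gho_edg_orth]) simp
  finally have "gho f * edg f \<approx> 0" by (rule cong_zeroI1)
  then have "vtx (head E f) \<in> J"
    unfolding cong_zero_iff[symmetric] by (rule cong_trans[OF cong_sym[OF gho_edg[OF assms(2)]]])
  then show ?thesis using J_le_I assms(2) by (intro vtx_I_imp) auto
qed

text \<open>Since \<open>H\<close> is hereditary and z is outside it, t never enters
  \<open>H\<close>; so at each vertex t must take the arc that \<gamma> takes.\<close>

lemma exitless_walks_agree:
  assumes "awalk u \<gamma> w" and "\<forall>e\<in>set \<gamma>. exitless e" and "awalk u t z" and "z \<notin> H"
    and "length t \<le> length \<gamma>"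
  shows "t = take (length t) \<gamma>"
  using assms
proof (induction t arbitrary: u \<gamma>)
  case (Cons f t)
  then obtain e \<gamma>' where \<gamma>: "\<gamma> = e # \<gamma>'" by (cases \<gamma>) auto
  have f: "f \<in> arcs E" "tail E f = u" "awalk (head E f) t z"
    using Cons.prems(3) by (auto simp: awalk_Cons_iff)
  have e: "tail E e = u" "awalk (head E e) \<gamma>' w" "exitless e"
    using Cons.prems(1,2) by (auto simp: awalk_Cons_iff \<gamma>)
  have "head E f \<notin> H" using H_awalk[OF f(3)] Cons.prems(4) by blast
  then have "f = e" using exitless_unique[OF e(3) f(1)] f(2) e(1) by auto
  moreover have "t = take (length t) \<gamma>'"
    using Cons.IH[of "head E e" \<gamma>'] Cons.prems(2,4,5) e(2) f(3) \<open>f = e\<close> by (simp add: \<gamma>)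
  ultimately show ?case by (simp add: \<gamma>)
qed simp

text \<open>The product collapses from the inside, each layer by e e^* = s(e).\<close>

lemma exitless_walk_unit:
  assumes "awalk u \<alpha> w" and "\<forall>e\<in>set \<alpha>. exitless e"
  shows "edges \<alpha> * vtx w * ghosts \<alpha> \<approx> vtx u"
  using assms
proof (induction \<alpha> arbitrary: u)
  case Nil
  then show ?case by (simp add: awalk_Nil_iff)
next
  case (Cons e \<alpha>)
  then have e: "tail E e = u" "awalk (head E e) \<alpha> w" "exitless e"
    by (auto simp: awalk_Cons_iff)
  have "edges (e # \<alpha>) * vtx w * ghosts (e # \<alpha>) = edg e * (edges \<alpha> * vtx w * ghosts \<alpha>) * gho e"
    by (simp add: mult.assoc)
  also have "\<dots> \<approx> edg e * vtx (head E e) * gho e"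
    using Cons.prems(2) by (intro cong_mult3 Cons.IH[OF e(2)]) simp
  also have "\<dots> \<approx> edg e * gho e" by (rule cong_right[OF edg_head])
  also have "\<dots> \<approx> vtx u" using e(3) by (simp add: exitless_def e(1))
  finally show ?case .
qed

end

section \<open>Powers of a shortest closed walk without exits\<close>

text \<open>Minimality of c is required only among closed walks at u. That all of these are powers
  of c is a consequence of the absence of exits.\<close>

locale exitless_cycle = leavitt_ideal_pair E J I H
  for E :: "('v, 'e) pre_digraph" and J :: "('k::field, 'v, 'e) free_alg set" and I H +
  fixes u :: 'v and c :: "'e list"
  assumes u_notin_H: "u \<notin> H"
    and c_walk: "awalk u c u" and c_ne: "c \<noteq> []"
    and c_exitless: "\<forall>e\<in>set c. exitless e"
    and c_minimal: "awalk u t u \<Longrightarrow> t \<noteq> [] \<Longrightarrow> length c \<le> length t"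
begin

definition cyc :: "('k, 'v, 'e) free_alg" where "cyc = real_path u c"
definition gcyc :: "('k, 'v, 'e) free_alg" where "gcyc = ghost_path u c"

lemma u_vert: "u \<in> verts E"
  using c_walk by blast

lemma vtx_cyc: "vtx u * cyc \<approx> cyc"
  using vtx_real_path[OF c_walk, of u] by (simp add: cyc_def)

lemma cyc_vtx: "cyc * vtx u \<approx> cyc"
  unfolding cyc_def by (rule real_path_vtx)

lemma gcyc_cyc: "gcyc * cyc \<approx> vtx u"
  unfolding cyc_def gcyc_def by (rule ghost_path_real_path[OF c_walk])

text \<open>Here the absence of exits enters: together with \<open>gcyc_cyc\<close> it makes the
  cycle invertible modulo \<open>J\<close>, with u as the unit.\<close>

lemma cyc_gcyc: "cyc * gcyc \<approx> vtx u"
proof -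
  have "cyc * gcyc = edges c * (vtx u * vtx u) * ghosts c"
    by (simp add: cyc_def gcyc_def mult.assoc)
  also have "\<dots> \<approx> edges c * vtx u * ghosts c"
    by (rule cong_mult3[OF vtx_idem])
  also have "\<dots> \<approx> vtx u"
    by (rule exitless_walk_unit[OF c_walk c_exitless])
  finally show ?thesis .
qed

text \<open>A nonempty closed walk is at least as long as c, and without exits its first arcs have
  to be those of c. Removing this copy of c leaves a shorter closed walk.\<close>

lemma closed_walk_replicate:
  "awalk u t u \<Longrightarrow> \<exists>m. t = concat (replicate m c)"
proof (induction t rule: length_induct)
  case (1 t)
  show ?case
  proof (cases "t = []")
    case True
    then show ?thesis by (intro exI[of _ 0]) simp
  next
    case False
    have len: "length c \<le> length t" by (rule c_minimal[OF 1(2) False])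
    define t1 where "t1 = take (length c) t"
    define t2 where "t2 = drop (length c) t"
    have split: "t = t1 @ t2" by (simp add: t1_def t2_def)
    obtain z where z: "awalk u t1 z" "awalk z t2 u"
      using 1(2) unfolding split by auto
    have "z \<notin> H" using H_awalk[OF z(2)] u_notin_H by blast
    then have "t1 = take (length t1) c"
      using exitless_walks_agree[OF c_walk c_exitless z(1)] by (simp add: t1_def)
    then have t1: "t1 = c" using len by (simp add: t1_def)
    then have "awalk u t2 u"
      using awalk_append_cancel[OF c_walk, of t2 u] 1(2) split by simp
    moreover have "length t2 < length t"
      using c_ne len by (cases c) (auto simp: t2_def)
    ultimately obtain m where "t2 = concat (replicate m c)" using 1(1) by blast
    then have "t = concat (replicate (Suc m) c)" by (simp add: split t1)
    then show ?thesis by blast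
  qed
qed

lemma replicate_walk: "awalk u (concat (replicate m c)) u"
  using c_walk u_vert by (induction m) (auto simp: awalk_Nil_iff intro: awalk_appendI simp del: awalk_append_iff)

text \<open>The factor u matters for m = 0, where \<open>cyc ^ 0\<close> is the unit of the free
  algebra while the empty walk is the vertex.\<close>

lemma replicate_real_path: "real_path u (concat (replicate m c)) \<approx> cyc ^ m * vtx u"
proof (induction m)
  case (Suc m)
  have "real_path u (concat (replicate (Suc m) c)) \<approx> real_path u c * real_path u (concat (replicate m c))"
    using cong_sym[OF real_path_append[OF replicate_walk, of c m]] by simp
  also have "\<dots> \<approx> cyc * (cyc ^ m * vtx u)"
    unfolding cyc_def[symmetric] by (rule cong_left[OF Suc.IH])
  finally show ?case by (simp add: mult.assoc)
qed simp


section \<open>Polynomials in an exitless cycle\<close>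

text \<open>Evaluation at the cycle by Horner's scheme. Constants become multiples of u, the unit of
  the corner in which the cycle lives.\<close>

definition ev :: "'k poly \<Rightarrow> ('k, 'v, 'e) free_alg" where
  "ev p = fold_coeffs (\<lambda>a x. scal a * vtx u + cyc * x) p 0"

lemma ev_0 [simp]: "ev 0 = 0"
  by (simp add: ev_def)

lemma ev_pCons [simp]: "ev (pCons a p) = scal a * vtx u + cyc * ev p"
  by (cases "p = 0 \<and> a = 0") (auto simp: ev_def)

lemma ev_add: "ev (p + q) = ev p + ev q"
  by (induction p q rule: poly_induct2) (simp_all add: scal_add algebra_simps)

lemma ev_uminus: "ev (- p) = - ev p"
  by (induction p) (simp_all add: scal_uminus)

lemma ev_diff: "ev (p - q) = ev p - ev q"
  using ev_add[of p "- q"] by (simp add: ev_uminus)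

lemma ev_smult: "ev (smult k p) = scal k * ev p"
  by (induction p) (simp_all add: scal_mult distrib_left mult.assoc scal_commute_left[of cyc])

lemma ev_monom: "ev (monom k m) = scal k * (cyc ^ m * vtx u)"
  by (induction m) (simp_all add: monom_0 monom_Suc scal_commute_left[of cyc] mult.assoc)

lemma vtx_ev: "vtx u * ev p \<approx> ev p"
proof (induction p)
  case (pCons a p)
  have "vtx u * ev (pCons a p) = scal a * (vtx u * vtx u) + (vtx u * cyc) * ev p"
    by (simp add: distrib_left scal_commute_left mult.assoc)
  also have "\<dots> \<approx> scal a * vtx u + cyc * ev p"
    by (rule cong_add[OF cong_left[OF vtx_idem] cong_right[OF vtx_cyc]])
  finally show ?case by simp
qed simp

lemma ev_vtx: "ev p * vtx u \<approx> ev p"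
proof (induction p)
  case (pCons a p)
  have "ev (pCons a p) * vtx u = scal a * (vtx u * vtx u) + cyc * (ev p * vtx u)"
    by (simp add: distrib_right mult.assoc)
  also have "\<dots> \<approx> scal a * vtx u + cyc * ev p"
    by (rule cong_add[OF cong_left[OF vtx_idem] cong_left[OF pCons.IH]])
  finally show ?case by simp
qed simp

lemma ev_cyc: "ev p * cyc \<approx> cyc * ev p"
proof (induction p)
  case (pCons a p)
  have "ev (pCons a p) * cyc = scal a * (vtx u * cyc) + cyc * (ev p * cyc)"
    by (simp add: distrib_right mult.assoc)
  also have "\<dots> \<approx> scal a * cyc + cyc * (cyc * ev p)"
    by (rule cong_add[OF cong_left[OF vtx_cyc] cong_left[OF pCons.IH]])
  also have "\<dots> \<approx> scal a * (cyc * vtx u) + cyc * (cyc * ev p)"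
    by (rule cong_add[OF cong_left[OF cong_sym[OF cyc_vtx]] cong_refl])
  also have "\<dots> = cyc * ev (pCons a p)"
    by (simp add: distrib_left scal_commute_left)
  finally show ?case .
qed simp

text \<open>Multiplicative only up to congruence, since u acts as a unit on values of
  \<open>ev\<close> only modulo \<open>J\<close>.\<close>

lemma ev_mult: "ev (p * q) \<approx> ev p * ev q"
proof (induction p)
  case (pCons a p)
  have "ev (pCons a p * q) = scal a * ev q + cyc * ev (p * q)"
    by (simp add: ev_add ev_smult)
  also have "\<dots> \<approx> scal a * (vtx u * ev q) + cyc * (ev p * ev q)"
    by (rule cong_add[OF cong_left[OF cong_sym[OF vtx_ev]] cong_left[OF pCons.IH]])
  also have "\<dots> = ev (pCons a p) * ev q"
    by (simp add: distrib_right mult.assoc)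
  finally show ?case .
qed simp

text \<open>What commutes with an invertible element commutes with its inverse.\<close>

lemma ev_gcyc: "ev p * gcyc \<approx> gcyc * ev p"
proof -
  have "ev p * gcyc \<approx> vtx u * ev p * gcyc"
    by (rule cong_right[OF cong_sym[OF vtx_ev]])
  also have "\<dots> \<approx> gcyc * cyc * ev p * gcyc"
    by (rule cong_right[OF cong_right[OF cong_sym[OF gcyc_cyc]]])
  also have "\<dots> = gcyc * (cyc * ev p) * gcyc" by (simp add: mult.assoc)
  also have "\<dots> \<approx> gcyc * (ev p * cyc) * gcyc"
    by (rule cong_mult3[OF cong_sym[OF ev_cyc]])
  also have "\<dots> = gcyc * ev p * (cyc * gcyc)" by (simp add: mult.assoc)
  also have "\<dots> \<approx> gcyc * ev p * vtx u"
    by (rule cong_left[OF cyc_gcyc])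
  also have "\<dots> = gcyc * (ev p * vtx u)" by (simp add: mult.assoc)
  also have "\<dots> \<approx> gcyc * ev p" by (rule cong_left[OF ev_vtx])
  finally show ?thesis .
qed

lemma ev_gcyc_power: "ev p * gcyc ^ N \<approx> gcyc ^ N * ev p"
proof (induction N)
  case (Suc N)
  have "ev p * gcyc ^ Suc N = ev p * gcyc * gcyc ^ N" by (simp add: mult.assoc)
  also have "\<dots> \<approx> gcyc * ev p * gcyc ^ N" by (rule cong_right[OF ev_gcyc])
  also have "\<dots> = gcyc * (ev p * gcyc ^ N)" by (simp add: mult.assoc)
  also have "\<dots> \<approx> gcyc * (gcyc ^ N * ev p)" by (rule cong_left[OF Suc.IH])
  finally show ?case by (simp add: mult.assoc)
qed simp

lemma cyc_gcyc_power: "cyc ^ N * vtx u * gcyc ^ N \<approx> vtx u"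
proof (induction N)
  case (Suc N)
  have "cyc ^ Suc N * vtx u * gcyc ^ Suc N = cyc * (cyc ^ N * vtx u * gcyc ^ N) * gcyc"
    by (simp add: mult.assoc power_commutes[of gcyc])
  also have "\<dots> \<approx> cyc * vtx u * gcyc" by (rule cong_mult3[OF Suc.IH])
  also have "\<dots> \<approx> cyc * gcyc" by (rule cong_right[OF cyc_vtx])
  also have "\<dots> \<approx> vtx u" by (rule cyc_gcyc)
  finally show ?case .
qed simp

lemma closed_walk_ev:
  assumes "awalk u t u"
  shows "\<exists>m. real_path u t \<approx> ev (monom 1 m) \<and> (t \<noteq> [] \<longrightarrow> m \<noteq> 0)"
proof -
  obtain m where m: "t = concat (replicate m c)" using closed_walk_replicate[OF assms] by blast
  have "real_path u t \<approx> ev (monom 1 m)"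
    using replicate_real_path[of m] by (simp add: ev_monom m)
  moreover have "t \<noteq> [] \<longrightarrow> m \<noteq> 0" by (auto simp: m)
  ultimately show ?thesis by blast
qed

lemma ev_sum: "(\<And>i. i \<in> S \<Longrightarrow> \<exists>q. h i \<approx> ev q) \<Longrightarrow> \<exists>q. sum h S \<approx> ev q"
proof (induction S rule: infinite_finite_induct)
  case (insert x S)
  have "\<exists>q. sum h S \<approx> ev q" using insert.prems by (intro insert.IH) simp
  then obtain q where "sum h S \<approx> ev q" by blast
  moreover obtain p where "h x \<approx> ev p" using insert.prems[of x] by auto
  ultimately have "sum h (insert x S) \<approx> ev (p + q)"
    using insert.hyps by (simp add: ev_add cong_add)
  then show ?case by blast
qed (auto intro!: exI[of _ 0])

text \<open>Nonempty closed walks become positive powers of X, so they cannot cancel the constant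
  coefficient k.\<close>

lemma special_ev:
  assumes "special u g L"
  obtains p where "coeff p 0 \<noteq> 0" "g \<approx> ev p"
proof -
  obtain k where k: "k \<noteq> 0" and L: "\<And>k' \<gamma>. (k', \<gamma>) \<in> set L \<Longrightarrow> \<gamma> \<noteq> [] \<and> awalk u \<gamma> u"
    and g: "g \<approx> scal k * vtx u + walk_sum u L"
    using assms by (rule specialE) blast
  have "\<exists>q. coeff q 0 = 0 \<and> walk_sum u L \<approx> ev q"
    using L
  proof (induction L)
    case Nil
    then show ?case by (intro exI[of _ 0]) simp
  next
    case (Cons x L)
    obtain k' \<gamma> where x: "x = (k', \<gamma>)" by force
    have \<gamma>: "awalk u \<gamma> u" "\<gamma> \<noteq> []" using Cons.prems[of k' \<gamma>] x by auto
    obtain m where m: "real_path u \<gamma> \<approx> ev (monom 1 m)" "m \<noteq> 0"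
      using closed_walk_ev[OF \<gamma>(1)] \<gamma>(2) by blast
    have "\<exists>q. coeff q 0 = 0 \<and> walk_sum u L \<approx> ev q"
      using Cons.prems by (intro Cons.IH) auto
    then obtain q where q: "coeff q 0 = 0" "walk_sum u L \<approx> ev q"
      by blast
    have "walk_sum u (x # L) \<approx> ev (smult k' (monom 1 m) + q)"
      using cong_add[OF cong_left[OF m(1), of "scal k'"] q(2)] by (simp only: x ev_add ev_smult) simp
    then show ?case using m(2) q(1) by (intro exI[of _ "smult k' (monom 1 m) + q"]) simp
  qed
  then obtain q where q: "coeff q 0 = 0" "walk_sum u L \<approx> ev q"
    by blast
  have "g \<approx> ev ([:k:] + q)"
    using cong_trans[OF g cong_add[OF cong_refl q(2)]] by (simp add: ev_add)
  moreover have "coeff ([:k:] + q) 0 \<noteq> 0" using k q(1) by simp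
  ultimately show thesis by (intro that[of "[:k:] + q"])
qed

text \<open>Left multiplication by u keeps exactly those paths that also start at u, which are
  powers of the cycle.\<close>

lemma real_elem_ev:
  assumes "real_elem u y"
  shows "\<exists>q. vtx u * y \<approx> ev q"
proof -
  obtain A \<kappa> where A: "\<forall>\<alpha>\<in>A. \<exists>w. awalk w \<alpha> u" "y \<approx> path_sum u \<kappa> A"
    using assms unfolding real_elem_def by blast
  have "\<exists>q. scal (\<kappa> \<alpha>) * (vtx u * real_path u \<alpha>) \<approx> ev q" if \<alpha>: "\<alpha> \<in> A" for \<alpha>
  proof -
    obtain w where w: "awalk w \<alpha> u" using A(1) \<alpha> by blast
    have v: "vtx u * real_path u \<alpha> \<approx> (if u = w then real_path u \<alpha> else 0)"
      by (rule vtx_real_path[OF w])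
    have "\<exists>q. vtx u * real_path u \<alpha> \<approx> ev q"
    proof (cases "u = w")
      case True
      obtain m where m: "real_path u \<alpha> \<approx> ev (monom 1 m)"
        using closed_walk_ev[of \<alpha>] w True by blast
      have "vtx u * real_path u \<alpha> \<approx> real_path u \<alpha>" using v True by simp
      from cong_trans[OF this m] show ?thesis by blast
    next
      case False
      then show ?thesis using v by (intro exI[of _ 0]) simp
    qed
    then obtain q where "vtx u * real_path u \<alpha> \<approx> ev q" by blast
    then have "scal (\<kappa> \<alpha>) * (vtx u * real_path u \<alpha>) \<approx> ev (smult (\<kappa> \<alpha>) q)"
      unfolding ev_smult by (rule cong_left)
    then show ?thesis by blast
  qed
  then have "\<exists>q. (\<Sum>\<alpha>\<in>A. scal (\<kappa> \<alpha>) * (vtx u * real_path u \<alpha>)) \<approx> ev q"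
    by (rule ev_sum)
  then obtain q where q: "(\<Sum>\<alpha>\<in>A. scal (\<kappa> \<alpha>) * (vtx u * real_path u \<alpha>)) \<approx> ev q" by blast
  have "vtx u * y \<approx> (\<Sum>\<alpha>\<in>A. scal (\<kappa> \<alpha>) * (vtx u * real_path u \<alpha>))"
    using cong_left[OF A(2), of "vtx u"] by (simp add: sum_distrib_left scal_commute_left)
  from cong_trans[OF this q] show ?thesis by blast
qed

lemma nonneg_degree_ev: "nonneg_degree (ev p)"
proof (induction p)
  case (pCons a p)
  have "nonneg_degree cyc"
    unfolding cyc_def
    by (rule positive_imp_nonneg_degree[OF positive_degree_mult(1)[OF positive_degree_edges[OF c_ne] nonneg_degree_vtx]])
  then show ?case
    using pCons.IH by (simp add: nonneg_degree_add nonneg_degree_mult nonneg_degree_scal nonneg_degree_vtx)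
qed (simp add: nonneg_degree_zero)

text \<open>Injectivity modulo \<open>J\<close>: the part of degree 0 shows that the constant
  coefficient vanishes, and multiplication by the inverse of the cycle then divides the polynomial
  by X.\<close>

lemma ev_J_imp_zero: "ev p \<in> J \<Longrightarrow> p = 0"
proof (induction p)
  case (pCons a p)
  have "positive_degree cyc"
    unfolding cyc_def by (rule positive_degree_mult(1)[OF positive_degree_edges[OF c_ne] nonneg_degree_vtx])
  then have "positive_degree (cyc * ev p)" by (rule positive_degree_mult(1)[OF _ nonneg_degree_ev])
  then have "hom_part 0 (ev (pCons a p)) = scal a * vtx u"
    unfolding ev_pCons restrict_keys_add hom_part_vtx by (simp add: hom_part_positive)
  then have "scal a * vtx u \<in> J"
    using pCons.prems J_homogeneous unfolding homogeneous_closed_def by metis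
  then have a: "a = 0"
    using scal_vtx_notin_I[of u a] u_vert u_notin_H J_le_I by blast
  then have "gcyc * (cyc * ev p) \<in> J"
    using pCons.prems ring_ideal_left[OF ideal_J] by simp
  moreover have "gcyc * (cyc * ev p) \<approx> ev p"
    using cong_trans[OF cong_right[OF gcyc_cyc] vtx_ev] by (simp add: mult.assoc)
  ultimately have "ev p \<in> J" using cong_J by blast
  then show ?case using pCons.IH a by simp
qed simp

text \<open>The polynomials with value in \<open>I\<close> form an ideal of a principal ideal
  domain, and f is a generator of least degree. A zero constant coefficient would allow division by
  X, the cycle being invertible; a constant f would put u into \<open>I\<close>.\<close>

lemma ex_generator:
  assumes "ev p \<in> I" and "p \<noteq> 0"
  obtains f where "ev f \<in> I" "coeff f 0 \<noteq> 0" "degree f \<noteq> 0" "\<And>q. ev q \<in> I \<Longrightarrow> f dvd q"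
proof -
  define P where "P n \<longleftrightarrow> (\<exists>f. f \<noteq> 0 \<and> ev f \<in> I \<and> degree f = n)" for n
  have "\<exists>n. P n" using assms unfolding P_def by blast
  then have "P (LEAST n. P n)" by (rule LeastI_ex)
  then obtain f where f: "f \<noteq> 0" "ev f \<in> I" "degree f = (LEAST n. P n)"
    unfolding P_def by blast
  have minimal: "degree f \<le> degree q" if "q \<noteq> 0" "ev q \<in> I" for q
  proof -
    have "P (degree q)" unfolding P_def using that by blast
    then show ?thesis unfolding f(3) by (rule Least_le)
  qed
  have coeff: "coeff f 0 \<noteq> 0"
  proof
    assume "coeff f 0 = 0"
    then obtain g where g: "f = pCons 0 g" by (cases f) auto
    then have "gcyc * (cyc * ev g) \<in> I"
      using f(2) ring_ideal_left[OF ideal_I] by simp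
    moreover have "gcyc * (cyc * ev g) \<approx> ev g"
      using cong_trans[OF cong_right[OF gcyc_cyc] vtx_ev] by (simp add: mult.assoc)
    ultimately have "ev g \<in> I" using cong_I by blast
    moreover have "g \<noteq> 0" using f(1) g by auto
    ultimately show False using minimal[of g] g by simp
  qed
  have "degree f \<noteq> 0"
  proof
    assume "degree f = 0"
    then obtain a where a: "f = [:a:]" by (rule degree_eq_zeroE)
    then show False
      using f(1,2) scal_vtx_notin_I[of u a] u_vert u_notin_H by simp
  qed
  moreover have "f dvd q" if q: "ev q \<in> I" for q
  proof -
    have "ev ((q div f) * f) \<in> I"
      using cong_I[OF ev_mult] ring_ideal_left[OF ideal_I f(2)] by blast
    then have "ev (q - (q div f) * f) \<in> I"
      unfolding ev_diff using q ring_ideal_diff[OF ideal_I] by blast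
    then have "ev (q mod f) \<in> I" by (simp add: minus_div_mult_eq_mod)
    then have "q mod f = 0"
      using minimal[of "q mod f"] degree_mod_less[OF f(1), of q] by force
    then show ?thesis by (simp add: dvd_eq_mod_eq_0)
  qed
  ultimately show thesis by (intro that[OF f(2) coeff])
qed

text \<open>Group the paths by the closed walks at their ends. For a shortest path \<alpha>,
  \<alpha>^* y is a polynomial in the cycle that lies in \<open>I\<close>, hence a multiple of f(c).
  Multiplying back by \<alpha> recovers the part of y carried by the paths \<alpha>\<gamma>, and
  induction treats the remaining paths.\<close>

lemma real_in_ideal:
  assumes dvd: "\<And>q. ev q \<in> I \<Longrightarrow> f dvd q"
    and "finite A" and "\<forall>\<alpha>\<in>A. \<exists>w. awalk w \<alpha> u"
    and "y \<approx> path_sum u \<kappa> A" and "y \<in> I"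
  shows "\<exists>a. y \<approx> a * ev f"
  using assms(2-5)
proof (induction A arbitrary: y rule: finite_psubset_induct)
  case (psubset A)
  note walks = psubset.prems(1) and y = psubset.prems(2) and yI = psubset.prems(3)
  show ?case
  proof (cases "A = {}")
    case True
    then have "y \<approx> 0 * ev f" using y by simp
    then show ?thesis by blast
  next
    case False
    obtain \<alpha> where \<alpha>: "\<alpha> \<in> A" "\<And>\<beta>. \<beta> \<in> A \<Longrightarrow> length \<alpha> \<le> length \<beta>"
      using arg_min_if_finite[OF psubset.hyps(1) False, of length] by (meson not_le_imp_less)
    obtain w where w: "awalk w \<alpha> u" using walks \<alpha>(1) by blast
    define B where "B = {\<beta> \<in> A. \<exists>\<gamma>. \<beta> = \<alpha> @ \<gamma> \<and> awalk u \<gamma> u}"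
    have B: "B \<subseteq> A" "\<alpha> \<in> B" using \<alpha>(1) u_vert by (auto simp: B_def awalk_Nil_iff)
    define rest where "rest \<beta> = drop (length \<alpha>) \<beta>" for \<beta> :: "'e list"
    have rest: "\<beta> = \<alpha> @ rest \<beta>" "awalk u (rest \<beta>) u" if "\<beta> \<in> B" for \<beta>
      using that by (auto simp: B_def rest_def)
    let ?q = "ghost_path u \<alpha> :: ('k, 'v, 'e) free_alg"
    have star: "?q * real_path u \<beta> \<approx> (if \<beta> \<in> B then real_path u (rest \<beta>) else 0)" if \<beta>: "\<beta> \<in> A" for \<beta>
    proof (cases "\<beta> \<in> B")
      case True
      then show ?thesis
        using ghost_path_real_path_append[OF w rest(2)[OF True]] rest(1)[OF True] by simp
    next
      case False
      obtain w' where w': "awalk w' \<beta> u" using walks \<beta> by blast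
      show ?thesis
      proof (rule ghost_path_real_path_cases[OF w w'])
        fix \<gamma> assume *: "w' = w" "\<beta> = \<alpha> @ \<gamma>"
        then have "awalk u \<gamma> u" using awalk_append_cancel[OF w, of \<gamma> u] w' by simp
        then show ?thesis using False * \<beta> by (simp add: B_def)
      next
        fix \<gamma> assume "\<alpha> = \<beta> @ \<gamma>" "\<gamma> \<noteq> []"
        then have "length \<beta> < length \<alpha>" by simp
        then show ?thesis using \<alpha>(2)[OF \<beta>] by simp
      next
        assume "?q * real_path u \<beta> \<approx> 0"
        then show ?thesis using False by simp
      qed
    qed
    have qy: "?q * y \<approx> (\<Sum>\<beta>\<in>B. scal (\<kappa> \<beta>) * real_path u (rest \<beta>))"
    proof -
      have "?q * y \<approx> (\<Sum>\<beta>\<in>A. scal (\<kappa> \<beta>) * (?q * real_path u \<beta>))"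
        using cong_left[OF y, of ?q] by (simp add: sum_distrib_left scal_commute_left)
      also have "\<dots> \<approx> (\<Sum>\<beta>\<in>A. scal (\<kappa> \<beta>) * (if \<beta> \<in> B then real_path u (rest \<beta>) else 0))"
        by (rule cong_sum[OF cong_left[OF star]])
      also have "\<dots> = (\<Sum>\<beta>\<in>B. scal (\<kappa> \<beta>) * real_path u (rest \<beta>))"
        using B(1) psubset.hyps(1) by (intro sum.mono_neutral_cong_right) auto
      finally show ?thesis .
    qed
    have "\<exists>q. scal (\<kappa> \<beta>) * real_path u (rest \<beta>) \<approx> ev q" if \<beta>: "\<beta> \<in> B" for \<beta>
    proof -
      obtain m where "real_path u (rest \<beta>) \<approx> ev (monom 1 m)"
        using closed_walk_ev[OF rest(2)[OF \<beta>]] by blast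
      then have "scal (\<kappa> \<beta>) * real_path u (rest \<beta>) \<approx> ev (smult (\<kappa> \<beta>) (monom 1 m))"
        unfolding ev_smult by (rule cong_left)
      then show ?thesis by blast
    qed
    then have "\<exists>q. (\<Sum>\<beta>\<in>B. scal (\<kappa> \<beta>) * real_path u (rest \<beta>)) \<approx> ev q"
      by (rule ev_sum)
    then obtain q where q: "(\<Sum>\<beta>\<in>B. scal (\<kappa> \<beta>) * real_path u (rest \<beta>)) \<approx> ev q" by blast
    have qI: "?q * y \<in> I" by (rule ring_ideal_left[OF ideal_I yI])
    then have "ev q \<in> I" using cong_I[OF cong_trans[OF qy q]] by blast
    then obtain r where "q = r * f" using dvd[of q] by (metis dvdE mult.commute)
    then have qyf: "?q * y \<approx> ev r * ev f"
      using cong_trans[OF cong_trans[OF qy q]] ev_mult[of r f] by simp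
    \<comment> \<open>Subtracting this removes the paths in \<open>B\<close> and no others. As
      \<alpha> belongs to \<open>B\<close>, the set of paths shrinks strictly.\<close>
    define y1 where "y1 = real_path u \<alpha> * (?q * y)"
    have y1: "y1 \<approx> path_sum u \<kappa> B"
    proof -
      have "y1 \<approx> (\<Sum>\<beta>\<in>B. scal (\<kappa> \<beta>) * (real_path u \<alpha> * real_path u (rest \<beta>)))"
        using cong_left[OF qy, of "real_path u \<alpha>"]
        by (simp add: y1_def sum_distrib_left scal_commute_left)
      also have "\<dots> \<approx> path_sum u \<kappa> B"
      proof (rule cong_sum[OF cong_left])
        fix \<beta> assume "\<beta> \<in> B"
        then show "real_path u \<alpha> * real_path u (rest \<beta>) \<approx> real_path u \<beta>"
          using real_path_append[of u "rest \<beta>" u \<alpha>] rest[of \<beta>] by simp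
      qed
      finally show ?thesis .
    qed
    have y1I: "y1 \<in> I" unfolding y1_def by (rule ring_ideal_left[OF ideal_I qI])
    have "y - y1 \<approx> path_sum u \<kappa> (A - B)"
      using cong_diff[OF y y1] sum_diff[OF psubset.hyps(1) B(1), of "\<lambda>\<alpha>. scal (\<kappa> \<alpha>) * real_path u \<alpha>"]
      by simp
    moreover have "y - y1 \<in> I" by (rule ring_ideal_diff[OF ideal_I yI y1I])
    moreover have "A - B \<subset> A" using B by blast
    moreover have "\<forall>\<alpha>\<in>A - B. \<exists>w. awalk w \<alpha> u" using walks by blast
    ultimately obtain a where a: "y - y1 \<approx> a * ev f" using psubset.IH by blast
    have "y1 \<approx> real_path u \<alpha> * ev r * ev f"
      unfolding y1_def using cong_left[OF qyf, of "real_path u \<alpha>"] by (simp only: mult.assoc)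
    from cong_add[OF this a] have "y \<approx> (real_path u \<alpha> * ev r + a) * ev f"
      by (simp add: distrib_right)
    then show ?thesis by blast
  qed
qed

text \<open>Once c^N is at least as long as \<beta>, either \<beta> is a prefix of it and \<beta>^*
  is absorbed, or the product is 0. All larger exponents are included so that a sum can use the
  maximum of two bounds.\<close>

lemma large_power_real:
  assumes "Poly_Mapping.lookup z 0 = 0"
  shows "\<exists>N. \<forall>N'\<ge>N. real_elem u (z * (cyc ^ N' * vtx u))"
  using assms
proof (induction z rule: monomial_induct)
  case zero
  then show ?case by (simp add: real_elem_zero)
next
  case (add p q)
  then obtain N M where "\<forall>N'\<ge>N. real_elem u (p * (cyc ^ N' * vtx u))"
    "\<forall>N'\<ge>M. real_elem u (q * (cyc ^ N' * vtx u))" by blast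
  then have "\<forall>N'\<ge>max N M. real_elem u ((p + q) * (cyc ^ N' * vtx u))"
    by (simp only: distrib_right) (simp add: real_elem_add)
  then show ?case by blast
next
  case (cong p q)
  then show ?case using real_elem_cong[OF cong_right[OF cong(1)]] by blast
next
  case (monomial k w \<alpha> z w' \<beta>)
  have "real_elem u (scal k * monomial \<alpha> z \<beta> * (cyc ^ N * vtx u))" if N: "length \<beta> \<le> N" for N
  proof -
    let ?c = "concat (replicate N c)"
    have len: "length \<beta> \<le> length ?c"
    proof -
      have "N \<le> N * length c" using c_ne by (cases c) auto
      from order_trans[OF N this] show ?thesis by (simp add: length_concat sum_list_replicate)
    qed
    have eq: "scal k * monomial \<alpha> z \<beta> * (cyc ^ N * vtx u) \<approx> scal k * (edges \<alpha> * (ghost_path z \<beta> * real_path u ?c))"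
      using cong_left[OF cong_sym[OF replicate_real_path[of N]], of "scal k * monomial \<alpha> z \<beta>"]
      by (simp only: mult.assoc)
    show ?thesis
    proof (rule ghost_path_real_path_cases[OF monomial(2) replicate_walk[of N]])
      fix \<gamma> assume *: "u = w'" "?c = \<beta> @ \<gamma>"
      then have \<gamma>: "awalk z \<gamma> u"
        using awalk_append_cancel[OF monomial(2), of \<gamma> u] replicate_walk[of N] by simp
      have "ghost_path z \<beta> * real_path u ?c \<approx> real_path u \<gamma>"
        unfolding *(2) by (rule ghost_path_real_path_append[OF monomial(2) \<gamma>])
      from cong_left[OF cong_left[OF this], of "scal k" "edges \<alpha>"]
      have "scal k * (edges \<alpha> * (ghost_path z \<beta> * real_path u ?c)) \<approx> scal k * real_path u (\<alpha> @ \<gamma>)"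
        by (simp only: mult.assoc edges_simps)
      moreover have "real_elem u (scal k * real_path u (\<alpha> @ \<gamma>))"
        by (rule real_elem_path[OF awalk_appendI[OF monomial(1) \<gamma>]])
      ultimately show ?thesis using real_elem_cong[OF cong_trans[OF eq]] by blast
    next
      fix \<gamma> assume "\<beta> = ?c @ \<gamma>" "\<gamma> \<noteq> []"
      then have "length ?c < length \<beta>" by (metis length_append length_greater_0_conv less_add_same_cancel1)
      then show ?thesis using len by simp
    next
      assume "ghost_path z \<beta> * real_path u ?c \<approx> 0"
      then have "scal k * (edges \<alpha> * (ghost_path z \<beta> * real_path u ?c)) \<approx> 0"
        by (rule cong_zeroI1[OF cong_zeroI1])
      then show ?thesis using cong_trans[OF eq] real_elem_cong[OF _ real_elem_zero] by blast
    qed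
  qed
  then show ?case by blast
qed

text \<open>Ghost paths are cleared by c^N, the case of paths is applied, and the inverse power is
  multiplied back. It can be moved past f(c), which keeps f(c) rightmost.\<close>

lemma ideal_vtx_multiple:
  assumes dvd: "\<And>q. ev q \<in> I \<Longrightarrow> f dvd q" and z: "z \<in> I"
  shows "\<exists>a. z * vtx u \<approx> a * ev f"
proof -
  obtain N where N: "real_elem u (z * (cyc ^ N * vtx u))"
    using large_power_real[OF I_augmentation[OF z]] by blast
  have "z * (cyc ^ N * vtx u) \<in> I" by (rule ring_ideal_right[OF ideal_I z])
  then obtain a where a: "z * (cyc ^ N * vtx u) \<approx> a * ev f"
    using N real_in_ideal[OF dvd] unfolding real_elem_def by blast
  have "z * vtx u \<approx> z * (cyc ^ N * vtx u * gcyc ^ N)"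
    by (rule cong_left[OF cong_sym[OF cyc_gcyc_power]])
  also have "\<dots> = z * (cyc ^ N * vtx u) * gcyc ^ N" by (simp add: mult.assoc)
  also have "\<dots> \<approx> a * ev f * gcyc ^ N" by (rule cong_right[OF a])
  also have "\<dots> = a * (ev f * gcyc ^ N)" by (simp add: mult.assoc)
  also have "\<dots> \<approx> a * (gcyc ^ N * ev f)" by (rule cong_left[OF ev_gcyc_power])
  finally have "z * vtx u \<approx> a * gcyc ^ N * ev f" by (simp add: mult.assoc)
  then show ?thesis by blast
qed

text \<open>After multiplication by a power of X the left factor a also becomes a polynomial in the
  cycle, and injectivity of \<open>ev\<close> turns the congruence into an equation of
  polynomials.\<close>

lemma ev_multiple_dvd:
  assumes "coeff f 0 \<noteq> 0" and a: "ev p \<approx> a * ev (f ^ n)"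
  shows "f ^ n dvd p"
proof -
  \<comment> \<open>The factor a is an arbitrary element of the unital algebra; multiplying by u
    removes its constant term.\<close>
  have "Poly_Mapping.lookup (vtx u * a) 0 = 0"
  proof -
    have "Poly_Mapping.keys (vtx u * a) \<subseteq> {x + y | x y. x \<in> {Word [Vertex u]} \<and> y \<in> Poly_Mapping.keys a}"
      using keys_mult[of "vtx u" a] by (simp add: gen_def)
    then have "0 \<notin> Poly_Mapping.keys (vtx u * a)"
      by (auto simp: zero_word_def plus_word_def)
    then show ?thesis by (simp add: in_keys_iff)
  qed
  then obtain N where "real_elem u (vtx u * a * (cyc ^ N * vtx u))"
    using large_power_real by blast
  then obtain q where q: "vtx u * (vtx u * a * (cyc ^ N * vtx u)) \<approx> ev q"
    using real_elem_ev by blast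
  let ?x = "cyc ^ N * vtx u"
  have x: "?x = ev (monom 1 N)" by (simp add: ev_monom)
  have "ev (p * monom 1 N) \<approx> ev p * ?x"
    unfolding x by (rule ev_mult)
  \<comment> \<open>The inner u removes the constant term of a, the outer one selects the paths that
    start at u.\<close>
  also have "\<dots> \<approx> vtx u * (vtx u * ev p) * ?x"
    by (rule cong_right[OF cong_sym[OF cong_trans[OF cong_left[OF vtx_ev] vtx_ev]]])
  also have "\<dots> \<approx> vtx u * (vtx u * (a * ev (f ^ n))) * ?x"
    by (rule cong_mult3[OF cong_left[OF a]])
  also have "\<dots> = vtx u * (vtx u * a) * (ev (f ^ n) * ev (monom 1 N))"
    by (simp add: x mult.assoc)
  also have "\<dots> \<approx> vtx u * (vtx u * a) * ev (monom 1 N * f ^ n)"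
    using cong_left[OF cong_sym[OF ev_mult[of "f ^ n" "monom 1 N"]]] by (simp only: mult.commute[of "monom 1 N"])
  also have "\<dots> \<approx> vtx u * (vtx u * a) * (ev (monom 1 N) * ev (f ^ n))"
    by (rule cong_left[OF ev_mult])
  also have "\<dots> = vtx u * (vtx u * a * ?x) * ev (f ^ n)"
    by (simp add: x mult.assoc)
  also have "\<dots> \<approx> ev q * ev (f ^ n)" by (rule cong_right[OF q])
  also have "\<dots> \<approx> ev (q * f ^ n)" by (rule cong_sym[OF ev_mult])
  finally have "ev (p * monom 1 N - q * f ^ n) \<in> J"
    by (simp add: cong_def ev_diff)
  then have "p * monom 1 N = q * f ^ n"
    using ev_J_imp_zero by fastforce
  then have "f ^ n dvd monom 1 N * p" by (metis dvd_triv_right mult.commute)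
  moreover have "coeff (f ^ n) 0 \<noteq> 0" using assms(1) by (simp add: coeff_0_power)
  ultimately show ?thesis using dvd_monom_mult_cancel by blast
qed

end

section \<open>The intersection of the powers\<close>

context leavitt_ideal_pair
begin

text \<open>\<open>T n\<close> plays the role of the power with exponent n + 1. Of the powers it is
  used only that they are ideals and that each element of the next one is a sum of products, up to
  congruence.\<close>

theorem intersection_subset_J:
  fixes T :: "nat \<Rightarrow> ('k, 'v, 'e) free_alg set"
  assumes T0: "T 0 = I" and ideals: "\<And>n. ring_ideal (T n)"
    and step: "\<And>n z. z \<in> T (Suc n) \<Longrightarrow>
      \<exists>l. set l \<subseteq> T n \<times> I \<and> z \<approx> (\<Sum>(x, y)\<leftarrow>l. x * y)"
  shows "(\<Inter>n. T n) \<subseteq> J"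
proof (rule ccontr)
  assume not: "\<not> (\<Inter>n. T n) \<subseteq> J"
  have ideal: "ring_ideal (\<Inter>n. T n)"
    using ideals unfolding ring_ideal_def by auto
  have sub: "(\<Inter>n. T n) \<subseteq> I" using T0 by blast
  obtain u g L where u: "u \<notin> H" and g: "g \<in> (\<Inter>n. T n)" and sp: "special u g L"
    and exitless: "\<forall>(k, \<gamma>)\<in>set L. \<forall>e\<in>set \<gamma>. exitless e"
    using ex_special_exitless[OF ideal sub not] by (elim exE conjE)
  have gI: "g \<in> I" using g sub by blast
  have u_vert: "u \<in> verts E" using sp by (simp add: special_def)
  \<comment> \<open>With no closed walk at all, u itself would be in \<open>I\<close>.\<close>
  have "L \<noteq> []"
  proof
    assume "L = []"
    then obtain k where k: "k \<noteq> 0" "g \<approx> scal k * vtx u"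
      using sp by (auto simp: special_def)
    then have "scal k * vtx u \<in> I" using cong_I gI by blast
    then show False using scal_vtx_notin_I[of u k] u u_vert k(1) by blast
  qed
  then obtain k \<gamma> where L: "(k, \<gamma>) \<in> set L" by (cases L) auto
  then have \<gamma>: "\<gamma> \<noteq> []" "awalk u \<gamma> u" "\<forall>e\<in>set \<gamma>. exitless e"
    using sp exitless unfolding special_def by blast+
  define W where "W = {t. t \<noteq> [] \<and> awalk u t u}"
  define c where "c = arg_min length (\<lambda>t. t \<in> W)"
  have c: "c \<in> W" "\<And>t. t \<in> W \<Longrightarrow> length c \<le> length t"
    using arg_min_nat_lemma[of "\<lambda>t. t \<in> W" \<gamma> length] \<gamma> by (auto simp: c_def W_def)
  have "\<gamma> \<in> W" using \<gamma> by (simp add: W_def)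
  have c_walk: "awalk u c u" "c \<noteq> []" using c(1) by (simp_all add: W_def)
  \<comment> \<open>The shortest closed walk c need not occur in \<open>L\<close>, but as a prefix
    of \<gamma> it inherits the absence of exits.\<close>
  have "c = take (length c) \<gamma>"
    by (rule exitless_walks_agree[OF \<gamma>(2,3) c_walk(1) u c(2)[OF \<open>\<gamma> \<in> W\<close>]])
  then have "set c \<subseteq> set \<gamma>" by (metis set_take_subset)
  then have c_exitless: "\<forall>e\<in>set c. exitless e" using \<gamma>(3) by blast
  interpret exitless_cycle E J I H u c
    using u c_walk c_exitless c(2) by unfold_locales (auto simp: W_def)
  obtain p where p: "coeff p 0 \<noteq> 0" "g \<approx> ev p" by (rule special_ev[OF sp])
  have "ev p \<in> I" using cong_I[OF p(2)] gI by blast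
  moreover have p0: "p \<noteq> 0" using p(1) by auto
  ultimately obtain f where f: "ev f \<in> I" "coeff f 0 \<noteq> 0" "degree f \<noteq> 0"
    and f_dvd: "\<And>q. ev q \<in> I \<Longrightarrow> f dvd q"
    by (rule ex_generator) blast
  have claim: "\<exists>a. z * vtx u \<approx> a * ev (f ^ Suc n)" if "z \<in> T n" for n z
    using that
  proof (induction n arbitrary: z)
    case 0
    then have "z \<in> I" using T0 by simp
    from ideal_vtx_multiple[OF f_dvd this] show ?case by simp
  next
    case (Suc n)
    obtain l where l: "set l \<subseteq> T n \<times> I" "z \<approx> (\<Sum>(x, y)\<leftarrow>l. x * y)"
      using step[OF Suc.prems] by blast
    have prod: "\<exists>a. x * y * vtx u \<approx> a * ev (f ^ Suc (Suc n))" if xy: "x \<in> T n" "y \<in> I" for x y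
    proof -
      obtain a where a: "y * vtx u \<approx> a * ev f" using ideal_vtx_multiple[OF f_dvd xy(2)] by blast
      \<comment> \<open>The factor a left over from y is absorbed into \<open>T n\<close>, so the
        induction hypothesis applies to x a; the vertex it requires is supplied by u f(c) =
        f(c).\<close>
      have "x * a \<in> T n" by (rule ring_ideal_right[OF ideals xy(1)])
      then obtain b where b: "x * a * vtx u \<approx> b * ev (f ^ Suc n)" using Suc.IH by blast
      have "x * y * vtx u = x * (y * vtx u)" by (simp add: mult.assoc)
      also have "\<dots> \<approx> x * (a * ev f)" by (rule cong_left[OF a])
      also have "\<dots> = x * a * ev f" by (simp add: mult.assoc)
      also have "\<dots> \<approx> x * a * (vtx u * ev f)" by (rule cong_left[OF cong_sym[OF vtx_ev]])
      also have "\<dots> = x * a * vtx u * ev f" by (simp add: mult.assoc)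
      also have "\<dots> \<approx> b * ev (f ^ Suc n) * ev f" by (rule cong_right[OF b])
      also have "\<dots> = b * (ev (f ^ Suc n) * ev f)" by (simp add: mult.assoc)
      also have "\<dots> \<approx> b * ev (f ^ Suc n * f)" by (rule cong_left[OF cong_sym[OF ev_mult]])
      also have "\<dots> = b * ev (f ^ Suc (Suc n))" by (simp only: power_Suc2)
      finally show ?thesis by blast
    qed
    have "\<exists>a. (\<Sum>(x, y)\<leftarrow>l. x * y) * vtx u \<approx> a * ev (f ^ Suc (Suc n))"
      using l(1)
    proof (induction l)
      case Nil
      have "(\<Sum>(x, y)\<leftarrow>[]. x * y) * vtx u \<approx> 0 * ev (f ^ Suc (Suc n))" by simp
      then show ?case by blast
    next
      case (Cons xy l)
      obtain x y where xy: "xy = (x, y)" by force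
      have "\<exists>a. x * y * vtx u \<approx> a * ev (f ^ Suc (Suc n))"
        using Cons.prems xy by (intro prod) auto
      then obtain a where a: "x * y * vtx u \<approx> a * ev (f ^ Suc (Suc n))" by blast
      have "\<exists>b. (\<Sum>(x, y)\<leftarrow>l. x * y) * vtx u \<approx> b * ev (f ^ Suc (Suc n))"
        using Cons.prems by (intro Cons.IH) simp
      then obtain b where b: "(\<Sum>(x, y)\<leftarrow>l. x * y) * vtx u \<approx> b * ev (f ^ Suc (Suc n))" by blast
      have "(\<Sum>(x, y)\<leftarrow>xy # l. x * y) * vtx u = x * y * vtx u + (\<Sum>(x, y)\<leftarrow>l. x * y) * vtx u"
        by (simp add: xy distrib_right)
      also have "\<dots> \<approx> a * ev (f ^ Suc (Suc n)) + b * ev (f ^ Suc (Suc n))"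
        by (rule cong_add[OF a b])
      also have "\<dots> = (a + b) * ev (f ^ Suc (Suc n))" by (rule distrib_right[symmetric])
      finally show ?case by blast
    qed
    then obtain a where "(\<Sum>(x, y)\<leftarrow>l. x * y) * vtx u \<approx> a * ev (f ^ Suc (Suc n))" by blast
    from cong_trans[OF cong_right[OF l(2)] this] show ?case by blast
  qed
  have dvd: "f ^ Suc n dvd p" for n
  proof -
    have "g \<in> T n" using g by blast
    from claim[OF this] obtain a where a: "g * vtx u \<approx> a * ev (f ^ Suc n)" by blast
    have "ev p \<approx> a * ev (f ^ Suc n)"
      by (rule cong_trans[OF cong_sym[OF cong_trans[OF cong_right[OF p(2)] ev_vtx]] a])
    then show ?thesis by (rule ev_multiple_dvd[OF f(2)])
  qed
  \<comment> \<open>An exponent one above the degree of p suffices, since f is not constant.\<close>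
  have "degree (f ^ Suc (degree p)) \<le> degree p"
    by (rule dvd_imp_degree_le[OF dvd p0])
  moreover have "degree (f ^ Suc (degree p)) = Suc (degree p) * degree f"
    by (rule degree_power_eq) (use f(2) in auto)
  moreover have "Suc (degree p) * 1 \<le> Suc (degree p) * degree f"
    using f(3) by (intro mult_le_mono2) simp
  ultimately show False by simp
qed

end

section \<open>From the unital algebra on all letters to the algebra of the graph\<close>

definition graph_word :: "('v, 'e) pre_digraph \<Rightarrow> ('v, 'e) word \<Rightarrow> bool" where
  "graph_word E w \<longleftrightarrow> set (letters w) \<subseteq> graph_letters E"

abbreviation prune :: "('v, 'e) pre_digraph \<Rightarrow> ('k::zero, 'v, 'e) free_alg \<Rightarrow> ('k, 'v, 'e) free_alg" where
  "prune E \<equiv> restrict_keys (graph_word E)"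

lemma graph_word_add: "graph_word E (u + w) \<longleftrightarrow> graph_word E u \<and> graph_word E w"
  by (auto simp: graph_word_def plus_word_def)

lemma graph_word_zero [simp]: "graph_word E 0"
  by (simp add: graph_word_def zero_word_def)

lemma prune_mult: "prune E (p * q) = prune E p * prune E (q :: ('k::field, 'v, 'e) free_alg)"
  by (rule restrict_keys_mult) (rule graph_word_add)

lemma letters_eq_Nil: "letters w = [] \<longleftrightarrow> w = 0"
  by (cases w) (simp add: zero_word_def)

lemma prune_eq_iff: "prune E p = p \<longleftrightarrow> (\<forall>w\<in>Poly_Mapping.keys p. graph_word E w)"
proof
  assume "prune E p = p"
  then show "\<forall>w\<in>Poly_Mapping.keys p. graph_word E w"
    using keys_restrict_keys[of "graph_word E" p] by auto
next
  assume "\<forall>w\<in>Poly_Mapping.keys p. graph_word E w"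
  then show "prune E p = p" by (simp add: restrict_keys_id)
qed

lemma prune_idem [simp]: "prune E (prune E p) = prune E p"
  by (simp add: prune_eq_iff keys_restrict_keys)

lemma prune_scal: "prune E (scal k) = scal k"
  by (simp add: scal_def restrict_keys_single)

lemma prune_scal_mult: "prune E (scal k * p) = scal k * prune E p"
  by (simp add: prune_mult prune_scal)

text \<open>Two equations that the algebra operations visibly preserve replace the condition on
  words.\<close>

lemma carrier_free_lpa:
  "p \<in> carrier (free_lpa E) \<longleftrightarrow> Poly_Mapping.lookup p 0 = 0 \<and> prune E p = p"
  by (auto simp: free_lpa_def prune_eq_iff letters_eq_Nil graph_word_def in_keys_iff)

lemma free_lpa_simps [simp]:
  "x \<otimes>\<^bsub>free_lpa E\<^esub> y = x * y" "x \<oplus>\<^bsub>free_lpa E\<^esub> y = x + y" "\<zero>\<^bsub>free_lpa E\<^esub> = 0"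
  "c \<odot>\<^bsub>free_lpa E\<^esub> x = scal c * x"
  by (simp_all add: free_lpa_def scal_def)

lemma lookup_mult_zero:
  fixes p q :: "('k::field, 'v, 'e) free_alg"
  assumes "Poly_Mapping.lookup p 0 = 0 \<or> Poly_Mapping.lookup q 0 = 0"
  shows "Poly_Mapping.lookup (p * q) 0 = 0"
proof -
  have "0 \<notin> Poly_Mapping.keys (p * q)"
  proof
    assume "0 \<in> Poly_Mapping.keys (p * q)"
    then obtain a b where "a \<in> Poly_Mapping.keys p" "b \<in> Poly_Mapping.keys q" "0 = a + b"
      using keys_mult[of p q] by blast
    moreover have "letters a = [] \<and> letters b = []"
      using arg_cong[OF \<open>0 = a + b\<close>, of letters] by (simp add: zero_word_def plus_word_def)
    ultimately show False unfolding letters_eq_Nil using assms by (auto simp: in_keys_iff)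
  qed
  then show ?thesis by (simp add: in_keys_iff)
qed

text \<open>\<open>K\<close> fixes the coefficient field, which \<open>E\<close> does not
  mention.\<close>

locale leavitt = wf_digraph E for E :: "('v, 'e) pre_digraph" +
  fixes K :: "'k::field itself"
begin

abbreviation carr :: "('k, 'v, 'e) free_alg set" where
  "carr \<equiv> carrier (free_lpa E)"

abbreviation rel :: "('k, 'v, 'e) free_alg set" where
  "rel \<equiv> lpa_relation_ideal E"

abbreviation lpa :: "('k, ('k, 'v, 'e) free_alg set) module" ("\<L>") where
  "\<L> \<equiv> leavitt_path_algebra E"

abbreviation cls :: "('k, 'v, 'e) free_alg \<Rightarrow> ('k, 'v, 'e) free_alg set" where
  "cls \<equiv> lpa_class E"

lemma carr_zero: "0 \<in> carr"
  by (simp add: carrier_free_lpa)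

lemma carr_add: "p \<in> carr \<Longrightarrow> q \<in> carr \<Longrightarrow> p + q \<in> carr"
  by (simp add: carrier_free_lpa lookup_add restrict_keys_add)

lemma carr_uminus: "p \<in> carr \<Longrightarrow> - p \<in> carr"
  by (simp add: carrier_free_lpa restrict_keys_uminus)

lemma carr_diff: "p \<in> carr \<Longrightarrow> q \<in> carr \<Longrightarrow> p - q \<in> carr"
  by (simp add: carrier_free_lpa lookup_minus restrict_keys_diff)

lemma carr_mult: "p \<in> carr \<Longrightarrow> q \<in> carr \<Longrightarrow> p * q \<in> carr"
  by (simp add: carrier_free_lpa prune_mult lookup_mult_zero)

lemma carr_scal: "p \<in> carr \<Longrightarrow> scal k * p \<in> carr"
  by (simp add: carrier_free_lpa prune_scal_mult lookup_mult_zero)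

lemma carr_sum: "(\<And>i. i \<in> S \<Longrightarrow> f i \<in> carr) \<Longrightarrow> sum f S \<in> carr"
  by (induction S rule: infinite_finite_induct) (auto intro: carr_zero carr_add)

lemma carr_hom_part: "p \<in> carr \<Longrightarrow> hom_part n p \<in> carr"
  by (simp add: carrier_free_lpa lookup_restrict_keys restrict_keys_commute[of "graph_word E"])

lemma carr_gen: "x \<in> graph_letters E \<Longrightarrow> gen x \<in> carr"
  by (simp add: carrier_free_lpa gen_def restrict_keys_single graph_word_def lookup_single zero_word_def)

lemma carr_letters:
  "v \<in> verts E \<Longrightarrow> vtx v \<in> carr" "e \<in> arcs E \<Longrightarrow> edg e \<in> carr"
  "e \<in> arcs E \<Longrightarrow> gho e \<in> carr"
  by (auto intro: carr_gen simp: graph_letters_def)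

lemma abelian_group_free: "abelian_group (free_lpa E :: ('k, ('k, 'v, 'e) free_alg) module)"
proof (rule abelian_groupI, unfold free_lpa_simps)
  fix x :: "('k, 'v, 'e) free_alg"
  assume "x \<in> carr"
  then show "\<exists>y\<in>carr. y + x = 0"
    by (intro bexI[of _ "- x"]) (simp_all add: carr_uminus)
qed (simp_all add: carr_zero carr_add ac_simps)

lemma a_inv_free: "p \<in> carr \<Longrightarrow> \<ominus>\<^bsub>free_lpa E\<^esub> p = - p"
  using abelian_group.minus_equality[OF abelian_group_free, of "- p" p]
  by (simp add: carr_uminus)

text \<open>Negation is listed separately because the carrier has no -1 to multiply by. Closure
  under scalars is left out, as in \<open>two_sided_ideal\<close>, and is derived for ideals
  containing the relations.\<close>

definition free_ideal :: "('k, 'v, 'e) free_alg set \<Rightarrow> bool" where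
  "free_ideal A \<longleftrightarrow> A \<subseteq> carr \<and> 0 \<in> A \<and> (\<forall>a\<in>A. \<forall>b\<in>A. a + b \<in> A) \<and> (\<forall>a\<in>A. - a \<in> A) \<and>
     (\<forall>a\<in>A. \<forall>x\<in>carr. x * a \<in> A \<and> a * x \<in> A)"

lemma two_sided_ideal_free: "two_sided_ideal (free_lpa E) A \<longleftrightarrow> free_ideal A"
proof -
  have inv: "inv\<^bsub>add_monoid (free_lpa E)\<^esub> p = - p" if "p \<in> carr" for p
    using a_inv_free[OF that] by (simp add: a_inv_def)
  have "subgroup A (add_monoid (free_lpa E)) \<longleftrightarrow>
      A \<subseteq> carr \<and> (\<forall>a\<in>A. \<forall>b\<in>A. a + b \<in> A) \<and> 0 \<in> A \<and> (\<forall>a\<in>A. - a \<in> A)"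
  proof
    assume sub: "subgroup A (add_monoid (free_lpa E))"
    then have A: "A \<subseteq> carr" using subgroup.subset by fastforce
    have "- a \<in> A" if "a \<in> A" for a
      using subgroup.m_inv_closed[OF sub that] inv[of a] A that by auto
    then show "A \<subseteq> carr \<and> (\<forall>a\<in>A. \<forall>b\<in>A. a + b \<in> A) \<and> 0 \<in> A \<and> (\<forall>a\<in>A. - a \<in> A)"
      using A subgroup.m_closed[OF sub] subgroup.one_closed[OF sub] by simp
  next
    assume A: "A \<subseteq> carr \<and> (\<forall>a\<in>A. \<forall>b\<in>A. a + b \<in> A) \<and> 0 \<in> A \<and> (\<forall>a\<in>A. - a \<in> A)"
    then show "subgroup A (add_monoid (free_lpa E))"
      using inv by (intro subgroup.intro) auto
  qed
  then show ?thesis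
    unfolding two_sided_ideal_def additive_subgroup_def free_ideal_def free_lpa_simps by blast
qed

lemma
  assumes "free_ideal A"
  shows free_ideal_carrier: "a \<in> A \<Longrightarrow> a \<in> carr"
    and free_ideal_zero: "0 \<in> A"
    and free_ideal_add: "a \<in> A \<Longrightarrow> b \<in> A \<Longrightarrow> a + b \<in> A"
    and free_ideal_uminus: "a \<in> A \<Longrightarrow> - a \<in> A"
    and free_ideal_left: "a \<in> A \<Longrightarrow> x \<in> carr \<Longrightarrow> x * a \<in> A"
    and free_ideal_right: "a \<in> A \<Longrightarrow> x \<in> carr \<Longrightarrow> a * x \<in> A"
  using assms unfolding free_ideal_def by blast+

lemma free_ideal_diff: "free_ideal A \<Longrightarrow> a \<in> A \<Longrightarrow> b \<in> A \<Longrightarrow> a - b \<in> A"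
  using free_ideal_add[of A a "- b"] free_ideal_uminus[of A b] by simp

lemma free_ideal_sum: "free_ideal A \<Longrightarrow> (\<And>i. i \<in> S \<Longrightarrow> f i \<in> A) \<Longrightarrow> sum f S \<in> A"
  by (induction S rule: infinite_finite_induct) (auto intro: free_ideal_zero free_ideal_add)

lemma free_ideal_cong: "free_ideal A \<Longrightarrow> a - b \<in> A \<Longrightarrow> a \<in> A \<longleftrightarrow> b \<in> A"
  using free_ideal_add[of A "a - b" b] free_ideal_diff[of A a "a - b"] by auto

lemma free_ideal_carr: "free_ideal carr"
  by (simp add: free_ideal_def carr_zero carr_add carr_uminus carr_mult)


section \<open>The relation ideal\<close>

lemma relator_carrier: "r \<in> lpa_relators E \<Longrightarrow> r \<in> carr"
  unfolding lpa_relators_def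
  by (auto intro!: carr_diff carr_mult carr_sum carr_letters
      simp: regular_vertex_def)

lemma relation_ideal_least:
  assumes "free_ideal A" and "\<And>c r. r \<in> lpa_relators E \<Longrightarrow> scal c * r \<in> A"
  shows "rel \<subseteq> A"
  using assms unfolding lpa_relation_ideal_def ideal_generated_def two_sided_ideal_free by auto

lemma scal_relator_rel: "r \<in> lpa_relators E \<Longrightarrow> scal c * r \<in> rel"
  unfolding lpa_relation_ideal_def ideal_generated_def two_sided_ideal_free by auto

lemma free_ideal_rel: "free_ideal rel"
proof -
  have rel: "rel = \<Inter> {A. free_ideal A \<and> {scal c * p | c p. p \<in> lpa_relators E} \<subseteq> A}"
    by (simp add: lpa_relation_ideal_def ideal_generated_def two_sided_ideal_free)
  have "rel \<subseteq> carr"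
    by (rule relation_ideal_least[OF free_ideal_carr]) (intro carr_scal relator_carrier)
  then show ?thesis
    unfolding free_ideal_def
  proof (intro conjI ballI)
    show "0 \<in> rel" unfolding rel by (auto intro: free_ideal_zero)
    show "a + b \<in> rel" if "a \<in> rel" "b \<in> rel" for a b
      using that unfolding rel by (auto intro: free_ideal_add)
    show "- a \<in> rel" if "a \<in> rel" for a
      using that unfolding rel by (auto intro: free_ideal_uminus)
    show "x * a \<in> rel" "a * x \<in> rel" if "a \<in> rel" "x \<in> carr" for a x
      using that unfolding rel by (auto intro: free_ideal_left free_ideal_right)
  qed
qed

text \<open>The elements of \<open>rel\<close> all of whose scalar multiples are in
  \<open>rel\<close> form an ideal containing the generators, because these include all scalar
  multiples of the relators.\<close>

lemma rel_scal:
  assumes "a \<in> rel"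
  shows "scal k * a \<in> rel"
proof -
  note R = free_ideal_rel
  let ?B = "{a \<in> rel. \<forall>k. scal k * a \<in> rel}"
  have "free_ideal ?B"
    unfolding free_ideal_def
  proof (intro conjI ballI)
    show "?B \<subseteq> carr"
      using free_ideal_carrier[OF R] by blast
    show "0 \<in> ?B"
      using free_ideal_zero[OF R] by simp
    show "a + b \<in> ?B"
      if "a \<in> ?B" "b \<in> ?B" for a b
      using that free_ideal_add[OF R] by (simp add: distrib_left)
    show "- a \<in> ?B" if "a \<in> ?B" for a
      using that free_ideal_uminus[OF R] by simp
    fix a x assume a: "a \<in> ?B" and x: "x \<in> carr"
    have "scal k * (x * a) \<in> rel" for k
      unfolding scal_commute_left[symmetric] using a x free_ideal_left[OF R] by blast
    then show "x * a \<in> ?B"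
      using a x free_ideal_left[OF R] by blast
    have "scal k * (a * x) \<in> rel" for k
      unfolding mult.assoc[symmetric] using a x free_ideal_right[OF R] by blast
    then show "a * x \<in> ?B"
      using a x free_ideal_right[OF R] by blast
  qed
  then have "rel \<subseteq> ?B"
    by (rule relation_ideal_least) (auto simp: scal_relator_rel mult.assoc[symmetric] scal_mult[symmetric])
  then show ?thesis using assms by blast
qed

definition homogeneous :: "int \<Rightarrow> ('k, 'v, 'e) free_alg \<Rightarrow> bool" where
  "homogeneous d p \<longleftrightarrow> (\<forall>w\<in>Poly_Mapping.keys p. word_degree w = d)"

lemma hom_part_homogeneous:
  "homogeneous d p \<Longrightarrow> hom_part n p = (if n = d then p else 0)"
  by (auto simp: homogeneous_def intro: restrict_keys_id restrict_keys_eq_zero)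

lemma homogeneous_hom_part: "homogeneous n (hom_part n p)"
  by (simp add: homogeneous_def keys_restrict_keys)

lemma homogeneous_mult: "homogeneous d p \<Longrightarrow> homogeneous d' q \<Longrightarrow> homogeneous (d + d') (p * q)"
  using keys_mult[of p q] by (force simp: homogeneous_def word_degree_add)

lemma homogeneous_diff: "homogeneous d p \<Longrightarrow> homogeneous d q \<Longrightarrow> homogeneous d (p - q)"
  using keys_diff[of p q] by (auto simp: homogeneous_def)

lemma homogeneous_sum: "(\<And>i. i \<in> S \<Longrightarrow> homogeneous d (f i)) \<Longrightarrow> homogeneous d (sum f S)"
proof (induction S rule: infinite_finite_induct)
  case (insert x S)
  then have "homogeneous d (f x)" "homogeneous d (sum f S)" by auto
  then show ?case
    using insert.hyps keys_add[of "f x" "sum f S"] by (auto simp: homogeneous_def)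
qed (simp_all add: homogeneous_def)

lemma homogeneous_gen: "homogeneous (letter_degree x) (gen x)"
  by (simp add: homogeneous_def gen_def word_degree_def)

lemma homogeneous_letters: "homogeneous 0 (vtx v)" "homogeneous 1 (edg e)" "homogeneous (-1) (gho e)"
  using homogeneous_gen[of "Vertex v"] homogeneous_gen[of "Edge e"] homogeneous_gen[of "Ghost e"] by simp_all

lemma homogeneous_products:
  "homogeneous 0 (vtx u * vtx v)" "homogeneous 1 (vtx v * edg e)" "homogeneous 1 (edg e * vtx v)"
  "homogeneous (-1) (vtx v * gho e)" "homogeneous (-1) (gho e * vtx v)"
  "homogeneous 0 (gho e * edg f)" "homogeneous 0 (edg e * gho f)"
  using homogeneous_mult[OF homogeneous_letters(1,1), of u v]
    homogeneous_mult[OF homogeneous_letters(1,2), of v e] homogeneous_mult[OF homogeneous_letters(2,1), of e v]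
    homogeneous_mult[OF homogeneous_letters(1,3), of v e] homogeneous_mult[OF homogeneous_letters(3,1), of e v]
    homogeneous_mult[OF homogeneous_letters(3,2), of e f] homogeneous_mult[OF homogeneous_letters(2,3), of e f]
  by simp_all

lemma homogeneous_relator:
  assumes "r \<in> lpa_relators E"
  shows "\<exists>d. homogeneous d r"
proof -
  have "homogeneous 0 r \<or> homogeneous 1 r \<or> homogeneous (-1) r"
    using assms unfolding lpa_relators_def
    by (elim UnE CollectE exE conjE)
       (simp_all add: homogeneous_diff homogeneous_products homogeneous_letters homogeneous_sum)
  then show ?thesis by blast
qed

text \<open>This is an ideal because multiplication by a word merely shifts degrees.\<close>

lemma free_ideal_homogeneous_core:
  assumes A: "free_ideal A"
  shows "free_ideal {a \<in> A. \<forall>n. hom_part n a \<in> A}"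
proof -
  have left: "hom_part n (x * a) \<in> A" and right: "hom_part n (a * x) \<in> A"
    if a: "a \<in> A" "\<forall>n. hom_part n a \<in> A" and x: "x \<in> carr" for a x n
  proof -
    let ?s = "\<lambda>w. Poly_Mapping.single w (Poly_Mapping.lookup x w)"
    have s: "?s w \<in> carr" if "w \<in> Poly_Mapping.keys x" for w
      using x that by (auto simp: free_lpa_def)
    have "x * a = (\<Sum>w\<in>Poly_Mapping.keys x. ?s w * a)"
      by (subst poly_mapping_sum_singles[of x]) (simp add: sum_distrib_right)
    then have "hom_part n (x * a) =
        (\<Sum>w\<in>Poly_Mapping.keys x. ?s w * hom_part (n - word_degree w) a)"
      by (simp add: restrict_keys_sum hom_part_single_mult)
    then show "hom_part n (x * a) \<in> A"
      using a(2) s by (auto intro!: free_ideal_sum[OF A] free_ideal_left[OF A])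
    have "a * x = (\<Sum>w\<in>Poly_Mapping.keys x. a * ?s w)"
      by (subst poly_mapping_sum_singles[of x]) (simp add: sum_distrib_left)
    then have "hom_part n (a * x) =
        (\<Sum>w\<in>Poly_Mapping.keys x. hom_part (n - word_degree w) a * ?s w)"
      by (simp add: restrict_keys_sum hom_part_mult_single)
    then show "hom_part n (a * x) \<in> A"
      using a(2) s by (auto intro!: free_ideal_sum[OF A] free_ideal_right[OF A])
  qed
  show ?thesis
    unfolding free_ideal_def
    using left right free_ideal_carrier[OF A] free_ideal_zero[OF A] free_ideal_add[OF A]
      free_ideal_uminus[OF A] free_ideal_left[OF A] free_ideal_right[OF A]
    by (auto simp: restrict_keys_add restrict_keys_uminus)
qed

text \<open>Each relator is homogeneous, so the elements of \<open>rel\<close> with all parts in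
  \<open>rel\<close> form an ideal that contains the generators.\<close>

lemma rel_homogeneous: "homogeneous_closed rel"
proof -
  have "rel \<subseteq> {a \<in> rel. \<forall>n. hom_part n a \<in> rel}"
  proof (rule relation_ideal_least[OF free_ideal_homogeneous_core[OF free_ideal_rel]])
    fix c :: 'k and r :: "('k, 'v, 'e) free_alg"
    assume r: "r \<in> lpa_relators E"
    obtain d where d: "homogeneous d r" using homogeneous_relator[OF r] by blast
    show "scal c * r \<in> {a \<in> rel. \<forall>n. hom_part n a \<in> rel}"
      using scal_relator_rel[OF r, of c] free_ideal_zero[OF free_ideal_rel]
      by (simp add: hom_part_scal_mult hom_part_homogeneous[OF d])
  qed
  then show ?thesis by (auto simp: homogeneous_closed_def)
qed


section \<open>Extending ideals to the unital free algebra on all letters\<close>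

text \<open>Extended ideals are ideals of a whole type, so congruences modulo them need no membership side
  conditions. They contain the letters that do not belong to the graph.\<close>

definition ext_ideal :: "('k, 'v, 'e) free_alg set \<Rightarrow> ('k, 'v, 'e) free_alg set" where
  "ext_ideal A = {p. prune E p \<in> A}"

lemma ext_ideal_iff: "p \<in> carr \<Longrightarrow> p \<in> ext_ideal A \<longleftrightarrow> p \<in> A"
  by (simp add: ext_ideal_def carrier_free_lpa)

text \<open>After pruning, a multiplier is a scalar plus an element of the carrier. The scalar part
  is the reason for demanding closure under scalars.\<close>

lemma ring_ideal_ext_ideal:
  assumes A: "free_ideal A" and scal: "\<And>k a. a \<in> A \<Longrightarrow> scal k * a \<in> A"
  shows "ring_ideal (ext_ideal A)"
proof -
  have split: "prune E x = scal (Poly_Mapping.lookup x 0) + (prune E x - scal (Poly_Mapping.lookup x 0))"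
    "prune E x - scal (Poly_Mapping.lookup x 0) \<in> carr" for x :: "('k, 'v, 'e) free_alg"
    by (simp_all add: carrier_free_lpa lookup_minus lookup_restrict_keys scal_def restrict_keys_diff
        restrict_keys_single restrict_keys_id keys_restrict_keys)
  show ?thesis
  proof (rule ring_idealI)
    show "0 \<in> ext_ideal A" by (simp add: ext_ideal_def free_ideal_zero[OF A])
    show "a + b \<in> ext_ideal A" if "a \<in> ext_ideal A" "b \<in> ext_ideal A" for a b
      using that by (simp add: ext_ideal_def restrict_keys_add free_ideal_add[OF A])
  next
    fix a x :: "('k, 'v, 'e) free_alg" assume "a \<in> ext_ideal A"
    then have a: "prune E a \<in> A" by (simp add: ext_ideal_def)
    let ?k = "scal (Poly_Mapping.lookup x 0)"
    have "prune E x * prune E a = ?k * prune E a + (prune E x - ?k) * prune E a"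
      by (simp add: left_diff_distrib)
    also have "\<dots> \<in> A"
      by (intro free_ideal_add[OF A] scal a free_ideal_left[OF A] split)
    finally show "x * a \<in> ext_ideal A" by (simp add: ext_ideal_def prune_mult)
    have "prune E a * prune E x = ?k * prune E a + prune E a * (prune E x - ?k)"
      by (simp add: right_diff_distrib scal_commute)
    also have "\<dots> \<in> A"
      by (intro free_ideal_add[OF A] scal a free_ideal_right[OF A] split)
    finally show "a * x \<in> ext_ideal A" by (simp add: ext_ideal_def prune_mult)
  qed
qed

lemma lpa_congruence_ext_ideal:
  assumes A: "free_ideal A" and "rel \<subseteq> A" and scal: "\<And>k a. a \<in> A \<Longrightarrow> scal k * a \<in> A"
  shows "lpa_congruence E (ext_ideal A)"
proof unfold_locales
  show "ring_ideal (ext_ideal A)" by (rule ring_ideal_ext_ideal[OF A scal])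
  show "lpa_relators E \<subseteq> ext_ideal A"
  proof
    fix r :: "('k, 'v, 'e) free_alg" assume r: "r \<in> lpa_relators E"
    then have "r \<in> A" using scal_relator_rel[OF r, of 1] assms(2) by auto
    then show "r \<in> ext_ideal A" using ext_ideal_iff[OF relator_carrier[OF r]] by simp
  qed
  show "gen x \<in> ext_ideal A" if "x \<notin> graph_letters E" for x
    using that free_ideal_zero[OF A] by (simp add: ext_ideal_def gen_def restrict_keys_single graph_word_def)
qed

lemma homogeneous_closed_ext_ideal: "homogeneous_closed A \<Longrightarrow> homogeneous_closed (ext_ideal A)"
  by (simp add: homogeneous_closed_def ext_ideal_def restrict_keys_commute[of "graph_word E"])

lemma ext_ideal_augmentation:
  assumes "free_ideal A" and "p \<in> ext_ideal A"
  shows "Poly_Mapping.lookup p 0 = 0"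
  using free_ideal_carrier[OF assms(1), of "prune E p"] assms(2)
  by (simp add: ext_ideal_def carrier_free_lpa lookup_restrict_keys)

text \<open>For a local unit e of a, k a is congruent to a (k e) modulo the relations, and k e is an
  admissible multiplier.\<close>

lemma free_ideal_scal:
  assumes A: "free_ideal A" and "rel \<subseteq> A" and a: "a \<in> A"
  shows "scal k * a \<in> A"
proof -
  interpret R: lpa_congruence E "ext_ideal rel"
    by (rule lpa_congruence_ext_ideal[OF free_ideal_rel order_refl rel_scal])
  have carr: "a \<in> carr" using A a by (rule free_ideal_carrier)
  then obtain W where "finite W" and W: "R.cong a (a * (\<Sum>w\<in>W. vtx w))"
    using R.right_local_unit[of a] by (auto simp: carrier_free_lpa)
  \<comment> \<open>\<open>W\<close> is not known to consist of vertices of the graph; pruning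
    discards the foreign ones and leaves the congruence intact.\<close>
  define e :: "('k, 'v, 'e) free_alg" where "e = prune E (\<Sum>w\<in>W. vtx w)"
  have "e \<in> carr"
    by (auto simp: e_def carrier_free_lpa lookup_restrict_keys lookup_sum gen_def lookup_single zero_word_def
        restrict_keys_id keys_restrict_keys)
  have "a - a * e \<in> rel"
    using W[unfolded R.cong_def] carr by (simp add: ext_ideal_def restrict_keys_diff prune_mult e_def carrier_free_lpa)
  then have "scal k * (a - a * e) \<in> A" using rel_scal assms(2) by blast
  moreover have "a * (scal k * e) \<in> A"
    by (rule free_ideal_right[OF A a carr_scal[OF \<open>e \<in> carr\<close>]])
  ultimately have "scal k * (a - a * e) + a * (scal k * e) \<in> A"
    by (rule free_ideal_add[OF A])
  then show ?thesis by (simp add: right_diff_distrib scal_commute_left)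
qed


section \<open>Calculating with classes\<close>

lemma cls_def: "cls p = {n + p | n. n \<in> rel}"
  by (auto simp: lpa_class_def a_r_coset_def')

lemma cls_eq_iff: "cls p = cls q \<longleftrightarrow> p - q \<in> rel"
proof
  assume "cls p = cls q"
  moreover have "p \<in> cls p" using free_ideal_zero[OF free_ideal_rel] by (auto simp: cls_def)
  ultimately obtain n where "n \<in> rel" "p = n + q" by (auto simp: cls_def)
  then show "p - q \<in> rel" by simp
next
  assume pq: "p - q \<in> rel"
  have sub: "cls p \<subseteq> cls q" if "p - q \<in> rel" for p q
  proof
    fix x assume "x \<in> cls p"
    then obtain n where n: "n \<in> rel" "x = n + p" by (auto simp: cls_def)
    then have "x = (n + (p - q)) + q" "n + (p - q) \<in> rel"
      using free_ideal_add[OF free_ideal_rel n(1) that] by simp_all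
    then show "x \<in> cls q" unfolding cls_def by blast
  qed
  have "q - p \<in> rel" using free_ideal_uminus[OF free_ideal_rel pq] by simp
  with pq show "cls p = cls q" by (intro equalityI sub)
qed

lemma lpa_carrier: "carrier \<L> = cls ` carr"
  by (auto simp: leavitt_path_algebra_def ring.extend_def FactRing_def A_RCOSETS_def' lpa_class_def)

lemma lpa_zero: "\<zero>\<^bsub>\<L>\<^esub> = cls 0"
  by (simp add: leavitt_path_algebra_def ring.extend_def FactRing_def cls_def)

lemma lpa_add: "cls p \<oplus>\<^bsub>\<L>\<^esub> cls q = cls (p + q)"
proof -
  have "cls p \<oplus>\<^bsub>\<L>\<^esub> cls q = {x + y | x y. x \<in> cls p \<and> y \<in> cls q}"
    by (auto simp: leavitt_path_algebra_def ring.extend_def FactRing_def set_add_def')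
  also have "\<dots> = cls (p + q)"
  proof (intro equalityI subsetI)
    fix z assume "z \<in> {x + y | x y. x \<in> cls p \<and> y \<in> cls q}"
    then obtain n m where "n \<in> rel" "m \<in> rel" "z = (n + p) + (m + q)" by (auto simp: cls_def)
    then have "n + m \<in> rel" "z = (n + m) + (p + q)"
      by (simp_all add: free_ideal_add[OF free_ideal_rel])
    then show "z \<in> cls (p + q)" unfolding cls_def by blast
  next
    fix z assume "z \<in> cls (p + q)"
    then obtain n where n: "n \<in> rel" "z = (n + p) + (0 + q)" by (auto simp: cls_def add.assoc)
    moreover have "n + p \<in> cls p" "0 + q \<in> cls q"
      using n(1) free_ideal_zero[OF free_ideal_rel] unfolding cls_def by blast+
    ultimately show "z \<in> {x + y | x y. x \<in> cls p \<and> y \<in> cls q}" by blast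
  qed
  finally show ?thesis .
qed

text \<open>Unlike for sums, representatives in the carrier are demanded: \<open>rel\<close> absorbs
  only such factors.\<close>

lemma lpa_mult:
  assumes "p \<in> carr" and "q \<in> carr"
  shows "cls p \<otimes>\<^bsub>\<L>\<^esub> cls q = cls (p * q)"
proof -
  have "cls p \<otimes>\<^bsub>\<L>\<^esub> cls q = (\<Union>a\<in>cls p. \<Union>b\<in>cls q. cls (a * b))"
    by (simp add: leavitt_path_algebra_def ring.extend_def FactRing_def rcoset_mult_def lpa_class_def)
  also have "\<dots> = cls (p * q)"
  proof -
    have "cls (a * b) = cls (p * q)" if ab: "a \<in> cls p" "b \<in> cls q" for a b
    proof -
      obtain n where n: "n \<in> rel" "a = n + p" using ab(1) by (auto simp: cls_def)
      obtain m where m: "m \<in> rel" "b = m + q" using ab(2) by (auto simp: cls_def)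
      have b: "b \<in> carr"
        using carr_add[OF free_ideal_carrier[OF free_ideal_rel m(1)] assms(2)] m(2) by simp
      have "a * b - p * q = n * b + p * m"
        by (simp add: n(2) m(2) algebra_simps)
      then show ?thesis
        unfolding cls_eq_iff
        using free_ideal_add[OF free_ideal_rel free_ideal_right[OF free_ideal_rel n(1) b]
            free_ideal_left[OF free_ideal_rel m(1) assms(1)]] by simp
    qed
    moreover have "p \<in> cls p" "q \<in> cls q"
      using free_ideal_zero[OF free_ideal_rel] by (force simp: cls_def)+
    ultimately show ?thesis by blast
  qed
  finally show ?thesis .
qed

lemma abelian_group_lpa: "abelian_group \<L>"
proof (rule abelian_groupI)
  fix X assume "X \<in> carrier \<L>"
  then obtain p where p: "X = cls p" "p \<in> carr" by (auto simp: lpa_carrier)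
  then show "\<exists>Y\<in>carrier \<L>. Y \<oplus>\<^bsub>\<L>\<^esub> X = \<zero>\<^bsub>\<L>\<^esub>"
    by (intro bexI[of _ "cls (- p)"]) (simp_all add: lpa_add lpa_zero lpa_carrier carr_uminus)
qed (auto simp: lpa_carrier lpa_add lpa_zero ac_simps intro: carr_zero carr_add)

lemma lpa_uminus: "p \<in> carr \<Longrightarrow> \<ominus>\<^bsub>\<L>\<^esub> cls p = cls (- p)"
  using abelian_group.minus_equality[OF abelian_group_lpa, of "cls (- p)" "cls p"]
  by (simp add: lpa_add lpa_zero lpa_carrier carr_uminus)

lemma lpa_minus: "p \<in> carr \<Longrightarrow> q \<in> carr \<Longrightarrow> cls p \<ominus>\<^bsub>\<L>\<^esub> cls q = cls (p - q)"
  by (simp add: a_minus_def lpa_uminus lpa_add)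

lemma lpa_finsum:
  assumes "finite S" and "\<And>i. i \<in> S \<Longrightarrow> f i \<in> carr"
  shows "(\<Oplus>\<^bsub>\<L>\<^esub>i\<in>S. cls (f i)) = cls (sum f S)"
proof -
  interpret abelian_group \<L> by (rule abelian_group_lpa)
  show ?thesis
    using assms by (induction S rule: finite_induct) (auto simp: lpa_zero lpa_add lpa_carrier)
qed

section \<open>Ideals of the Leavitt path algebra and their preimages\<close>

definition preimage :: "('k, 'v, 'e) free_alg set set \<Rightarrow> ('k, 'v, 'e) free_alg set" where
  "preimage A = {p \<in> carr. cls p \<in> A}"

lemma preimage_iff: "p \<in> carr \<Longrightarrow> p \<in> preimage A \<longleftrightarrow> cls p \<in> A"
  by (simp add: preimage_def)

lemma
  assumes "two_sided_ideal \<L> A"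
  shows lpa_ideal_carrier: "X \<in> A \<Longrightarrow> X \<in> carrier \<L>"
    and lpa_ideal_zero: "\<zero>\<^bsub>\<L>\<^esub> \<in> A"
    and lpa_ideal_add: "X \<in> A \<Longrightarrow> Y \<in> A \<Longrightarrow> X \<oplus>\<^bsub>\<L>\<^esub> Y \<in> A"
    and lpa_ideal_uminus: "X \<in> A \<Longrightarrow> \<ominus>\<^bsub>\<L>\<^esub> X \<in> A"
    and lpa_ideal_left: "X \<in> A \<Longrightarrow> Y \<in> carrier \<L> \<Longrightarrow> Y \<otimes>\<^bsub>\<L>\<^esub> X \<in> A"
    and lpa_ideal_right: "X \<in> A \<Longrightarrow> Y \<in> carrier \<L> \<Longrightarrow> X \<otimes>\<^bsub>\<L>\<^esub> Y \<in> A"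
proof -
  have sub: "subgroup A (add_monoid \<L>)"
    using assms by (simp add: two_sided_ideal_def additive_subgroup_def)
  show "X \<in> A \<Longrightarrow> X \<in> carrier \<L>" using subgroup.subset[OF sub] by auto
  show "\<zero>\<^bsub>\<L>\<^esub> \<in> A" using subgroup.one_closed[OF sub] by simp
  show "X \<in> A \<Longrightarrow> Y \<in> A \<Longrightarrow> X \<oplus>\<^bsub>\<L>\<^esub> Y \<in> A" using subgroup.m_closed[OF sub] by simp
  show "X \<in> A \<Longrightarrow> \<ominus>\<^bsub>\<L>\<^esub> X \<in> A" using subgroup.m_inv_closed[OF sub] by (simp add: a_inv_def)
qed (use assms in \<open>simp_all add: two_sided_ideal_def\<close>)

lemma two_sided_idealI:
  assumes "A \<subseteq> carrier \<L>" and "\<zero>\<^bsub>\<L>\<^esub> \<in> A" and "\<And>X Y. X \<in> A \<Longrightarrow> Y \<in> A \<Longrightarrow> X \<oplus>\<^bsub>\<L>\<^esub> Y \<in> A"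
    and "\<And>X. X \<in> A \<Longrightarrow> \<ominus>\<^bsub>\<L>\<^esub> X \<in> A"
    and "\<And>X Y. X \<in> A \<Longrightarrow> Y \<in> carrier \<L> \<Longrightarrow> Y \<otimes>\<^bsub>\<L>\<^esub> X \<in> A"
    and "\<And>X Y. X \<in> A \<Longrightarrow> Y \<in> carrier \<L> \<Longrightarrow> X \<otimes>\<^bsub>\<L>\<^esub> Y \<in> A"
  shows "two_sided_ideal \<L> A"
proof -
  have "subgroup A (add_monoid \<L>)"
    using assms(1-4) by (intro subgroup.intro) (simp_all add: a_inv_def[symmetric])
  then show ?thesis
    using assms(5,6) by (simp add: two_sided_ideal_def additive_subgroup_def)
qed

lemma free_ideal_preimage:
  assumes A: "two_sided_ideal \<L> A"
  shows "free_ideal (preimage A)"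
  unfolding free_ideal_def
proof (intro conjI ballI)
  show "preimage A \<subseteq> carr" by (auto simp: preimage_def)
  show "0 \<in> preimage A"
    using lpa_ideal_zero[OF A] by (simp add: preimage_def carr_zero lpa_zero)
  show "p + q \<in> preimage A" if "p \<in> preimage A" "q \<in> preimage A" for p q
    using that lpa_ideal_add[OF A, of "cls p" "cls q"]
    by (simp add: preimage_def carr_add lpa_add)
  show "- p \<in> preimage A" if "p \<in> preimage A" for p
    using that lpa_ideal_uminus[OF A, of "cls p"]
    by (simp add: preimage_def carr_uminus lpa_uminus)
  show "x * p \<in> preimage A" "p * x \<in> preimage A" if "p \<in> preimage A" "x \<in> carr" for p x
    using that lpa_ideal_left[OF A, of "cls p" "cls x"] lpa_ideal_right[OF A, of "cls p" "cls x"]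
    by (simp_all add: preimage_def carr_mult lpa_mult lpa_carrier)
qed

lemma rel_preimage:
  assumes "two_sided_ideal \<L> A"
  shows "rel \<subseteq> preimage A"
proof
  fix n assume n: "n \<in> rel"
  then have "cls n = \<zero>\<^bsub>\<L>\<^esub>" unfolding lpa_zero cls_eq_iff by simp
  then show "n \<in> preimage A"
    using free_ideal_carrier[OF free_ideal_rel n] lpa_ideal_zero[OF assms] by (simp add: preimage_def)
qed

lemma two_sided_ideal_image:
  assumes A: "free_ideal A"
  shows "two_sided_ideal \<L> (cls ` A)"
proof (rule two_sided_idealI)
  have carr: "a \<in> carr" if "a \<in> A" for a by (rule free_ideal_carrier[OF A that])
  show "cls ` A \<subseteq> carrier \<L>" using carr by (auto simp: lpa_carrier)
  show "\<zero>\<^bsub>\<L>\<^esub> \<in> cls ` A" using free_ideal_zero[OF A] by (simp add: lpa_zero)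
  show "X \<oplus>\<^bsub>\<L>\<^esub> Y \<in> cls ` A" if "X \<in> cls ` A" "Y \<in> cls ` A" for X Y
    using that free_ideal_add[OF A] by (auto simp: lpa_add)
  show "\<ominus>\<^bsub>\<L>\<^esub> X \<in> cls ` A" if "X \<in> cls ` A" for X
    using that carr free_ideal_uminus[OF A] by (auto simp: lpa_uminus)
  show "Y \<otimes>\<^bsub>\<L>\<^esub> X \<in> cls ` A" "X \<otimes>\<^bsub>\<L>\<^esub> Y \<in> cls ` A" if "X \<in> cls ` A" "Y \<in> carrier \<L>" for X Y
    using that carr free_ideal_left[OF A] free_ideal_right[OF A] by (auto simp: lpa_carrier lpa_mult)
qed

lemma cls_image_iff:
  assumes "free_ideal A" and "rel \<subseteq> A"
  shows "cls p \<in> cls ` A \<longleftrightarrow> p \<in> A"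
  using free_ideal_cong[OF assms(1), of p] assms(2) by (auto simp: cls_eq_iff)

section \<open>Graded ideals and homogeneous preimages\<close>

lemma lpa_component_iff:
  "X \<in> lpa_component E n \<longleftrightarrow> (\<exists>p\<in>carr. homogeneous n p \<and> X = cls p)"
  by (auto simp: lpa_component_def homogeneous_def)

text \<open>The components of L are independent because \<open>rel\<close> is homogeneous: the
  difference of two representatives lies in \<open>rel\<close>, and so does each of its
  parts.\<close>

lemma graded_decomposition_unique:
  assumes p: "p \<in> carr" and f: "\<forall>n. f n \<in> lpa_component E n"
    and fin: "finite {n. f n \<noteq> \<zero>\<^bsub>\<L>\<^esub>}"
    and sum: "cls p = (\<Oplus>\<^bsub>\<L>\<^esub>n\<in>{n. f n \<noteq> \<zero>\<^bsub>\<L>\<^esub>}. f n)"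
  shows "f m = cls (hom_part m p)"
proof -
  obtain q where q: "\<And>n. q n \<in> carr" "\<And>n. homogeneous n (q n)" "\<And>n. f n = cls (q n)"
    using f unfolding lpa_component_iff by metis
  let ?D = "{n. f n \<noteq> \<zero>\<^bsub>\<L>\<^esub>}"
  have f_eq: "f = (\<lambda>n. cls (q n))" using q(3) by (rule ext)
  have "cls p = cls (sum q ?D)"
    using lpa_finsum[OF fin, of q] q(1) sum unfolding f_eq by simp
  then have "p - sum q ?D \<in> rel" by (simp add: cls_eq_iff)
  then have "hom_part m (p - sum q ?D) \<in> rel"
    using rel_homogeneous by (simp add: homogeneous_closed_def)
  moreover have "hom_part m (sum q ?D) = (if m \<in> ?D then q m else 0)"
    using fin by (simp add: restrict_keys_sum hom_part_homogeneous[OF q(2)])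
  ultimately have "hom_part m p - (if m \<in> ?D then q m else 0) \<in> rel"
    by (simp add: restrict_keys_diff)
  then have "cls (hom_part m p) = cls (if m \<in> ?D then q m else 0)"
    by (simp add: cls_eq_iff)
  then show ?thesis using q(3)[of m] by (cases "m \<in> ?D") (auto simp: lpa_zero)
qed

lemma graded_ideal_imp_homogeneous:
  assumes "graded_ideal E A"
  shows "homogeneous_closed (preimage A)"
  unfolding homogeneous_closed_def
proof (intro ballI allI)
  fix p m assume p: "p \<in> preimage A"
  then have carr: "p \<in> carr" and "cls p \<in> A" by (simp_all add: preimage_def)
  then obtain f :: "int \<Rightarrow> ('k, 'v, 'e) free_alg set" where
    f: "\<forall>n. f n \<in> A \<inter> lpa_component E n" "finite {n. f n \<noteq> \<zero>\<^bsub>\<L>\<^esub>}"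
      "cls p = (\<Oplus>\<^bsub>\<L>\<^esub>n\<in>{n. f n \<noteq> \<zero>\<^bsub>\<L>\<^esub>}. f n)"
    using assms unfolding graded_ideal_def by (meson ex1_implies_ex)
  have "f m = cls (hom_part m p)"
    using f by (intro graded_decomposition_unique[OF carr]) auto
  moreover have "f m \<in> A" using f(1) by blast
  ultimately show "hom_part m p \<in> preimage A"
    using carr_hom_part[OF carr] by (simp add: preimage_def)
qed

lemma homogeneous_imp_graded_ideal:
  assumes A: "two_sided_ideal \<L> A" and hom: "homogeneous_closed (preimage A)"
  shows "graded_ideal E A"
  unfolding graded_ideal_def
proof (intro conjI ballI ex_ex1I)
  fix X assume "X \<in> A"
  then obtain p where p: "p \<in> carr" "X = cls p" "p \<in> preimage A"
    using lpa_ideal_carrier[OF A] by (auto simp: lpa_carrier preimage_def)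
  define f where "f n = cls (hom_part n p)" for n
  define D where "D = word_degree ` Poly_Mapping.keys p"
  let ?S = "{n. f n \<noteq> \<zero>\<^bsub>\<L>\<^esub>}"
  have part: "hom_part n p \<in> carr" for n
    by (rule carr_hom_part[OF p(1)])
  have D: "finite D" "?S \<subseteq> D"
  proof -
    show "finite D" by (simp add: D_def)
    show "?S \<subseteq> D"
    proof
      fix n assume "n \<in> ?S"
      then have "hom_part n p \<noteq> 0" by (auto simp: f_def lpa_zero)
      then show "n \<in> D"
        using restrict_keys_eq_zero[of p "\<lambda>w. word_degree w = n"] by (auto simp: D_def)
    qed
  qed
  then have fin: "finite ?S" using finite_subset by blast
  \<comment> \<open>A nonzero part of p can have class zero. The sum in \<open>graded_ideal\<close>
    skips such degrees, so their contribution has to be shown to lie in \<open>rel\<close>.\<close>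
  have "(\<Sum>n\<in>D - ?S. hom_part n p) \<in> rel"
  proof (rule free_ideal_sum[OF free_ideal_rel])
    fix n assume "n \<in> D - ?S"
    then have "cls (hom_part n p) = cls 0" by (simp add: f_def lpa_zero)
    then show "hom_part n p \<in> rel" by (simp add: cls_eq_iff)
  qed
  moreover have "p = (\<Sum>n\<in>D - ?S. hom_part n p) + (\<Sum>n\<in>?S. hom_part n p)"
    using sum_hom_parts[of D p] D sum.subset_diff[of ?S D "\<lambda>n. hom_part n p"]
    by (simp add: D_def)
  ultimately have "p - (\<Sum>n\<in>?S. hom_part n p) \<in> rel"
    by (metis add_diff_cancel_right')
  then have "cls p = cls (\<Sum>n\<in>?S. hom_part n p)" by (simp add: cls_eq_iff)
  also have "\<dots> = (\<Oplus>\<^bsub>\<L>\<^esub>n\<in>?S. f n)"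
    unfolding f_def using lpa_finsum[OF fin part] by (simp add: f_def)
  finally have "X = (\<Oplus>\<^bsub>\<L>\<^esub>n\<in>?S. f n)" by (simp add: p(2))
  moreover have "\<forall>n. f n \<in> A \<inter> lpa_component E n"
  proof
    fix n
    have "hom_part n p \<in> preimage A" using hom p(3) by (simp add: homogeneous_closed_def)
    then show "f n \<in> A \<inter> lpa_component E n"
      using part[of n] homogeneous_hom_part[of n p] by (auto simp: f_def preimage_def lpa_component_iff)
  qed
  ultimately show "\<exists>f. (\<forall>n. f n \<in> A \<inter> lpa_component E n) \<and> finite {n. f n \<noteq> \<zero>\<^bsub>\<L>\<^esub>} \<and>
      X = (\<Oplus>\<^bsub>\<L>\<^esub>n\<in>{n. f n \<noteq> \<zero>\<^bsub>\<L>\<^esub>}. f n)"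
    using fin by blast
  fix g h :: "int \<Rightarrow> ('k, 'v, 'e) free_alg set"
  assume g: "(\<forall>n. g n \<in> A \<inter> lpa_component E n) \<and> finite {n. g n \<noteq> \<zero>\<^bsub>\<L>\<^esub>} \<and>
      X = (\<Oplus>\<^bsub>\<L>\<^esub>n\<in>{n. g n \<noteq> \<zero>\<^bsub>\<L>\<^esub>}. g n)"
    and h: "(\<forall>n. h n \<in> A \<inter> lpa_component E n) \<and> finite {n. h n \<noteq> \<zero>\<^bsub>\<L>\<^esub>} \<and>
      X = (\<Oplus>\<^bsub>\<L>\<^esub>n\<in>{n. h n \<noteq> \<zero>\<^bsub>\<L>\<^esub>}. h n)"
  have "g n = cls (hom_part n p)" for n
    using g by (intro graded_decomposition_unique[OF p(1)]) (auto simp: p(2)[symmetric])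
  moreover have "h n = cls (hom_part n p)" for n
    using h by (intro graded_decomposition_unique[OF p(1)]) (auto simp: p(2)[symmetric])
  ultimately show "g = h" by (intro ext) simp
qed (rule A)

lemma two_sided_ideal_generated:
  assumes "X \<subseteq> carrier \<L>"
  shows "two_sided_ideal \<L> (ideal_generated \<L> X)"
proof (rule two_sided_idealI)
  let ?C = "{A. two_sided_ideal \<L> A \<and> X \<subseteq> A}"
  have "two_sided_ideal \<L> (carrier \<L>)"
    using two_sided_ideal_image[OF free_ideal_carr] by (simp add: lpa_carrier)
  then show "ideal_generated \<L> X \<subseteq> carrier \<L>"
    using assms by (auto simp: ideal_generated_def)
qed (auto simp: ideal_generated_def intro: lpa_ideal_zero lpa_ideal_add lpa_ideal_uminus lpa_ideal_left lpa_ideal_right)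

text \<open>The elements of the preimage with all parts in it form an ideal containing the relations
  and the homogeneous generators, hence everything.\<close>

lemma generated_homogeneous:
  assumes X: "X \<subseteq> carr" and hom: "\<And>x. x \<in> X \<Longrightarrow> \<exists>d. homogeneous d x"
  shows "homogeneous_closed (preimage (ideal_generated \<L> (cls ` X)))"
proof -
  let ?I = "ideal_generated \<L> (cls ` X)"
  have I: "two_sided_ideal \<L> ?I"
    using X by (intro two_sided_ideal_generated) (auto simp: lpa_carrier)
  note P = free_ideal_preimage[OF I]
  define B where "B = {a \<in> preimage ?I. \<forall>n. hom_part n a \<in> preimage ?I}"
  have B: "free_ideal B" unfolding B_def by (rule free_ideal_homogeneous_core[OF P])
  have "rel \<subseteq> B"
    using rel_preimage[OF I] rel_homogeneous by (auto simp: B_def homogeneous_closed_def)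
  have "x \<in> B" if x: "x \<in> X" for x
  proof -
    have "x \<in> preimage ?I" using X x by (auto simp: preimage_def ideal_generated_def)
    moreover obtain d where "homogeneous d x" using hom[OF x] by blast
    ultimately show ?thesis
      using free_ideal_zero[OF P] by (simp add: B_def hom_part_homogeneous)
  qed
  then have "?I \<subseteq> cls ` B"
    using two_sided_ideal_image[OF B] by (auto simp: ideal_generated_def)
  then have "preimage ?I \<subseteq> B"
    using cls_image_iff[OF B \<open>rel \<subseteq> B\<close>] by (auto simp: preimage_def)
  then show ?thesis by (auto simp: B_def homogeneous_closed_def)
qed

lemma break_elem_carrier:
  assumes "v \<in> breaking_vertices E H"
  shows "break_elem E H v \<in> carr"
  unfolding break_elem_def using assms
  by (intro carr_diff carr_sum carr_mult carr_letters)
     (auto simp: breaking_vertices_def arcs_leaving_def)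

lemma breaking_element_cls:
  assumes v: "v \<in> breaking_vertices E H"
  shows "breaking_element E H v = cls (break_elem E H v)"
proof -
  have arcs: "e \<in> arcs E" if "e \<in> arcs_leaving E H v" for e
    using that by (auto simp: arcs_leaving_def)
  have fin: "finite (arcs_leaving E H v)" and vert: "v \<in> verts E"
    using v by (auto simp: breaking_vertices_def)
  have term_carrier: "edg e * gho e \<in> carr" if "e \<in> arcs_leaving E H v" for e
    by (intro carr_mult carr_letters arcs[OF that])
  interpret abelian_group \<L> by (rule abelian_group_lpa)
  have "(\<Oplus>\<^bsub>\<L>\<^esub>e\<in>arcs_leaving E H v. lpa_edge E e \<otimes>\<^bsub>\<L>\<^esub> lpa_ghost E e) =
      (\<Oplus>\<^bsub>\<L>\<^esub>e\<in>arcs_leaving E H v. cls (edg e * gho e))"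
    using arcs term_carrier
    by (intro finsum_cong') (auto simp: lpa_mult carr_letters lpa_carrier)
  also have "\<dots> = cls (\<Sum>e\<in>arcs_leaving E H v. edg e * gho e)"
    by (rule lpa_finsum[OF fin term_carrier])
  finally show ?thesis
    unfolding breaking_element_def break_elem_def
    using lpa_minus[OF carr_letters(1)[OF vert] carr_sum[OF term_carrier]] by simp
qed

lemma homogeneous_break_elem: "homogeneous 0 (break_elem E H v)"
  unfolding break_elem_def
  by (intro homogeneous_diff homogeneous_letters homogeneous_sum homogeneous_products)

lemma lpa_congruence_preimage:
  assumes A: "two_sided_ideal \<L> A"
  shows "lpa_congruence E (ext_ideal (preimage A))"
  using free_ideal_preimage[OF A] rel_preimage[OF A] free_ideal_scal
  by (intro lpa_congruence_ext_ideal) auto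

lemma ring_ideal_preimage: "two_sided_ideal \<L> A \<Longrightarrow> ring_ideal (ext_ideal (preimage A))"
  using lpa_congruence.ideal_J[OF lpa_congruence_preimage] .

lemma ext_preimage_iff: "p \<in> carr \<Longrightarrow> p \<in> ext_ideal (preimage A) \<longleftrightarrow> cls p \<in> A"
  by (simp add: ext_ideal_iff preimage_iff)

lemma ext_preimage_mono: "A \<subseteq> B \<Longrightarrow> ext_ideal (preimage A) \<subseteq> ext_ideal (preimage B)"
  by (auto simp: ext_ideal_def preimage_def)

lemma ext_preimage_mono_iff:
  assumes "two_sided_ideal \<L> A" and "ext_ideal (preimage A) \<subseteq> ext_ideal (preimage B)"
  shows "A \<subseteq> B"
proof
  fix X assume "X \<in> A"
  moreover obtain p where "p \<in> carr" "X = cls p"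
    using lpa_ideal_carrier[OF assms(1) \<open>X \<in> A\<close>] by (auto simp: lpa_carrier)
  ultimately show "X \<in> B" using assms(2) ext_preimage_iff by blast
qed

section \<open>Products and powers of ideals\<close>

lemma
  assumes "X \<in> carrier \<L>" and "Y \<in> carrier \<L>" and "Z \<in> carrier \<L>"
  shows lpa_assoc: "(X \<otimes>\<^bsub>\<L>\<^esub> Y) \<otimes>\<^bsub>\<L>\<^esub> Z = X \<otimes>\<^bsub>\<L>\<^esub> (Y \<otimes>\<^bsub>\<L>\<^esub> Z)"
    and lpa_distrib_left: "X \<otimes>\<^bsub>\<L>\<^esub> (Y \<oplus>\<^bsub>\<L>\<^esub> Z) = X \<otimes>\<^bsub>\<L>\<^esub> Y \<oplus>\<^bsub>\<L>\<^esub> X \<otimes>\<^bsub>\<L>\<^esub> Z"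
    and lpa_distrib_right: "(Y \<oplus>\<^bsub>\<L>\<^esub> Z) \<otimes>\<^bsub>\<L>\<^esub> X = Y \<otimes>\<^bsub>\<L>\<^esub> X \<oplus>\<^bsub>\<L>\<^esub> Z \<otimes>\<^bsub>\<L>\<^esub> X"
    and lpa_uminus_mult: "\<ominus>\<^bsub>\<L>\<^esub> (X \<otimes>\<^bsub>\<L>\<^esub> Y) = (\<ominus>\<^bsub>\<L>\<^esub> X) \<otimes>\<^bsub>\<L>\<^esub> Y"
    and lpa_mult_closed: "X \<otimes>\<^bsub>\<L>\<^esub> Y \<in> carrier \<L>"
  using assms
  by (auto simp: lpa_carrier lpa_mult lpa_add lpa_uminus carr_mult carr_add
      carr_uminus mult.assoc distrib_left distrib_right)

lemma two_sided_ideal_prod: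
  assumes A: "two_sided_ideal \<L> A" and B: "two_sided_ideal \<L> B"
  shows "two_sided_ideal \<L> (ideal_prod \<L> A B)"
proof -
  interpret abelian_group \<L> by (rule abelian_group_lpa)
  note carr = lpa_ideal_carrier[OF A] lpa_ideal_carrier[OF B]
  have closed: "X \<in> carrier \<L>" if "X \<in> ideal_prod \<L> A B" for X
    using that by induction (auto intro: carr lpa_mult_closed)
  show ?thesis
  proof (rule two_sided_idealI)
    show "ideal_prod \<L> A B \<subseteq> carrier \<L>" using closed by blast
    have "\<zero>\<^bsub>\<L>\<^esub> \<otimes>\<^bsub>\<L>\<^esub> \<zero>\<^bsub>\<L>\<^esub> \<in> ideal_prod \<L> A B"
      by (intro ideal_prod.prod lpa_ideal_zero A B)
    then show "\<zero>\<^bsub>\<L>\<^esub> \<in> ideal_prod \<L> A B"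
      by (simp add: lpa_zero lpa_mult carr_zero)
    show "X \<oplus>\<^bsub>\<L>\<^esub> Y \<in> ideal_prod \<L> A B" if "X \<in> ideal_prod \<L> A B" "Y \<in> ideal_prod \<L> A B" for X Y
      using that by (rule ideal_prod.sum)
    show "\<ominus>\<^bsub>\<L>\<^esub> X \<in> ideal_prod \<L> A B" if "X \<in> ideal_prod \<L> A B" for X
      using that
    proof induction
      case (prod i j)
      then show ?case
        using lpa_uminus_mult[OF carr(1) carr(2) carr(2), of i j j] lpa_ideal_uminus[OF A]
        by (auto intro: ideal_prod.prod)
    next
      case (sum s1 s2)
      then show ?case using closed by (auto simp: minus_add intro: ideal_prod.sum)
    qed
    fix X Y assume X: "X \<in> ideal_prod \<L> A B" and Y: "Y \<in> carrier \<L>"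
    show "Y \<otimes>\<^bsub>\<L>\<^esub> X \<in> ideal_prod \<L> A B"
      using X
    proof induction
      case (prod i j)
      then show ?case
        using lpa_assoc[OF Y carr(1) carr(2), of i j] lpa_ideal_left[OF A _ Y]
        by (metis ideal_prod.prod)
    next
      case (sum s1 s2)
      then show ?case
        using lpa_distrib_left[OF Y, of s1 s2] closed by (auto intro: ideal_prod.sum)
    qed
    show "X \<otimes>\<^bsub>\<L>\<^esub> Y \<in> ideal_prod \<L> A B"
      using X
    proof induction
      case (prod i j)
      then show ?case
        using lpa_assoc[OF carr(1) carr(2) Y, of i j] lpa_ideal_right[OF B _ Y]
        by (metis ideal_prod.prod)
    next
      case (sum s1 s2)
      then show ?case
        using lpa_distrib_right[OF Y, of s1 s2] closed by (auto intro: ideal_prod.sum)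
    qed
  qed
qed

lemma two_sided_ideal_power:
  assumes "two_sided_ideal \<L> A"
  shows "two_sided_ideal \<L> (ideal_power \<L> A (Suc n))"
proof (induction n)
  case (Suc n)
  then show ?case using assms by (simp add: two_sided_ideal_prod)
qed (use assms in simp)

lemma idempotent_in_power:
  assumes "X \<in> A" and "X \<otimes>\<^bsub>\<L>\<^esub> X = X"
  shows "X \<in> ideal_power \<L> A (Suc n)"
proof (induction n)
  case (Suc n)
  then have "X \<otimes>\<^bsub>\<L>\<^esub> X \<in> ideal_power \<L> A (Suc (Suc n))"
    using assms(1) by (auto intro: ideal_prod.prod)
  then show ?case by (simp only: assms(2))
qed (use assms in simp)

lemma vertex_idempotent:
  assumes "v \<in> verts E"
  shows "cls (vtx v) \<otimes>\<^bsub>\<L>\<^esub> cls (vtx v) = cls (vtx v)"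
proof -
  have "vtx v * vtx v - vtx v \<in> (lpa_relators E :: ('k, 'v, 'e) free_alg set)"
    using assms unfolding lpa_relators_def by blast
  from scal_relator_rel[OF this, of 1] show ?thesis
    using assms by (simp add: lpa_mult carr_letters cls_eq_iff)
qed

lemma ideal_prod_sum_list:
  assumes A: "two_sided_ideal \<L> A" and B: "two_sided_ideal \<L> B" and X: "X \<in> ideal_prod \<L> A B"
  shows "\<exists>l. set l \<subseteq> preimage A \<times> preimage B \<and> X = cls (\<Sum>(x, y)\<leftarrow>l. x * y)"
  using X
proof induction
  case (prod i j)
  obtain p where p: "p \<in> carr" "i = cls p"
    using lpa_ideal_carrier[OF A prod(1)] by (auto simp: lpa_carrier)
  obtain q where q: "q \<in> carr" "j = cls q"
    using lpa_ideal_carrier[OF B prod(2)] by (auto simp: lpa_carrier)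
  show ?case
    using prod p q by (intro exI[of _ "[(p, q)]"]) (simp add: preimage_def lpa_mult)
next
  case (sum s1 s2)
  then obtain l1 l2 where "set l1 \<subseteq> preimage A \<times> preimage B" "s1 = cls (\<Sum>(x, y)\<leftarrow>l1. x * y)"
    "set l2 \<subseteq> preimage A \<times> preimage B" "s2 = cls (\<Sum>(x, y)\<leftarrow>l2. x * y)" by blast
  then show ?case by (intro exI[of _ "l1 @ l2"]) (simp add: lpa_add)
qed

section \<open>Transfer to the Leavitt path algebra\<close>

theorem intersection_of_powers:
  assumes I: "two_sided_ideal \<L> I"
    and H: "H = {v \<in> verts E. cls (vtx v) \<in> I}"
    and S: "S = {v \<in> breaking_vertices E H. breaking_element E H v \<in> I}"
  defines "J \<equiv> (ideal_HS E H S :: ('k, 'v, 'e) free_alg set set)"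
  shows "(\<Inter>n\<in>{1..}. ideal_power \<L> I n) = J" and "graded_ideal E J" and "J \<subseteq> I"
    and "\<And>T. graded_ideal E T \<Longrightarrow> T \<subseteq> I \<Longrightarrow> T \<subseteq> J"
proof -
  define X :: "('k, 'v, 'e) free_alg set" where "X = vtx ` H \<union> break_elem E H ` S"
  have X_carrier: "X \<subseteq> carr"
    using carr_letters(1) break_elem_carrier by (auto simp: X_def H S)
  have "breaking_element E H ` S = cls ` break_elem E H ` S"
    unfolding image_image using breaking_element_cls by (intro image_cong) (auto simp: S)
  then have J_X: "J = ideal_generated \<L> (cls ` X)"
    by (simp add: J_def ideal_HS_def X_def image_Un image_image)
  have J: "two_sided_ideal \<L> J"
    unfolding J_X using X_carrier by (intro two_sided_ideal_generated) (auto simp: lpa_carrier)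
  have X_J: "cls x \<in> J" if "x \<in> X" for x
    using that by (auto simp: J_X ideal_generated_def)
  have X_I: "cls x \<in> I" if "x \<in> X" for x
    using that breaking_element_cls[of _ H] by (auto simp: X_def H S)
  have J_least: "J \<subseteq> A" if "two_sided_ideal \<L> A" "\<And>x. x \<in> X \<Longrightarrow> cls x \<in> A" for A
    using that by (auto simp: J_X ideal_generated_def)
  show J_I: "J \<subseteq> I" by (rule J_least[OF I X_I])
  have J_hom: "homogeneous_closed (preimage J)"
    unfolding J_X
  proof (rule generated_homogeneous[OF X_carrier])
    fix x assume "x \<in> X"
    then show "\<exists>d. homogeneous d x"
      using homogeneous_letters(1) homogeneous_break_elem by (auto simp: X_def)
  qed
  show "graded_ideal E J" by (rule homogeneous_imp_graded_ideal[OF J J_hom])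
  interpret J: lpa_congruence E "ext_ideal (preimage J)"
    by (rule lpa_congruence_preimage[OF J])
  interpret P: leavitt_ideal_pair E "ext_ideal (preimage J)" "ext_ideal (preimage I)" H
  proof unfold_locales
    show "ring_ideal (ext_ideal (preimage I))" by (rule ring_ideal_preimage[OF I])
    show "ext_ideal (preimage J) \<subseteq> ext_ideal (preimage I)" by (rule ext_preimage_mono[OF J_I])
    show "Poly_Mapping.lookup p 0 = 0" if "p \<in> ext_ideal (preimage I)" for p
      by (rule ext_ideal_augmentation[OF free_ideal_preimage[OF I] that])
    show "homogeneous_closed (ext_ideal (preimage J))"
      by (rule homogeneous_closed_ext_ideal[OF J_hom])
    show "H = {v \<in> verts E. vtx v \<in> ext_ideal (preimage I)}"
      unfolding H using ext_preimage_iff[OF carr_letters(1)] by blast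
    show "vtx v \<in> ext_ideal (preimage J)" if "v \<in> H" for v
    proof -
      have "v \<in> verts E" using that by (simp add: H)
      moreover have "cls (vtx v) \<in> J" using that by (intro X_J) (simp add: X_def)
      ultimately show ?thesis using ext_preimage_iff[OF carr_letters(1)] by blast
    qed
    show "break_elem E H v \<in> ext_ideal (preimage J)"
      if v: "v \<in> breaking_vertices E H" "break_elem E H v \<in> ext_ideal (preimage I)" for v
    proof -
      have "v \<in> S"
        using v ext_preimage_iff[OF break_elem_carrier[OF v(1)]] breaking_element_cls[OF v(1)]
        by (simp add: S)
      then have "cls (break_elem E H v) \<in> J" by (intro X_J) (simp add: X_def)
      then show ?thesis using ext_preimage_iff[OF break_elem_carrier[OF v(1)]] by blast
    qed
  qed
  show "T \<subseteq> J" if T: "graded_ideal E T" "T \<subseteq> I" for T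
  proof -
    have "two_sided_ideal \<L> T" using T(1) by (simp add: graded_ideal_def)
    moreover have "ext_ideal (preimage T) \<subseteq> ext_ideal (preimage J)"
      by (intro P.graded_subset_J ring_ideal_preimage ext_preimage_mono T
          homogeneous_closed_ext_ideal graded_ideal_imp_homogeneous calculation)
    ultimately show ?thesis by (rule ext_preimage_mono_iff)
  qed
  have idem: "cls x \<otimes>\<^bsub>\<L>\<^esub> cls x = cls x" if "x \<in> X" for x
  proof -
    from that consider v where "v \<in> H" "x = vtx v" | v where "v \<in> S" "x = break_elem E H v"
      by (auto simp: X_def)
    then show ?thesis
    proof cases
      case 1
      then show ?thesis by (simp add: H vertex_idempotent)
    next
      case 2
      \<comment> \<open>Idempotence is an equation in \<open>L\<close> itself, so the calculation is
        made modulo the relations alone and not modulo \<open>J\<close>.\<close>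
      interpret R: lpa_congruence E "ext_ideal rel"
        by (rule lpa_congruence_ext_ideal[OF free_ideal_rel order_refl rel_scal])
      have v: "v \<in> breaking_vertices E H" "finite (arcs_leaving E H v)"
        using 2(1) by (auto simp: S breaking_vertices_def)
      let ?b = "break_elem E H v :: ('k, 'v, 'e) free_alg"
      have b: "?b \<in> carr" by (rule break_elem_carrier[OF v(1)])
      have "?b * ?b - ?b \<in> ext_ideal rel"
        using R.break_elem_idem[OF v(2)] by (simp add: R.cong_def)
      then have "?b * ?b - ?b \<in> rel"
        using ext_ideal_iff[OF carr_diff[OF carr_mult[OF b b] b]] by blast
      then show ?thesis using b by (simp add: 2(2) lpa_mult cls_eq_iff)
    qed
  qed
  show "(\<Inter>n\<in>{1..}. ideal_power \<L> I n) = J"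
  proof (intro equalityI)
    have pow: "two_sided_ideal \<L> (ideal_power \<L> I n)" if "n \<in> {1..}" for n
      using two_sided_ideal_power[OF I, of "n - 1"] that by simp
    show "J \<subseteq> (\<Inter>n\<in>{1..}. ideal_power \<L> I n)"
    proof (rule INT_greatest)
      fix n :: nat assume n: "n \<in> {1..}"
      then obtain m where m: "n = Suc m" by (cases n) auto
      show "J \<subseteq> ideal_power \<L> I n"
        unfolding m by (intro J_least two_sided_ideal_power I idempotent_in_power X_I idem)
    qed
    \<comment> \<open>The index is shifted because exponent 0 would give the whole algebra.\<close>
    define T where "T n = ext_ideal (preimage (ideal_power \<L> I (Suc n)))" for n
    have "(\<Inter>n. T n) \<subseteq> ext_ideal (preimage J)"
    proof (rule P.intersection_subset_J)
      show "T 0 = ext_ideal (preimage I)" by (simp add: T_def)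
      show "ring_ideal (T n)" for n
        unfolding T_def by (intro ring_ideal_preimage two_sided_ideal_power I)
      fix n z assume z: "z \<in> T (Suc n)"
      then have z': "prune E z \<in> carr" "cls (prune E z) \<in> ideal_prod \<L> (ideal_power \<L> I (Suc n)) I"
        by (auto simp: T_def ext_ideal_def preimage_def)
      obtain l where l: "set l \<subseteq> preimage (ideal_power \<L> I (Suc n)) \<times> preimage I"
        "cls (prune E z) = cls (\<Sum>(x, y)\<leftarrow>l. x * y)"
        using ideal_prod_sum_list[OF two_sided_ideal_power[OF I] I z'(2)] by blast
      have "prune E z - (\<Sum>(x, y)\<leftarrow>l. x * y) \<in> rel"
        using l(2) by (simp only: cls_eq_iff)
      then have 1: "J.cong (prune E z) (\<Sum>(x, y)\<leftarrow>l. x * y)"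
        using rel_preimage[OF J] free_ideal_carrier[OF free_ideal_rel] ext_ideal_iff
        unfolding J.cong_def by blast
      \<comment> \<open>An element of an extended ideal may involve foreign letters. Pruning removes
        only words containing such letters, which lie in every extended ideal.\<close>
      have 2: "J.cong z (prune E z)"
        unfolding J.cong_def
        using free_ideal_zero[OF free_ideal_preimage[OF J]] by (simp add: ext_ideal_def restrict_keys_diff)
      have sub: "preimage A \<subseteq> ext_ideal (preimage A)" for A
        using ext_ideal_iff by (auto simp: preimage_def)
      have "set l \<subseteq> T n \<times> ext_ideal (preimage I)"
        using l(1) sub unfolding T_def by blast
      then show "\<exists>l. set l \<subseteq> T n \<times> ext_ideal (preimage I) \<and> J.cong z (\<Sum>(x, y)\<leftarrow>l. x * y)"
        using J.cong_trans[OF 2 1] by blast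
    qed
    moreover have "Y \<in> J" if Y: "Y \<in> (\<Inter>n\<in>{1..}. ideal_power \<L> I n)"
      and sub: "(\<Inter>n. T n) \<subseteq> ext_ideal (preimage J)" for Y
    proof -
      have Y': "Y \<in> ideal_power \<L> I (Suc n)" for n by (rule INT_D[OF Y]) simp
      then have "Y \<in> carrier \<L>" using lpa_ideal_carrier[OF I] Y'[of 0] by simp
      then obtain p where p: "p \<in> carr" "Y = cls p" by (auto simp: lpa_carrier)
      have "p \<in> T n" for n
        using Y'[of n] p(2) ext_preimage_iff[OF p(1), of "ideal_power \<L> I (Suc n)"] by (simp add: T_def)
      then have "p \<in> ext_ideal (preimage J)" using sub by blast
      then show ?thesis using ext_preimage_iff[OF p(1)] p(2) by blast
    qed
    ultimately show "(\<Inter>n\<in>{1..}. ideal_power \<L> I n) \<subseteq> J" by blast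
  qed
qed

end

theorem theorem3p6:
  fixes E :: "('v, 'e) pre_digraph"
    and L :: "('k::field, ('k, 'v, 'e) free_alg set) module"
    and I :: "('k, 'v, 'e) free_alg set set"
    and H S :: "'v set"
  assumes "wf_digraph E"
    and "L = leavitt_path_algebra E"
    and "two_sided_ideal L I"
    and "\<not> graded_ideal E I"
    and "H = {v \<in> verts E. lpa_vertex E v \<in> I}"
    and "S = {v \<in> breaking_vertices E H. breaking_element E H v \<in> I}"
  shows "(\<Inter>n \<in> {1..}. ideal_power L I n) = ideal_HS E H S \<and>
    graded_ideal E (ideal_HS E H S :: ('k, 'v, 'e) free_alg set set) \<and>
    (ideal_HS E H S :: ('k, 'v, 'e) free_alg set set) \<subseteq> I \<and>
    (\<forall>J. graded_ideal E J \<and> J \<subseteq> I \<longrightarrow> J \<subseteq> ideal_HS E H S)"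
proof -
  interpret leavitt E "TYPE('k)"
    using assms(1) by (rule leavitt.intro)
  note * = intersection_of_powers[OF assms(3)[unfolded assms(2)] assms(5,6)]
  show ?thesis
    unfolding assms(2) using * by blast
qed

end
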